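(* Let $p\ge 1$, let $X\in\mathbb R^p$ have density $f(\|x-\theta\|)$, and consider estimating $\theta\in\mathbb R^p$ under the loss $L_Q(\theta,\delta)=(\delta-\theta)'Q(\delta-\theta)$ with $Q$ a positive definite matrix. Let $g(\theta)=G(\|\theta\|_d)$ with $G:(0,\infty)\to(0,\infty)$, and let $\delta_g$ be the generalized Bayes estimator with respect to $g$. The conditions G1, G1', G1'', G2, G3, F1, FG1 (with constants $t_1\le t_2$, $t_3\le t_4$, $\gamma$, $s$) are those listed in the context. 1. Assume G1, G2, G3, F1 and FG1. If $s>2+\max(1,\,1+\gamma-t_1-p)$ and $t_2<2-p$, then $\delta_g$ is admissible. 2. Assume G1, G2, G3, F1, FG1, and also G1' and G1''. If $s>2+\max(1,\,3-t_1-p,\,t_2,\,2-t_3-p,\,t_4)$ and $t_2\ge 2-p$, then $\delta_g$ is admissible.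
   Context: Norm: $\|x\|$ is the Euclidean norm and $\|x\|_d^2=d_1^2x_1^2+\cdots+d_p^2x_p^2$ for fixed constants $d_1\ge\cdots\ge d_p\ge 1$. Generalized Bayes estimator: $\delta_g(x)=\int_{\mathbb R^p}\theta f(\|x-\theta\|)g(\theta)d\theta\big/\int_{\mathbb R^p}f(\|x-\theta\|)g(\theta)d\theta$. An estimator $\delta$ is admissible if no estimator $\delta'$ satisfies $R(\theta,\delta')\le R(\theta,\delta)$ for all $\theta$ with strict inequality for some $\theta$, where $R(\theta,\delta)=E_\theta[L_Q(\theta,\delta(X))]$. $F(u)=\int_u^\infty r f(r)\,dr$. A measurable, eventually positive function $\ell$ is regularly varying with index $\alpha$ ($\ell\in\mathrm{RV}_\alpha$) if $\lim_{x\to\infty}\ell(tx)/\ell(x)=t^\alpha$ for all $t>0$. The function $\beta:[0,\infty)\to(0,\infty)$ is fixed: it is continuously differentiable, monotone decreasing, integrable on $[0,\infty)$, and regularly varying with index $-1$. Set $H_1(\eta)=\int_\eta^\infty e^{\eta-r}\beta(r)dr\big/\int_\eta^\infty\beta(r)dr$. Conditions: - G1: $G(\eta)$ is continuously differentiable in $\eta>0$, and there exist $r_1>0$ and $t_1\le t_2$ such that $t_1\le \eta G'(\eta)/G(\eta)\le t_2$ for all $\eta\ge r_1$. - G1': by redefining $r_1$ if necessary in G1, $t_1$ and $t_2$ can be taken to have the same sign. - G1'': $G'(\eta)$ is continuously differentiable in $\eta>0$, and there exist $t_3\le t_4$ such that $t_3\le\eta G''(\eta)/G'(\eta)\le t_4$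 for all $\eta\ge r_1$. - G2: $\int_1^\infty\eta^{p-1}G(\eta)d\eta=\infty$ and there exists $0<\gamma\le 2$ such that $\int_1^\infty\eta^{p-1}G(\eta)H_1^\gamma(\eta)d\eta<\infty$ (this is the $\gamma$ in the claim). - G3: $\lim_{\eta\to0}\eta G'(\eta)/G(\eta)=t_0$ exists and $t_0>1-p$. - F1: there exist $r_0>0$, $L>0$ and $s>1$ such that $r^{p+s}f(r)\le L$ for all $r\ge r_0$. - FG1: $\int_0^\infty r^{p-1}f(r)G(r)dr<\infty$ and $\int_0^\infty r^{p-2}F(r)G(r)dr<\infty$. Standing assumptions: $t_2\ge -p$ and $t_1\le 2-p$. *)

theory Defs
  imports "HOL-Analysis.Analysis"
begin

section \<open>Estimation of a location vector under quadratic loss\<close>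

definition positive_definite :: "real^'n^'n \<Rightarrow> bool" where
  "positive_definite Q \<longleftrightarrow> transpose Q = Q \<and> (\<forall>x. x \<noteq> 0 \<longrightarrow> 0 < x \<bullet> (Q *v x))"

definition quadratic_loss :: "real^'n^'n \<Rightarrow> real^'n \<Rightarrow> real^'n \<Rightarrow> real" where
  "quadratic_loss Q \<theta> a = (a - \<theta>) \<bullet> (Q *v (a - \<theta>))"

text \<open>The type of the second argument fixes the dimension in which
  \<open>x \<mapsto> f \<parallel>x\<parallel>\<close> is a probability density. Only the values of \<open>f\<close> on \<open>[0,\<infinity>)\<close> matter.\<close>

definition radial_density :: "(real \<Rightarrow> real) \<Rightarrow> (real^'n) itself \<Rightarrow> bool" where
  "radial_density f _ \<longleftrightarrow>
     f \<in> borel_measurable (restrict_space borel {0..}) \<and>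
     (\<forall>r\<ge>0. 0 \<le> f r) \<and>
     (\<integral>\<^sup>+x. ennreal (f (norm (x :: real^'n))) \<partial>lborel) = 1"

definition location_distr :: "(real \<Rightarrow> real) \<Rightarrow> real^'n \<Rightarrow> (real^'n) measure" where
  "location_distr f \<theta> = density lborel (\<lambda>x. ennreal (f (norm (x - \<theta>))))"

text \<open>The risk is the expected loss with values in \<open>[0,\<infinity>]\<close>; estimators of infinite risk
  are not excluded.\<close>

definition risk :: "(real \<Rightarrow> real) \<Rightarrow> real^'n^'n \<Rightarrow> real^'n \<Rightarrow> (real^'n \<Rightarrow> real^'n) \<Rightarrow> ennreal" where
  "risk f Q \<theta> \<delta> = (\<integral>\<^sup>+x. ennreal (quadratic_loss Q \<theta> (\<delta> x)) \<partial>location_distr f \<theta>)"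

definition estimator :: "(real^'n \<Rightarrow> real^'n) \<Rightarrow> bool" where
  "estimator \<delta> \<longleftrightarrow> \<delta> \<in> borel_measurable borel"

definition admissible_estimator :: "(real \<Rightarrow> real) \<Rightarrow> real^'n^'n \<Rightarrow> (real^'n \<Rightarrow> real^'n) \<Rightarrow> bool" where
  "admissible_estimator f Q \<delta> \<longleftrightarrow> estimator \<delta> \<and>
     \<not> (\<exists>\<delta>'. estimator \<delta>' \<and> (\<forall>\<theta>. risk f Q \<theta> \<delta>' \<le> risk f Q \<theta> \<delta>) \<and>
           (\<exists>\<theta>. risk f Q \<theta> \<delta>' < risk f Q \<theta> \<delta>))"

definition norm_d :: "real^'n \<Rightarrow> real^'n \<Rightarrow> real" where
  "norm_d d x = sqrt (\<Sum>i\<in>UNIV. (d $ i)\<^sup>2 * (x $ i)\<^sup>2)"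

text \<open>Where the integrals diverge, the Bochner integral takes the default value \<open>0\<close>.
  The value of an estimator on a Lebesgue null set does not affect its risk.\<close>

definition gen_bayes :: "(real \<Rightarrow> real) \<Rightarrow> (real^'n \<Rightarrow> real) \<Rightarrow> real^'n \<Rightarrow> real^'n" where
  "gen_bayes f g x =
     (\<integral>\<theta>. (f (norm (x - \<theta>)) * g \<theta>) *\<^sub>R \<theta> \<partial>lborel) /\<^sub>R (\<integral>\<theta>. f (norm (x - \<theta>)) * g \<theta> \<partial>lborel)"


section \<open>The function \<open>\<beta>\<close>\<close>

definition regularly_varying :: "(real \<Rightarrow> real) \<Rightarrow> real \<Rightarrow> bool" where
  "regularly_varying l \<alpha> \<longleftrightarrow>
     l \<in> borel_measurable (restrict_space borel {0..}) \<and>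
     (\<forall>\<^sub>F x in at_top. 0 < l x) \<and>
     (\<forall>t>0. ((\<lambda>x. l (t * x) / l x) \<longlongrightarrow> t powr \<alpha>) at_top)"

text \<open>The derivative at the endpoint \<open>0\<close> is one-sided.\<close>

definition beta_function :: "(real \<Rightarrow> real) \<Rightarrow> bool" where
  "beta_function \<beta> \<longleftrightarrow>
     (\<forall>x\<ge>0. 0 < \<beta> x) \<and>
     (\<exists>\<beta>'. (\<forall>x\<ge>0. (\<beta> has_real_derivative \<beta>' x) (at x within {0..})) \<and>
           continuous_on {0..} \<beta>') \<and>
     antimono_on {0..} \<beta> \<and>
     set_integrable lborel {0..} \<beta> \<and>
     regularly_varying \<beta> (-1)"

definition H1 :: "(real \<Rightarrow> real) \<Rightarrow> real \<Rightarrow> real" where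
  "H1 \<beta> \<eta> = (LINT r:{\<eta>..}|lborel. exp (\<eta> - r) * \<beta> r) / (LINT r:{\<eta>..}|lborel. \<beta> r)"


section \<open>Conditions on \<open>f\<close> and \<open>G\<close>\<close>

definition cond_G1 :: "(real \<Rightarrow> real) \<Rightarrow> real \<Rightarrow> real \<Rightarrow> bool" where
  "cond_G1 G t1 t2 \<longleftrightarrow>
     G C1_differentiable_on {0<..} \<and> t1 \<le> t2 \<and>
     (\<exists>r1>0. \<forall>\<eta>\<ge>r1. t1 \<le> \<eta> * deriv G \<eta> / G \<eta> \<and> \<eta> * deriv G \<eta> / G \<eta> \<le> t2)"

text \<open>The threshold \<open>r1\<close> is existentially quantified in \<open>cond_G1\<close>, so it may be enlarged here.
  The constants have the same sign when both are nonnegative or both are nonpositive; zero is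
  compatible with either sign.\<close>

definition cond_G1' :: "(real \<Rightarrow> real) \<Rightarrow> real \<Rightarrow> real \<Rightarrow> bool" where
  "cond_G1' G t1 t2 \<longleftrightarrow> cond_G1 G t1 t2 \<and> (0 \<le> t1 \<and> 0 \<le> t2 \<or> t1 \<le> 0 \<and> t2 \<le> 0)"

text \<open>The bounds on \<open>\<eta> G'' \<eta> / G' \<eta>\<close> presuppose that the quotient is defined, hence
  \<open>G' \<eta> \<noteq> 0\<close>; division by zero must not satisfy them by convention.\<close>

definition cond_G1'' :: "(real \<Rightarrow> real) \<Rightarrow> real \<Rightarrow> real \<Rightarrow> bool" where
  "cond_G1'' G t3 t4 \<longleftrightarrow>
     deriv G C1_differentiable_on {0<..} \<and> t3 \<le> t4 \<and>
     (\<exists>r1>0. \<forall>\<eta>\<ge>r1. deriv G \<eta> \<noteq> 0 \<and>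
        t3 \<le> \<eta> * deriv (deriv G) \<eta> / deriv G \<eta> \<and>
        \<eta> * deriv (deriv G) \<eta> / deriv G \<eta> \<le> t4)"

definition cond_G2 :: "nat \<Rightarrow> (real \<Rightarrow> real) \<Rightarrow> (real \<Rightarrow> real) \<Rightarrow> real \<Rightarrow> bool" where
  "cond_G2 p \<beta> G \<gamma> \<longleftrightarrow>
     (\<integral>\<^sup>+\<eta>\<in>{1..}. ennreal (\<eta> powr (real p - 1) * G \<eta>) \<partial>lborel) = \<infinity> \<and>
     0 < \<gamma> \<and> \<gamma> \<le> 2 \<and>
     (\<integral>\<^sup>+\<eta>\<in>{1..}. ennreal (\<eta> powr (real p - 1) * G \<eta> * H1 \<beta> \<eta> powr \<gamma>) \<partial>lborel) < \<infinity>"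

definition cond_G3 :: "nat \<Rightarrow> (real \<Rightarrow> real) \<Rightarrow> bool" where
  "cond_G3 p G \<longleftrightarrow>
     (\<exists>t0 > 1 - real p. ((\<lambda>\<eta>. \<eta> * deriv G \<eta> / G \<eta>) \<longlongrightarrow> t0) (at_right 0))"

definition cond_F1 :: "nat \<Rightarrow> (real \<Rightarrow> real) \<Rightarrow> real \<Rightarrow> bool" where
  "cond_F1 p f s \<longleftrightarrow>
     1 < s \<and> (\<exists>r0>0. \<exists>L>0. \<forall>r\<ge>r0. r powr (real p + s) * f r \<le> L)"

text \<open>\<open>F\<close> takes values in \<open>[0,\<infinity>]\<close>, since the integral may diverge at \<open>u = 0\<close>.\<close>

definition F_tail :: "(real \<Rightarrow> real) \<Rightarrow> real \<Rightarrow> ennreal" where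
  "F_tail f u = (\<integral>\<^sup>+r\<in>{u..}. ennreal (r * f r) \<partial>lborel)"

definition cond_FG1 :: "nat \<Rightarrow> (real \<Rightarrow> real) \<Rightarrow> (real \<Rightarrow> real) \<Rightarrow> bool" where
  "cond_FG1 p f G \<longleftrightarrow>
     (\<integral>\<^sup>+r\<in>{0<..}. ennreal (r powr (real p - 1) * f r * G r) \<partial>lborel) < \<infinity> \<and>
     (\<integral>\<^sup>+r\<in>{0<..}. ennreal (r powr (real p - 2)) * F_tail f r * ennreal (G r) \<partial>lborel) < \<infinity>"

end

theory Submission
  imports Defs
begin

text \<open>The proof is Blyth's method with the prior densities
  \<open>g\<^sub>i \<theta> = G \<parallel>\<theta>\<parallel>\<^sub>d * h\<^sub>i(\<parallel>\<theta>\<parallel>\<^sub>d)\<^sup>2\<close>, where \<open>h\<^sub>i \<eta> = 1 - B (\<eta> + i + 1) / B \<eta>\<close> and \<open>B \<eta>\<close> is the integral of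
  \<open>\<beta>\<close> over \<open>[\<eta>, \<infinity>)\<close>. Monotonicity of \<open>\<beta>\<close> and its doubling property (regular variation) give, uniformly
  in \<open>i\<close>, that \<open>h\<^sub>i\<close> is comparable at comparable arguments and has Lipschitz constant \<open>O(\<beta> / B)\<close> there;
  moreover \<open>h\<^sub>i = O(\<beta> / B)\<close> for fixed \<open>i\<close>, and \<open>\<beta> / B\<close> is of the order of \<open>H1\<close>.

  With \<open>m\<^sub>i\<close> the marginal density and \<open>\<delta>\<^sub>i\<close> the Bayes estimator for \<open>g\<^sub>i\<close>, one has
  \<open>m\<^sub>i(x) (\<delta>\<^sub>i - \<delta>\<^sub>g)(x) = \<integral> (\<theta> - \<delta>\<^sub>g(x)) (h\<^sub>i(\<theta>)\<^sup>2 - h\<^sub>i(x)\<^sup>2) f(\<parallel>x - \<theta>\<parallel>) g(\<theta>) d\<theta>\<close>. For large \<open>x\<close>, the part of this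
  integral with \<open>\<theta>\<close> near \<open>x\<close> is at most a constant times \<open>g h\<^sub>i \<beta> / B\<close> at \<open>x\<close>, and the rest is polynomially small
  by F1. Hence \<open>m\<^sub>i |\<delta>\<^sub>i - \<delta>\<^sub>g|\<^sup>2\<close> is dominated by \<open>g (\<beta> / B)\<^sup>2\<close> plus an integrable power, uniformly in \<open>i\<close>, and its
  integral tends to \<open>0\<close>. The exponents fit as soon as \<open>s > 3\<close> and \<open>s > 3 + \<gamma> - t1 - p\<close>, which holds in both
  parts of the theorem because \<open>\<gamma> \<le> 2\<close>.\<close>

section \<open>Radial integrals\<close>

text \<open>The exponents come from a trade-off. Away from \<open>x\<close> the integrand, with the
  factor \<open>\<theta> - \<delta>\<close> included, decays in the distance with power
  \<open>p + s - 1\<close>, which is split as \<open>a + b\<close>: \<open>b\<close> powers make the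
  prior integrable in \<theta>, and \<open>a\<close> powers remain as decay in \<open>x\<close>.
  Integrability of \<open>g\<close> against \<open>(1 + N) powr (- b)\<close> is extracted from G2
  by bounding \<open>H1\<close> from below: regular variation of index -1 yields a bound by the
  power \<open>- e\<close> for every \<open>e > 1\<close>, hence \<open>b = \<gamma> * e\<close>.
  The square of the remainder is then divided by \<open>m\<^sub>i\<close>, which is of order at
  least \<open>g * h\<^sub>i\<^sup>2\<close>; uniformly in \<open>i\<close> the factor
  \<open>h\<^sub>i\<close> is bounded below through \<open>h\<^sub>0\<close>, by the power
  \<open>- e\<close> again. With \<open>g\<close> at least of order \<open>N powr t1\<close>, the
  quotient is a power of \<open>N\<close> with exponent \<open>-(2 * a + t1 - 2 * e)\<close>,
  integrable if \<open>2 * a + t1 - 2 * e > p\<close>. At \<open>e = 1\<close> this reads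
  \<open>p + 2 * s - 4 - 2 * \<gamma> + t1 > 0\<close>, which is the sum of the two lower bounds on
  \<open>s\<close> together with \<open>\<gamma> \<le> 2\<close>.\<close>

lemma emeasure_homogeneous_sublevel:
  fixes N :: "'a::euclidean_space \<Rightarrow> real"
  assumes [measurable]: "N \<in> borel_measurable borel"
    and hom: "\<And>c x. 0 < c \<Longrightarrow> N (c *\<^sub>R x) = c * N x" and "0 < r"
  shows "emeasure lborel {x. N x \<le> r} = ennreal (r ^ DIM('a)) * emeasure lborel {x. N x \<le> 1}"
proof -
  have "emeasure lborel {x. N x \<le> r} =
      emeasure (density (distr lborel borel (\<lambda>x. 0 + r *\<^sub>R x)) (\<lambda>_. ennreal (\<bar>r\<bar> ^ DIM('a)))) {x::'a. N x \<le> r}"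
    using lborel_affine[of r "0::'a"] \<open>0 < r\<close> by simp
  also have "\<dots> = ennreal (r ^ DIM('a)) * emeasure (distr lborel borel (\<lambda>x. 0 + r *\<^sub>R x)) {x::'a. N x \<le> r}"
    using \<open>0 < r\<close> by (simp add: emeasure_density nn_integral_cmult_indicator)
  also have "emeasure (distr lborel borel (\<lambda>x. 0 + r *\<^sub>R x)) {x::'a. N x \<le> r} = emeasure lborel {x. N x \<le> 1}"
    using \<open>0 < r\<close> by (subst emeasure_distr) (auto simp: hom vimage_def)
  finally show ?thesis .
qed

lemma nn_integral_power_Icc:
  assumes "0 < n" "0 \<le> r"
  shows "(\<integral>\<^sup>+x. ennreal (real n * x ^ (n - 1)) * indicator {0..r} x \<partial>lborel) = ennreal (r ^ n)"
proof -
  have "((\<lambda>x. x ^ n) has_real_derivative real n * x ^ (n - 1)) (at x)" for x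
    by (auto intro!: derivative_eq_intros)
  then show ?thesis
    using assms nn_integral_FTC_Icc[of "\<lambda>x. real n * x ^ (n - 1)" 0 r "\<lambda>x. x ^ n"] by simp
qed

text \<open>The law of \<open>N\<close> under Lebesgue measure is determined by the half-lines, and
  scaling gives them measure proportional to \<open>r ^ DIM('a)\<close>; differentiation yields the
  radial density. The bound \<open>norm x \<le> N x\<close> keeps sublevel sets bounded, hence of
  finite measure. \<open>C\<close> is the dimension times the volume of the unit sublevel
  set.\<close>

lemma nn_integral_homogeneous:
  fixes N :: "'a::euclidean_space \<Rightarrow> real"
  assumes N[measurable]: "N \<in> borel_measurable borel"
    and hom: "\<And>c x. 0 < c \<Longrightarrow> N (c *\<^sub>R x) = c * N x"
    and ge: "\<And>x. norm x \<le> N x"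
  obtains C :: real where "\<And>\<psi>. \<psi> \<in> borel_measurable borel \<Longrightarrow>
    (\<integral>\<^sup>+x. \<psi> (N x) \<partial>lborel) = ennreal C * (\<integral>\<^sup>+r\<in>{0<..}. \<psi> r * ennreal (r ^ (DIM('a) - 1)) \<partial>lborel)"
proof -
  let ?n = "DIM('a)"
  have "emeasure lborel {x. N x \<le> 1} \<le> emeasure lborel (cball (0::'a) 1)"
    using order_trans[OF ge] by (intro emeasure_mono) auto
  also have "\<dots> < \<infinity>"
    by (intro emeasure_bounded_finite bounded_cball)
  finally have fin: "emeasure lborel {x. N x \<le> 1} \<noteq> \<infinity>"
    by simp
  define V where "V = measure lborel {x. N x \<le> 1}"
  have V: "emeasure lborel {x. N x \<le> 1} = ennreal V"
    unfolding V_def using fin by (simp add: emeasure_eq_ennreal_measure)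
  have V0: "0 \<le> V" by (simp add: V_def)
  define h where "h r = ennreal (V * real ?n * r ^ (?n - 1)) * indicator {0<..} r" for r :: real
  have [measurable]: "h \<in> borel_measurable borel"
    unfolding h_def by measurable
  have "distr lborel borel N = density lborel h"
  proof (rule measure_eqI_generator_eq)
    show "Int_stable (range (\<lambda>a::real. {..a}))"
      by (auto simp: Int_stable_def)
    show "range (\<lambda>a::real. {..a}) \<subseteq> Pow UNIV" by simp
    have h0: "(\<integral>\<^sup>+x. h x * indicator {..r} x \<partial>lborel) = ennreal (V * r ^ ?n)" if "0 \<le> r" for r
    proof -
      have "(\<integral>\<^sup>+x. h x * indicator {..r} x \<partial>lborel) =
          (\<integral>\<^sup>+x. ennreal V * (ennreal (real ?n * x ^ (?n - 1)) * indicator {0..r} x) \<partial>lborel)"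
        \<comment> \<open>The origin is cut out of \<open>h\<close> but belongs to
          \<open>{0..r}\<close>; a single point has measure zero.\<close>
        using AE_lborel_singleton[of 0]
        by (intro nn_integral_cong_AE, eventually_elim)
           (auto simp: h_def indicator_def ennreal_mult'' ennreal_mult' V0 mult.assoc)
      also have "\<dots> = ennreal V * ennreal (r ^ ?n)"
        by (subst nn_integral_cmult) (use nn_integral_power_Icc[of ?n r] that in auto)
      finally show ?thesis using V0 that by (simp add: ennreal_mult)
    qed
    have N0: "emeasure lborel {x. N x \<le> r} = ennreal (V * r ^ ?n)" if "0 \<le> r" for r
    \<comment> \<open>Scaling needs a positive factor. At \<open>r = 0\<close> the sublevel set
      contains at most the origin, and the power vanishes because the dimension is positive.\<close>
    proof (cases "r = 0")
      case True
      have "emeasure lborel {x. N x \<le> 0} \<le> emeasure lborel {0::'a}"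
      proof (rule emeasure_mono)
        show "{x. N x \<le> 0} \<subseteq> {0::'a}"
          using ge by (metis (mono_tags, lifting) insertCI mem_Collect_eq norm_le_zero_iff order_trans subsetI)
      qed simp
      then show ?thesis using True DIM_positive[where ?'a='a] by (simp add: zero_power)
    next
      case False
      then show ?thesis
        using emeasure_homogeneous_sublevel[of N r, OF N hom] that V V0
        by (simp add: ennreal_mult mult.commute)
    qed
    show "emeasure (distr lborel borel N) X = emeasure (density lborel h) X"
      if XE: "X \<in> range (\<lambda>a::real. {..a})" for X
    proof -
      obtain r where X: "X = {..r}" using XE by blast
      show ?thesis
      proof (cases "0 \<le> r")
        case True
        then show ?thesis
          using h0[of r] N0[of r] X by (simp add: emeasure_distr emeasure_density vimage_def)
      next
        case False
        then have "{x. N x \<le> r} = {}"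
          using ge by (smt (verit) Collect_empty_eq norm_ge_zero)
        moreover have "(\<integral>\<^sup>+x. h x * indicator {..r} x \<partial>lborel) = (\<integral>\<^sup>+x. 0 \<partial>(lborel::real measure))"
          using False by (intro nn_integral_cong) (auto simp: h_def indicator_def)
        ultimately show ?thesis
          using X by (simp add: emeasure_distr emeasure_density vimage_def)
      qed
    qed
    show "sets (distr lborel borel N) = sigma_sets UNIV (range (\<lambda>a::real. {..a}))"
      "sets (density lborel h) = sigma_sets UNIV (range (\<lambda>a::real. {..a}))"
      by (simp_all add: borel_eq_atMost)
    show "range (\<lambda>i::nat. {..real i}) \<subseteq> range (\<lambda>a::real. {..a})" by auto
    show "(\<Union>i::nat. {..real i}) = UNIV" by (auto intro: real_arch_simple)
    show "emeasure (distr lborel borel N) {..real i} \<noteq> \<infinity>" for i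
      using N0[of "real i"] by (simp add: emeasure_distr vimage_def)
  qed
  then have eq: "(\<integral>\<^sup>+x. \<psi> (N x) \<partial>lborel) = ennreal (V * real ?n) * (\<integral>\<^sup>+r\<in>{0<..}. \<psi> r * ennreal (r ^ (?n - 1)) \<partial>lborel)"
    if [measurable]: "\<psi> \<in> borel_measurable borel" for \<psi>
  proof -
    have "(\<integral>\<^sup>+x. \<psi> (N x) \<partial>lborel) = (\<integral>\<^sup>+r. \<psi> r \<partial>distr lborel borel N)"
      by (simp add: nn_integral_distr)
    also have "\<dots> = (\<integral>\<^sup>+r. h r * \<psi> r \<partial>lborel)"
      unfolding \<open>distr lborel borel N = density lborel h\<close> by (simp add: nn_integral_density)
    also have "\<dots> = (\<integral>\<^sup>+r. ennreal (V * real ?n) * (\<psi> r * ennreal (r ^ (?n - 1)) * indicator {0<..} r) \<partial>lborel)"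
      using V0 by (intro nn_integral_cong) (auto simp: h_def indicator_def ennreal_mult mult_ac)
    finally show ?thesis
      by (simp add: nn_integral_cmult)
  qed
  show ?thesis using eq by (rule that)
qed

text \<open>At the origin only the product with the Jacobian \<open>r ^ (DIM('a) - 1)\<close> has to
  be bounded, which is what G3 provides for the prior, even if \<open>G\<close> itself blows up
  there.\<close>

lemma nn_integral_radial_finite:
  fixes N :: "'a::euclidean_space \<Rightarrow> real" and \<psi> :: "real \<Rightarrow> ennreal"
  assumes N: "N \<in> borel_measurable borel" "\<And>c x. 0 < c \<Longrightarrow> N (c *\<^sub>R x) = c * N x" "\<And>x. norm x \<le> N x"
    and \<psi>[measurable]: "\<psi> \<in> borel_measurable borel"
    and near: "\<And>r. 0 < r \<Longrightarrow> r < 1 \<Longrightarrow> \<psi> r * ennreal (r ^ (DIM('a) - 1)) \<le> ennreal M"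
    and far: "(\<integral>\<^sup>+r\<in>{1..}. \<psi> r * ennreal (r ^ (DIM('a) - 1)) \<partial>lborel) < \<infinity>"
  shows "(\<integral>\<^sup>+x. \<psi> (N x) \<partial>lborel) < \<infinity>"
proof -
  let ?\<phi> = "\<lambda>r. \<psi> r * ennreal (r ^ (DIM('a) - 1))"
  obtain C :: real where C: "(\<integral>\<^sup>+x. \<psi> (N x) \<partial>lborel) = ennreal C * (\<integral>\<^sup>+r\<in>{0<..}. ?\<phi> r \<partial>lborel)"
    using nn_integral_homogeneous[OF N] \<psi> by metis
  have "(\<integral>\<^sup>+r\<in>{0<..}. ?\<phi> r \<partial>lborel) \<le> (\<integral>\<^sup>+r. ennreal M * indicator {0..1} r + ?\<phi> r * indicator {1..} r \<partial>lborel)"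
    using near by (intro nn_integral_mono) (auto split: split_indicator)
  also have "\<dots> = ennreal M * emeasure lborel {0..1::real} + (\<integral>\<^sup>+r\<in>{1..}. ?\<phi> r \<partial>lborel)"
    by (simp add: nn_integral_add nn_integral_cmult_indicator)
  also have "\<dots> < \<infinity>" using far by (simp add: ennreal_mult_less_top)
  finally show ?thesis unfolding C by (simp add: ennreal_mult_less_top)
qed

lemma nn_integral_powr_atLeast_1:
  fixes q :: real
  assumes "q < -1"
  shows "(\<integral>\<^sup>+r. ennreal (r powr q) * indicator {1..} r \<partial>lborel) < \<infinity>"
proof -
  have "(\<integral>\<^sup>+r. ennreal (r powr q) * indicator {1..} r \<partial>lborel) = ennreal (0 - 1 powr (q + 1) / (q + 1))"
  proof (rule nn_integral_FTC_atLeast[where F="\<lambda>r. r powr (q + 1) / (q + 1)"])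
    show "((\<lambda>r. r powr (q + 1) / (q + 1)) has_real_derivative r powr q) (at r)" if "1 \<le> r" for r
      using that assms by (auto intro!: derivative_eq_intros)
    have "((\<lambda>r. r powr (q + 1) / (q + 1)) \<longlongrightarrow> 0 / (q + 1)) at_top"
      using assms by (intro tendsto_intros tendsto_neg_powr filterlim_ident) auto
    then show "((\<lambda>r. r powr (q + 1) / (q + 1)) \<longlongrightarrow> 0) at_top" by simp
  qed auto
  then show ?thesis by simp
qed

lemma nn_integral_homogeneous_powr:
  fixes N :: "'a::euclidean_space \<Rightarrow> real"
  assumes N: "N \<in> borel_measurable borel" "\<And>c x. 0 < c \<Longrightarrow> N (c *\<^sub>R x) = c * N x" "\<And>x. norm x \<le> N x"
    and q: "real DIM('a) < q"
  shows "(\<integral>\<^sup>+x. ennreal (N x powr (- q)) * indicator {x. 1 \<le> N x} x \<partial>lborel) < \<infinity>"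
proof -
  have eq: "r powr (- q) * r ^ (DIM('a) - 1) = r powr (real (DIM('a) - 1) - q)" if "1 \<le> r" for r :: real
    using that by (simp add: powr_realpow[symmetric] powr_add[symmetric])
  have "(\<integral>\<^sup>+r\<in>{1..}. ennreal (r powr (- q)) * indicator {1..} r * ennreal (r ^ (DIM('a) - 1)) \<partial>lborel) =
      (\<integral>\<^sup>+r. ennreal (r powr (real (DIM('a) - 1) - q)) * indicator {1..} r \<partial>lborel)"
    by (intro nn_integral_cong) (auto split: split_indicator simp: eq ennreal_mult'[symmetric] simp del: One_nat_def)
  also have "\<dots> < \<infinity>"
    using q DIM_positive[where 'a='a] by (intro nn_integral_powr_atLeast_1) (simp add: of_nat_diff Suc_leI)
  finally have "(\<integral>\<^sup>+x. (\<lambda>r. ennreal (r powr (- q)) * indicator {1..} r) (N x) \<partial>lborel) < \<infinity>"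
    \<comment> \<open>The integrand vanishes below 1, so 0 serves as its bound there.\<close>
    by (intro nn_integral_radial_finite[OF N, where M=0]) (auto split: split_indicator)
  then show ?thesis by (simp add: indicator_def)
qed

lemma nn_integral_finite_scale:
  assumes [measurable]: "X \<in> borel_measurable M" and "0 < c" and "\<And>x. ennreal c * X x \<le> Y x" and Y: "(\<integral>\<^sup>+x. Y x \<partial>M) < \<infinity>"
  shows "(\<integral>\<^sup>+x. X x \<partial>M) < \<infinity>"
proof -
  have "ennreal c * (\<integral>\<^sup>+x. X x \<partial>M) = (\<integral>\<^sup>+x. ennreal c * X x \<partial>M)" by (rule nn_integral_cmult[symmetric]) measurable
  also have "\<dots> \<le> (\<integral>\<^sup>+x. Y x \<partial>M)" using assms by (intro nn_integral_mono)
  also note Y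
  finally show ?thesis using \<open>0 < c\<close> by (auto simp: ennreal_mult_less_top)
qed

section \<open>Weights obtained from \<open>\<beta>\<close>\<close>

locale beta_fun =
  fixes \<beta> :: "real \<Rightarrow> real"
  assumes beta: "beta_function \<beta>"
begin

section \<open>Tail integrals of \<beta> and lower bounds from regular variation\<close>

definition B :: "real \<Rightarrow> real" where "B \<eta> = (LINT r:{\<eta>..}|lborel. \<beta> r)"

lemma pos: "0 \<le> x \<Longrightarrow> 0 < \<beta> x"
  and anti: "0 \<le> x \<Longrightarrow> x \<le> y \<Longrightarrow> \<beta> y \<le> \<beta> x"
  and int0: "set_integrable lborel {0..} \<beta>"
  and rv: "0 < t \<Longrightarrow> ((\<lambda>x. \<beta> (t * x) / \<beta> x) \<longlongrightarrow> t powr - 1) at_top"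
  using beta by (auto simp: beta_function_def regularly_varying_def monotone_on_def)

lemma int: "0 \<le> a \<Longrightarrow> A \<subseteq> {a..} \<Longrightarrow> A \<in> sets borel \<Longrightarrow> set_integrable lborel A \<beta>"
  by (rule set_integrable_subset[OF int0]) auto

text \<open>Monotonicity of \<beta> on an interval. The later estimates of tails and of their
  differences rest on these two inequalities, without differentiating \<open>B\<close>.\<close>

lemma B_diff:
  assumes "0 \<le> a" "a \<le> b"
  shows "(b - a) * \<beta> b \<le> B a - B b" "B a - B b \<le> (b - a) * \<beta> a"
proof -
  have "{a..} = {a..<b} \<union> {b..}" using assms by auto
  then have "B a = (LINT r:{a..<b} \<union> {b..}|lborel. \<beta> r)" by (simp add: B_def)
  also have "\<dots> = (LINT r:{a..<b}|lborel. \<beta> r) + B b"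
    unfolding B_def using assms by (intro set_integral_Un int[of a]) auto
  finally have eq: "B a - B b = (LINT r:{a..<b}|lborel. \<beta> r)" by simp
  have const: "(LINT r:{a..<b}|lborel. c) = (b - a) * c" "set_integrable lborel {a..<b} (\<lambda>_. c)" for c :: real
    using assms by (auto simp: set_lebesgue_integral_def set_integrable_def mult.commute)
  show "(b - a) * \<beta> b \<le> B a - B b"
    unfolding eq const(1)[symmetric] using assms by (intro set_integral_mono const int[of a]) (auto intro: anti)
  show "B a - B b \<le> (b - a) * \<beta> a"
    unfolding eq const(1)[symmetric] using assms by (intro set_integral_mono const int[of a]) (auto intro: anti)
qed

lemma B_nonneg: "0 \<le> a \<Longrightarrow> 0 \<le> B a"
  unfolding B_def set_lebesgue_integral_def
  by (intro Bochner_Integration.integral_nonneg) (auto simp: indicator_def intro: less_imp_le[OF pos])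

lemma B_pos: "0 \<le> a \<Longrightarrow> 0 < B a"
  using B_diff(1)[of a "a + 1"] B_nonneg[of "a + 1"] pos[of "a + 1"] by simp

lemma B_anti: "0 \<le> a \<Longrightarrow> a \<le> b \<Longrightarrow> B b \<le> B a"
  using B_diff(1)[of a b] pos[of b] by (smt (verit) mult_nonneg_nonneg)

lemma B_tendsto_0: "0 \<le> a \<Longrightarrow> (\<lambda>i. B (a + real (Suc i))) \<longlonglongrightarrow> 0"
proof -
  assume a: "0 \<le> a"
  have "(\<lambda>i. \<integral>r. indicator {a + real (Suc i)..} r *\<^sub>R \<beta> r \<partial>lborel) \<longlonglongrightarrow> (\<integral>r. 0 \<partial>(lborel::real measure))"
  proof (rule integral_dominated_convergence[where w="\<lambda>r. indicator {0..} r *\<^sub>R \<beta> r"])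
    show "integrable lborel (\<lambda>r. indicator {0..} r *\<^sub>R \<beta> r)"
      using int0 by (simp add: set_integrable_def)
    show "(\<lambda>r. indicator {a + real (Suc i)..} r *\<^sub>R \<beta> r) \<in> borel_measurable lborel" for i
    proof -
      have "set_integrable lborel {a + real (Suc i)..} \<beta>" using a by (intro int[of "a + real (Suc i)"]) auto
      then show ?thesis unfolding set_integrable_def by (rule borel_measurable_integrable)
    qed
    have "(\<lambda>i. indicator {a + real (Suc i)..} r *\<^sub>R \<beta> r) \<longlonglongrightarrow> 0" for r
    proof (rule tendsto_eventually)
      obtain n where "r < real n" using reals_Archimedean2 by blast
      then show "\<forall>\<^sub>F i in sequentially. indicator {a + real (Suc i)..} r *\<^sub>R \<beta> r = 0"
        using a by (intro eventually_sequentiallyI[of n]) (auto simp: indicator_def)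
    qed
    then show "AE r in lborel. (\<lambda>i. indicator {a + real (Suc i)..} r *\<^sub>R \<beta> r) \<longlonglongrightarrow> 0" by simp
    show "AE r in lborel. norm (indicator {a + real (Suc i)..} r *\<^sub>R \<beta> r) \<le> indicator {0..} r *\<^sub>R \<beta> r" for i
      using a by (intro AE_I2) (auto simp: indicator_def less_imp_le[OF pos])
  qed simp
  then show ?thesis by (simp add: B_def set_lebesgue_integral_def)
qed

text \<open>By regular variation of index -1 the ratio \<open>\<beta> (2 * x) / \<beta> x\<close>
  tends to 1/2, and \<open>2 powr (- e)\<close> is strictly smaller because
  \<open>1 < e\<close>.\<close>

lemma eventually_halving: "1 < e \<Longrightarrow> \<exists>X\<ge>1. \<forall>x\<ge>X. 2 powr (- e) * \<beta> x \<le> \<beta> (2 * x)"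
proof -
  assume "1 < e"
  then have "2 powr (- e) < (2::real) powr - 1" by (intro powr_less_mono) auto
  from order_tendstoD(1)[OF rv[of 2] this]
  have "\<forall>\<^sub>F x in at_top. 2 powr (- e) < \<beta> (2 * x) / \<beta> x" by simp
  then obtain X where X: "\<And>x. x \<ge> X \<Longrightarrow> 2 powr (- e) < \<beta> (2 * x) / \<beta> x"
    by (auto simp: eventually_at_top_linorder)
  show ?thesis
  proof (intro exI[of _ "max 1 X"] conjI allI impI)
    fix x assume x: "max 1 X \<le> x"
    then show "2 powr (- e) * \<beta> x \<le> \<beta> (2 * x)"
      using X[of x] pos[of x] by (simp add: field_simps)
  qed simp
qed

lemma doubling: "\<exists>c>0. c \<le> 1 \<and> (\<forall>x\<ge>0. c * \<beta> x \<le> \<beta> (2 * x))"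
proof -
  obtain X where X: "1 \<le> X" "\<And>x. X \<le> x \<Longrightarrow> 2 powr (- 2) * \<beta> x \<le> \<beta> (2 * x)"
    using eventually_halving[of 2] by auto
  \<comment> \<open>Beyond \<open>X\<close> the eventual bound applies. Below \<open>X\<close>,
    monotonicity gives at most \<open>\<beta> 0\<close> at \<open>x\<close> and at least
    \<open>\<beta> (2 * X)\<close> at \<open>2 * x\<close>.\<close>
  define c where "c = min (2 powr (-2)) (\<beta> (2 * X) / \<beta> 0)"
  have "0 < \<beta> (2 * X)" "0 < \<beta> 0" using X pos by auto
  moreover have "(2::real) powr (-2) \<le> 1" by (simp add: powr_minus)
  moreover have "c * \<beta> x \<le> \<beta> (2 * x)" if "0 \<le> x" for x
  proof (cases "X \<le> x")
    case True
    have "c * \<beta> x \<le> 2 powr (-2) * \<beta> x" using pos[OF that] by (intro mult_right_mono) (auto simp: c_def)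
    with X(2)[OF True] show ?thesis by simp
  next
    case False
    have "c * \<beta> x \<le> (\<beta> (2 * X) / \<beta> 0) * \<beta> 0"
      using pos[OF that] anti[of 0 x] that \<open>0 < \<beta> 0\<close> \<open>0 < \<beta> (2 * X)\<close>
      by (intro mult_mono) (auto simp: c_def)
    also have "\<dots> = \<beta> (2 * X)" using \<open>0 < \<beta> 0\<close> by simp
    also have "\<dots> \<le> \<beta> (2 * x)" using False that by (intro anti) auto
    finally show ?thesis .
  qed
  ultimately show ?thesis
    by (intro exI[of _ c]) (auto simp: c_def min_le_iff_disj)
qed

text \<open>A one-sided Potter bound. Doubling the argument costs \<beta> at most the factor
  \<open>2 powr (- e)\<close>, exactly what the power function loses, so the inequality propagates
  from a bounded interval to infinity.\<close>

lemma lower_power: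
  assumes e: "1 < e"
  shows "\<exists>c>0. \<forall>\<eta>\<ge>0. c * (1 + \<eta>) powr (- e) \<le> \<beta> (\<eta> + 1)"
proof -
  obtain X where X: "1 \<le> X" "\<And>x. X \<le> x \<Longrightarrow> 2 powr (- e) * \<beta> x \<le> \<beta> (2 * x)"
    using eventually_halving[OF e] by auto
  define m where "m = \<beta> (2 * X)"
  have m: "0 < m" unfolding m_def using X by (intro pos) auto
  \<comment> \<open>Induction on the number of halvings that bring \<open>x\<close> down to at most
    \<open>2 * X\<close>, where \<open>m\<close> is a lower bound of \<beta>.\<close>
  have ind: "m * x powr (- e) \<le> \<beta> x" if "X \<le> x" "x \<le> 2 ^ n * X" for x n
    using that
  proof (induction n arbitrary: x)
    case (Suc n)
    show ?case
    proof (cases "x \<le> 2 * X")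
      case True
      have "m * x powr (- e) \<le> m * 1"
        using m Suc.prems X e by (intro mult_left_mono) (auto simp: powr_minus ge_one_powr_ge_zero inverse_le_1_iff)
      also have "\<dots> \<le> \<beta> x" unfolding m_def using True X Suc.prems by (simp add: anti)
      finally show ?thesis .
    next
      case False
      have x: "x / 2 \<ge> X" "x / 2 \<le> 2 ^ n * X" using False Suc.prems by auto
      have "m * x powr (- e) = 2 powr (- e) * (m * (x / 2) powr (- e))"
        using x X by (simp add: powr_divide)
      also have "\<dots> \<le> 2 powr (- e) * \<beta> (x / 2)"
        using Suc.IH[OF x] by (intro mult_left_mono) auto
      also have "\<dots> \<le> \<beta> x" using X(2)[of "x / 2"] x by simp
      finally show ?thesis .
    qed
  next
    case 0
    have "m * x powr (- e) \<le> m * 1"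
      using m 0 X e by (intro mult_left_mono) (auto simp: powr_minus ge_one_powr_ge_zero inverse_le_1_iff)
    also have "\<dots> \<le> \<beta> x" unfolding m_def using X 0 by (simp add: anti)
    finally show ?case .
  qed
  have all: "m * x powr (- e) \<le> \<beta> x" if "1 \<le> x" for x
  proof (cases "X \<le> x")
    case True
    obtain n where "x < 2 ^ n" using real_arch_pow[of 2 x] by auto
    also have "(2::real) ^ n \<le> 2 ^ n * X" using X by simp
    finally show ?thesis using ind[OF True, of n] by simp
  next
    case False
    have "m * x powr (- e) \<le> m * 1"
      using m that e by (intro mult_left_mono) (auto simp: powr_minus ge_one_powr_ge_zero inverse_le_1_iff)
    also have "\<dots> \<le> \<beta> x" unfolding m_def using False that by (simp add: anti)
    finally show ?thesis .
  qed
  show ?thesis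
    using m all[of "1 + _"] by (intro exI[of _ m]) (auto simp: add.commute)
qed

text \<open>The integral of \<beta> over an interval of length \<open>k\<close>; with
  \<open>k = i + 1\<close> it is the numerator of \<open>h i\<close>.\<close>

definition K :: "real \<Rightarrow> real \<Rightarrow> real" where "K k \<eta> = B \<eta> - B (\<eta> + k)"

lemma K_bounds:
  assumes "0 \<le> k" "0 \<le> \<eta>"
  shows "k * \<beta> (\<eta> + k) \<le> K k \<eta>" "K k \<eta> \<le> k * \<beta> \<eta>"
  using B_diff[of \<eta> "\<eta> + k"] assms by (auto simp: K_def)

text \<open>If the two intervals overlap, their common part cancels and two intervals of length
  \<open>b - a\<close> remain, the left one carrying the larger values of \<beta>. Disjoint
  intervals are compared through the values of \<beta> at \<open>b\<close> and
  \<open>a + k\<close>.\<close>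

lemma K_anti:
  assumes k: "0 \<le> k" and a: "0 \<le> a" "a \<le> b"
  shows "K k b \<le> K k a"
proof (cases "b \<le> a + k")
  case True
  have "B (a + k) - B (b + k) \<le> (b - a) * \<beta> (a + k)" using B_diff(2)[of "a + k" "b + k"] assms by simp
  also have "\<dots> \<le> (b - a) * \<beta> b" using True assms by (intro mult_left_mono anti) auto
  also have "\<dots> \<le> B a - B b" by (rule B_diff) (use a in auto)
  finally show ?thesis by (simp add: K_def)
next
  case False
  have "K k b \<le> k * \<beta> b" using K_bounds assms by auto
  also have "\<dots> \<le> k * \<beta> (a + k)" using False assms by (intro mult_left_mono anti) auto
  also have "\<dots> \<le> K k a" using K_bounds assms by auto
  finally show ?thesis .
qed

text \<open>One constant serves all \<open>k\<close>, which makes the comparison of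
  \<open>h i\<close> at comparable arguments uniform in \<open>i\<close>. The drop from
  \<open>a\<close> to \<open>2 * a\<close> is at most an integral of \<beta> at scale
  \<open>a\<close>, and two doublings of \<beta> move it to scale \<open>4 * a\<close>.\<close>

lemma B_doubling: "\<exists>c>0. c \<le> 1 \<and> (\<forall>a\<ge>0. c * B a \<le> B (2 * a)) \<and> (\<forall>a\<ge>0. \<forall>k>0. c * K k a \<le> K k (2 * a))"
proof -
  obtain c where c: "0 < c" "c \<le> 1" "\<And>x. 0 \<le> x \<Longrightarrow> c * \<beta> x \<le> \<beta> (2 * x)" using doubling by auto
  have c4: "c ^ 2 * \<beta> x \<le> \<beta> (4 * x)" if "0 \<le> x" for x
  proof -
    have "c ^ 2 * \<beta> x = c * (c * \<beta> x)" by (simp add: power2_eq_square)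
    also have "\<dots> \<le> c * \<beta> (2 * x)" using c that by (intro mult_left_mono) auto
    also have "\<dots> \<le> \<beta> (4 * x)" using c(3)[of "2 * x"] that by simp
    finally show ?thesis .
  qed
  define c' where "c' = c ^ 2 / 2"
  have c2: "0 < c ^ 2" "c ^ 2 \<le> 1" using c by (auto simp: power_le_one)
  \<comment> \<open>This is where the factor 1/2 in \<open>c'\<close> is spent:
    \<open>c ^ 2 * x\<close> is at most \<open>y + c ^ 2 * y\<close>, hence at most
    \<open>2 * y\<close>.\<close>
  have *: "c' * x \<le> y" if "c ^ 2 * (x - y) \<le> y" "0 \<le> x" "0 \<le> y" for x y
  proof -
    have "c ^ 2 * y \<le> 1 * y" using c2 that by (intro mult_right_mono) auto
    then show ?thesis using that by (simp add: c'_def algebra_simps)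
  qed
  have "c' * B a \<le> B (2 * a)" if a: "0 \<le> a" for a
  proof (rule *)
    have "c ^ 2 * (B a - B (2 * a)) \<le> c ^ 2 * (a * \<beta> a)"
      using B_diff(2)[of a "2 * a"] a c2 by (intro mult_left_mono) auto
    also have "\<dots> = a * (c ^ 2 * \<beta> a)" by simp
    also have "\<dots> \<le> a * \<beta> (4 * a)" using a by (intro mult_left_mono c4)
    also have "\<dots> \<le> 2 * a * \<beta> (4 * a)" using a pos[of "4 * a"] by simp
    also have "\<dots> \<le> B (2 * a) - B (4 * a)" using B_diff(1)[of "2 * a" "4 * a"] a by simp
    also have "\<dots> \<le> B (2 * a)" using B_nonneg[of "4 * a"] a by simp
    finally show "c ^ 2 * (B a - B (2 * a)) \<le> B (2 * a)" .
  qed (use B_nonneg a in auto)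
  moreover have "c' * K k a \<le> K k (2 * a)" if a: "0 \<le> a" "0 < k" for a k
  proof (rule *)
    have K0: "0 \<le> K k a" "0 \<le> K k (2 * a)" using B_anti[of a "a + k"] B_anti[of "2*a" "2*a + k"] a by (auto simp: K_def)
    then show "0 \<le> K k a" "0 \<le> K k (2 * a)" .
    show "c ^ 2 * (K k a - K k (2 * a)) \<le> K k (2 * a)"
    \<comment> \<open>For \<open>k \<le> a\<close> the interval starting at \<open>2 * a\<close>
      stays below \<open>4 * a\<close>, so values of \<beta> are compared directly. For larger
      \<open>k\<close> only the loss over \<open>[a, 2a]\<close> counts; it is compared with the
      integral over \<open>[2a, 3a]\<close>, which the interval starting at \<open>2 * a\<close>
      contains.\<close>
    proof (cases "k \<le> a")
      case True
      have "c ^ 2 * (K k a - K k (2 * a)) \<le> c ^ 2 * (k * \<beta> a)"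
        using K_bounds(2)[of k a] a c2 K0 by (intro mult_left_mono) auto
      also have "\<dots> = k * (c ^ 2 * \<beta> a)" by simp
      also have "\<dots> \<le> k * \<beta> (4 * a)" using a by (intro mult_left_mono c4) auto
      also have "\<dots> \<le> k * \<beta> (2 * a + k)" using a True by (intro mult_left_mono anti) auto
      also have "\<dots> \<le> K k (2 * a)" using K_bounds[of k "2 * a"] a by auto
      finally show ?thesis .
    next
      case False
      have "K k a - K k (2 * a) = (B a - B (2 * a)) - (B (a + k) - B (2 * a + k))" by (simp add: K_def)
      also have "\<dots> \<le> a * \<beta> a" using B_diff(2)[of a "2 * a"] B_anti[of "a + k" "2 * a + k"] a by auto
      finally have "c ^ 2 * (K k a - K k (2 * a)) \<le> c ^ 2 * (a * \<beta> a)"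
        using c2 by (intro mult_left_mono) auto
      also have "\<dots> = a * (c ^ 2 * \<beta> a)" by simp
      also have "\<dots> \<le> a * \<beta> (4 * a)" using a by (intro mult_left_mono c4) auto
      also have "\<dots> \<le> a * \<beta> (3 * a)" using a by (intro mult_left_mono anti) auto
      also have "\<dots> \<le> B (2 * a) - B (3 * a)" using B_diff(1)[of "2 * a" "3 * a"] a by simp
      also have "\<dots> \<le> K k (2 * a)" using B_anti[of "3 * a" "2 * a + k"] a False by (simp add: K_def)
      finally show ?thesis .
    qed
  qed
  ultimately show ?thesis
    using c2 by (intro exI[of _ c']) (auto simp: c'_def)
qed

text \<open>The lower bound keeps only \<open>r < \<eta> + 1\<close>, where the exponential is at
  least \<open>exp (-1)\<close>. It ties \<open>H1\<close> to \<open>\<beta> / B\<close>.\<close>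

lemma H1_bounds:
  assumes "0 \<le> \<eta>"
  shows "H1 \<beta> \<eta> \<le> 1" "exp (-1) * \<beta> (\<eta> + 1) / B \<eta> \<le> H1 \<beta> \<eta>"
proof -
  let ?g = "\<lambda>r. exp (\<eta> - r) * \<beta> r"
  \<comment> \<open>Nothing is known of \<beta> off the half-line, so measurability is drawn from
    set integrability.\<close>
  have meas: "set_borel_measurable lborel {\<eta>..} \<beta>"
    using int[of \<eta> "{\<eta>..}"] assms
    unfolding set_integrable_def set_borel_measurable_def by (intro borel_measurable_integrable) auto
  have m2: "set_borel_measurable lborel {\<eta>..} ?g"
  proof -
    have "(\<lambda>r. exp (\<eta> - r) * (indicator {\<eta>..} r *\<^sub>R \<beta> r)) \<in> borel_measurable lborel"
      using meas unfolding set_borel_measurable_def by (intro borel_measurable_times) auto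
    then show ?thesis unfolding set_borel_measurable_def by (simp add: mult_ac)
  qed
  have le: "?g r \<le> \<beta> r" "0 \<le> ?g r" if "\<eta> \<le> r" for r
    using pos[of r] that assms by (auto simp: mult_le_cancel_right1)
  have ig: "set_integrable lborel {\<eta>..} ?g"
    by (rule set_integrable_bound[OF int[of \<eta>] m2]) (use le assms in \<open>auto intro!: AE_I2 intro: order_trans[OF _ abs_ge_self]\<close>)
  have "(LINT r:{\<eta>..}|lborel. ?g r) \<le> B \<eta>"
    unfolding B_def by (rule set_integral_mono[OF ig int[of \<eta>]]) (use le assms in auto)
  then show "H1 \<beta> \<eta> \<le> 1"
    using B_pos[OF assms] by (simp add: H1_def B_def)
  have const: "(LINT r:{\<eta>..<\<eta>+1}|lborel. c) = c" "set_integrable lborel {\<eta>..<\<eta>+1} (\<lambda>_. c)" for c :: real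
    by (auto simp: set_lebesgue_integral_def set_integrable_def)
  have ig2: "set_integrable lborel {\<eta>..<\<eta>+1} ?g" by (rule set_integrable_subset[OF ig]) auto
  have "exp (-1) * \<beta> (\<eta> + 1) = (LINT r:{\<eta>..<\<eta>+1}|lborel. exp (-1) * \<beta> (\<eta> + 1))" by (rule const(1)[symmetric])
  also have "\<dots> \<le> (LINT r:{\<eta>..<\<eta>+1}|lborel. ?g r)"
  proof (rule set_integral_mono[OF const(2) ig2])
    show "exp (-1) * \<beta> (\<eta> + 1) \<le> ?g r" if "r \<in> {\<eta>..<\<eta>+1}" for r
      using that assms pos[of "\<eta> + 1"] by (intro mult_mono anti) auto
  qed
  also have "\<dots> \<le> (LINT r:{\<eta>..}|lborel. ?g r)"
    unfolding set_lebesgue_integral_def using ig2 ig le pos assms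
    by (intro integral_mono) (auto simp: set_integrable_def split: split_indicator)
  finally show "exp (-1) * \<beta> (\<eta> + 1) / B \<eta> \<le> H1 \<beta> \<eta>"
    using B_pos[OF assms] by (simp add: H1_def B_def divide_right_mono)
qed

text \<open>The interface to the decision problem. \<open>D\<close> stands for
  \<open>\<beta> / B\<close>, and \<beta> appears only through \<open>H1\<close>, the quantity that
  G2 controls.\<close>

theorem beta_weights:
  obtains h :: "nat \<Rightarrow> real \<Rightarrow> real" and D :: "real \<Rightarrow> real" and C :: real
  where "\<And>i. h i \<in> borel_measurable borel" "D \<in> borel_measurable borel" "1 \<le> C"
    and "\<And>i \<eta>. 0 \<le> \<eta> \<Longrightarrow> 0 < h i \<eta>" "\<And>i \<eta>. 0 \<le> \<eta> \<Longrightarrow> h 0 \<eta> \<le> h i \<eta>" "\<And>i \<eta>. 0 \<le> \<eta> \<Longrightarrow> h i \<eta> \<le> 1"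
    and "\<And>\<eta>. 0 \<le> \<eta> \<Longrightarrow> (\<lambda>i. h i \<eta>) \<longlonglongrightarrow> 1"
    and "\<And>i \<eta> a. 0 \<le> \<eta> \<Longrightarrow> \<eta> / 2 \<le> a \<Longrightarrow> a \<le> 2 * \<eta> \<Longrightarrow> h i a \<le> C * h i \<eta>"
    and "\<And>i \<eta> a. 0 \<le> \<eta> \<Longrightarrow> \<eta> / 2 \<le> a \<Longrightarrow> a \<le> 2 * \<eta> \<Longrightarrow> h i \<eta> \<le> C * h i a"
    and "\<And>i \<eta> a. 0 \<le> \<eta> \<Longrightarrow> \<eta> / 2 \<le> a \<Longrightarrow> a \<le> 2 * \<eta> \<Longrightarrow> \<bar>h i a - h i \<eta>\<bar> \<le> C * \<bar>a - \<eta>\<bar> * D \<eta>"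
    and "\<And>i \<eta>. 0 \<le> \<eta> \<Longrightarrow> h i \<eta> \<le> real (Suc i) * D \<eta>"
    and "\<And>\<eta>. 0 \<le> \<eta> \<Longrightarrow> 0 < D \<eta>"
    and "\<And>\<eta>. 1 \<le> \<eta> \<Longrightarrow> D \<eta> \<le> C * H1 \<beta> \<eta>"
    and "\<And>e. 1 < e \<Longrightarrow> \<exists>c>0. \<forall>\<eta>\<ge>0. c * (1 + \<eta>) powr (- e) \<le> h 0 \<eta> \<and> c * (1 + \<eta>) powr (- e) \<le> H1 \<beta> \<eta>"
proof -
  obtain c where c: "0 < c" "c \<le> 1" "\<And>x. 0 \<le> x \<Longrightarrow> c * \<beta> x \<le> \<beta> (2 * x)" using doubling by auto
  obtain b where b: "0 < b" "b \<le> 1" "\<And>a. 0 \<le> a \<Longrightarrow> b * B a \<le> B (2 * a)"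
    "\<And>a k. 0 \<le> a \<Longrightarrow> 0 < k \<Longrightarrow> b * K k a \<le> K k (2 * a)"
    using B_doubling by auto
  \<comment> \<open>\<open>exp 1 / c\<close> compares \<open>D\<close> with \<open>H1\<close>.
    \<open>1 / (c * b * b)\<close> dominates \<open>1 / (b * b)\<close>, the price of moving both
    numerator and denominator of \<open>h i\<close> between comparable arguments.\<close>
  define C where "C = max (exp 1 / c) (1 / (c * b * b))"
  define h where "h i \<eta> = K (real (Suc i)) (max 0 \<eta>) / B (max 0 \<eta>)" for i \<eta>
  define D where "D \<eta> = \<beta> (max 0 \<eta>) / B (max 0 \<eta>)" for \<eta>
  have K_pos: "0 < K k \<eta>" if "0 < k" "0 \<le> \<eta>" for k \<eta>
    using K_bounds(1)[of k \<eta>] pos[of "\<eta> + k"] that by (smt (verit) mult_pos_pos)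
  have cb: "0 < c * b * b" "c * b * b \<le> 1" using b c by (auto intro!: mult_le_one)
  have "1 / (b * b) \<le> 1 / (c * b * b)" "1 / (c * b) \<le> 1 / (c * b * b)"
    using b c by (auto intro!: divide_left_mono mult_pos_pos simp: mult.assoc mult_le_cancel_right1 mult_le_cancel_left1)
  then have C: "1 / (c * b * b) \<le> C" "1 / (b * b) \<le> C" "1 / (c * b) \<le> C" "exp 1 / c \<le> C" "1 \<le> C"
    using cb by (auto simp: C_def le_max_iff_disj)
  \<comment> \<open>Clamping the argument at 0 turns a function that decreases on the half-line into
    one that decreases on the whole line, and monotone functions are Borel.\<close>
  have mm: "(\<lambda>x. g (max 0 x)) \<in> borel_measurable borel" if "\<And>x y. 0 \<le> x \<Longrightarrow> x \<le> y \<Longrightarrow> g y \<le> g x" for g :: "real \<Rightarrow> real"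
  proof -
    have "mono (\<lambda>x. - g (max 0 x))" using that by (auto simp: mono_def)
    from borel_measurable_mono[OF this] have "(\<lambda>x. - (- g (max 0 x))) \<in> borel_measurable borel"
      by (rule borel_measurable_uminus)
    then show ?thesis by (simp only: minus_minus)
  qed
  have [measurable]: "(\<lambda>x. \<beta> (max 0 x)) \<in> borel_measurable borel" "(\<lambda>x. B (max 0 x)) \<in> borel_measurable borel"
      "(\<lambda>x. K (real (Suc i)) (max 0 x)) \<in> borel_measurable borel" for i
    by (rule mm, use anti B_anti K_anti in auto)+
  show thesis
  proof (rule that[of h D C])
    show "h i \<in> borel_measurable borel" for i unfolding h_def by measurable
    show "D \<in> borel_measurable borel" unfolding D_def by measurable
    show "1 \<le> C" by (rule C)
    show "0 < h i \<eta>" "h i \<eta> \<le> 1" "0 < D \<eta>" "h i \<eta> \<le> real (Suc i) * D \<eta>" if "0 \<le> \<eta>" for i \<eta>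
      using K_pos[of "real (Suc i)" \<eta>] B_pos[of \<eta>] B_nonneg[of "\<eta> + real (Suc i)"] K_bounds(2)[of "real (Suc i)" \<eta>] pos[of \<eta>] that
      by (auto simp: h_def D_def K_def max_absorb2 divide_simps)
    show "h 0 \<eta> \<le> h i \<eta>" if "0 \<le> \<eta>" for i \<eta>
      using B_pos[of \<eta>] B_anti[of "\<eta> + 1" "\<eta> + real (Suc i)"] that by (auto simp: h_def K_def divide_simps)
    show "(\<lambda>i. h i \<eta>) \<longlonglongrightarrow> 1" if "0 \<le> \<eta>" for \<eta>
    proof -
      have "(\<lambda>i. (B \<eta> - B (\<eta> + real (Suc i))) / B \<eta>) \<longlonglongrightarrow> (B \<eta> - 0) / B \<eta>"
        using B_pos[OF that] B_tendsto_0[OF that] by (intro tendsto_intros) auto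
      then show ?thesis using B_pos[OF that] that by (simp add: h_def K_def max_absorb2)
    qed
    fix i and \<eta> a :: real
    assume \<eta>: "0 \<le> \<eta>" "\<eta> / 2 \<le> a" "a \<le> 2 * \<eta>"
    define k where "k = real (Suc i)"
    have k: "0 < k" by (simp add: k_def)
    have a: "0 \<le> a" using \<eta> by simp
    have h: "h i a = K k a / B a" "h i \<eta> = K k \<eta> / B \<eta>" using \<eta> a by (auto simp: h_def k_def max_absorb2)
    have B: "0 < B a" "0 < B \<eta>" "b * B \<eta> \<le> B a" "b * B a \<le> B \<eta>"
      using B_pos \<eta> a b(3)[of \<eta>] b(3)[of a] B_anti[of a "2 * \<eta>"] B_anti[of \<eta> "2 * a"] by auto
    have K: "0 < K k a" "0 < K k \<eta>" "b * K k \<eta> \<le> K k a" "b * K k a \<le> K k \<eta>"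
      using K_pos \<eta> a b(4)[of \<eta> k] b(4)[of a k] K_anti[of k a "2 * \<eta>"] K_anti[of k \<eta> "2 * a"] k by auto
    have step: "K k x / B x \<le> C * (K k y / B y)"
      if "0 < B x" "0 < B y" "b * B y \<le> B x" "b * K k x \<le> K k y" "0 < K k x" for x y
    proof -
      have "0 \<le> K k y" using mult_pos_pos[OF b(1) \<open>0 < K k x\<close>] that by linarith
      then have "K k x / B x \<le> (K k y / b) / (b * B y)"
        using that b by (intro frac_le) (auto simp: field_simps)
      also have "\<dots> = (1 / (b * b)) * (K k y / B y)" by simp
      also have "\<dots> \<le> C * (K k y / B y)"
        using that C(2) mult_pos_pos[OF b(1) \<open>0 < K k x\<close>] by (intro mult_right_mono divide_nonneg_pos) linarith+
      finally show ?thesis .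
    qed
    show "h i a \<le> C * h i \<eta>" "h i \<eta> \<le> C * h i a" unfolding h by (rule step; use B K in auto)+
    have lip: "\<bar>K k x / B x - K k y / B y\<bar> \<le> (y - x) * \<beta> x / B y" if xy: "0 \<le> x" "x \<le> y" for x y
    proof -
      \<comment> \<open>The two fractions arise from inserting \<open>B (y + k) / B x\<close>. Both
        are nonnegative and below the claimed bound, so their difference is too, without a factor 2
        and independently of \<open>k\<close>.\<close>
      let ?u = "(B (x + k) - B (y + k)) / B x" and ?v = "B (y + k) * (B x - B y) / (B x * B y)"
      have Bx: "0 < B x" "0 < B y" "B y \<le> B x" using xy B_pos B_anti by auto
      have d: "0 \<le> (y - x) * \<beta> x" using xy pos[of x] by simp
      have eq: "K k x / B x - K k y / B y = ?v - ?u"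
        using Bx by (simp add: K_def field_simps)
      have "B (x + k) - B (y + k) \<le> (y - x) * \<beta> (x + k)" using B_diff(2)[of "x + k" "y + k"] xy k by simp
      also have "\<dots> \<le> (y - x) * \<beta> x" using xy k by (intro mult_left_mono anti) auto
      finally have "?u \<le> (y - x) * \<beta> x / B y"
        using Bx d by (intro frac_le) auto
      moreover have "0 \<le> ?u" using Bx B_anti[of "x + k" "y + k"] xy k by simp
      moreover have "0 \<le> ?v" using Bx B_nonneg[of "y + k"] xy k by simp
      moreover have "?v \<le> (y - x) * \<beta> x / B y"
      proof -
        have "B (y + k) * (B x - B y) \<le> B x * ((y - x) * \<beta> x)"
          using B_diff(2)[of x y] B_anti[of x "y + k"] xy k Bx by (intro mult_mono) auto
        then have "B (y + k) * (B x - B y) / B x \<le> (y - x) * \<beta> x"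
          using Bx by (simp add: pos_divide_le_eq mult.commute)
        then have "B (y + k) * (B x - B y) / B x / B y \<le> (y - x) * \<beta> x / B y"
          using Bx by (intro divide_right_mono) auto
        then show ?thesis by simp
      qed
      ultimately show ?thesis unfolding eq by linarith
    qed
    show "\<bar>h i a - h i \<eta>\<bar> \<le> C * \<bar>a - \<eta>\<bar> * D \<eta>"
    \<comment> \<open>\<open>lip\<close> takes \<beta> at the smaller argument and \<open>B\<close>
      at the larger one. If \<open>a\<close> is the smaller, doubling of \<beta> moves the numerator
      to \<eta>; otherwise doubling of \<open>B\<close> moves the denominator.\<close>
    proof (cases "a \<le> \<eta>")
      case True
      have "c * \<beta> a \<le> \<beta> \<eta>" using c(3)[of a] anti[of \<eta> "2 * a"] \<eta> a by auto
      then have "\<beta> a \<le> \<beta> \<eta> / c" using c by (simp add: field_simps)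
      also have "\<dots> \<le> C * \<beta> \<eta>"
      proof -
        have "1 / c \<le> exp 1 / c" using c by (simp add: divide_right_mono)
        then have "1 / c \<le> C" using C(4) by simp
        then show ?thesis using mult_right_mono[of "1 / c" C "\<beta> \<eta>"] pos[OF \<eta>(1)] by simp
      qed
      finally have "(\<eta> - a) * \<beta> a / B \<eta> \<le> (\<eta> - a) * (C * \<beta> \<eta>) / B \<eta>"
        using True B by (intro divide_right_mono mult_left_mono) auto
      then show ?thesis using lip[OF a True] True \<eta> unfolding h by (simp add: D_def max_absorb2 mult_ac)
    next
      case False
      have "\<beta> \<eta> / B a \<le> \<beta> \<eta> / (b * B \<eta>)" using B b pos[OF \<eta>(1)] by (intro divide_left_mono) auto
      also have "\<dots> = (1 / b) * (\<beta> \<eta> / B \<eta>)" by simp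
      also have "\<dots> \<le> C * (\<beta> \<eta> / B \<eta>)"
      proof (rule mult_right_mono)
        have "1 / b \<le> 1 / (b * b)" using b by (intro divide_left_mono) (auto simp: mult_le_cancel_right1)
        then show "1 / b \<le> C" using C by simp
      qed (use B pos[OF \<eta>(1)] in auto)
      finally have "(a - \<eta>) * (\<beta> \<eta> / B a) \<le> (a - \<eta>) * (C * (\<beta> \<eta> / B \<eta>))"
        using False by (intro mult_left_mono) auto
      then show ?thesis using lip[of \<eta> a] False \<eta> unfolding h by (simp add: D_def max_absorb2 mult_ac abs_minus_commute)
    qed
  next
    fix \<eta> :: real assume \<eta>: "1 \<le> \<eta>"
    \<comment> \<open>Doubling reaches \<open>\<eta> + 1\<close> only if
      \<open>\<eta> + 1 \<le> 2 * \<eta>\<close>, whence the restriction to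
      \<open>1 \<le> \<eta>\<close>.\<close>
    have "c * \<beta> \<eta> \<le> \<beta> (\<eta> + 1)" using c(3)[of \<eta>] anti[of "\<eta> + 1" "2 * \<eta>"] \<eta> by auto
    then have "\<beta> \<eta> / B \<eta> \<le> (\<beta> (\<eta> + 1) / c) / B \<eta>"
      using c B_pos[of \<eta>] \<eta> by (intro divide_right_mono) (auto simp: field_simps)
    also have "\<dots> = (exp 1 / c) * (exp (-1) * \<beta> (\<eta> + 1) / B \<eta>)"
      by (simp add: exp_minus)
    also have "\<dots> \<le> C * H1 \<beta> \<eta>"
      using \<eta> C(4) c H1_bounds(2)[of \<eta>] pos[of "\<eta> + 1"] B_pos[of \<eta>] C(5) by (intro mult_mono) auto
    finally show "D \<eta> \<le> C * H1 \<beta> \<eta>" using \<eta> by (simp add: D_def max_absorb2)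
  next
    fix e :: real assume "1 < e"
    then obtain m where m: "0 < m" "\<And>\<eta>. 0 \<le> \<eta> \<Longrightarrow> m * (1 + \<eta>) powr (- e) \<le> \<beta> (\<eta> + 1)"
      using lower_power by blast
    show "\<exists>c>0. \<forall>\<eta>\<ge>0. c * (1 + \<eta>) powr (- e) \<le> h 0 \<eta> \<and> c * (1 + \<eta>) powr (- e) \<le> H1 \<beta> \<eta>"
    \<comment> \<open>One witness for both bounds: \<open>exp (-1)\<close> comes from
      \<open>H1_bounds\<close>, and \<open>B 0\<close> bounds every \<open>B \<eta>\<close> from
      above.\<close>
    proof (intro exI[of _ "exp (-1) * m / B 0"] conjI allI impI)
      show "0 < exp (-1) * m / B 0" using m B_pos[of 0] by simp
      fix \<eta> :: real assume \<eta>: "0 \<le> \<eta>"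
      have *: "exp (-1) * m / B 0 * (1 + \<eta>) powr (- e) \<le> exp (-1) * \<beta> (\<eta> + 1) / B \<eta>"
        using m \<eta> pos[of "\<eta> + 1"] B_pos[of \<eta>] B_anti[of 0 \<eta>]
        by (simp add: mult.assoc[symmetric]) (intro frac_le mult_left_mono; simp add: mult.assoc)
      then show "exp (-1) * m / B 0 * (1 + \<eta>) powr (- e) \<le> H1 \<beta> \<eta>" using H1_bounds(2)[OF \<eta>] by simp
      have "exp (-1) * \<beta> (\<eta> + 1) \<le> 1 * \<beta> (\<eta> + 1)" using pos[of "\<eta> + 1"] \<eta> by (intro mult_right_mono) auto
      also have "\<dots> \<le> K 1 \<eta>" using K_bounds(1)[of 1 \<eta>] \<eta> by simp
      finally have "exp (-1) * \<beta> (\<eta> + 1) / B \<eta> \<le> h 0 \<eta>"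
        using B_pos[OF \<eta>] \<eta> by (simp add: h_def max_absorb2 divide_right_mono)
      with * show "exp (-1) * m / B 0 * (1 + \<eta>) powr (- e) \<le> h 0 \<eta>" by simp
    qed
  qed
qed

end

section \<open>Growth of the prior\<close>

text \<open>The hypothesis on \<open>G'\<close> says that \<open>ln (G x) - t * ln x\<close> has a
  nonnegative derivative.\<close>

lemma log_derivative_ge:
  fixes G :: "real \<Rightarrow> real"
  assumes "0 < a" "a \<le> b"
    and G: "\<And>x. a \<le> x \<Longrightarrow> x \<le> b \<Longrightarrow> 0 < G x \<and> (G has_real_derivative G' x) (at x) \<and> t \<le> x * G' x / G x"
  shows "G a * (b / a) powr t \<le> G b"
proof -
  have "(\<lambda>x. ln (G x) - t * ln x) a \<le> (\<lambda>x. ln (G x) - t * ln x) b"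
  proof (rule DERIV_nonneg_imp_nondecreasing[OF \<open>a \<le> b\<close>])
    fix x assume x: "a \<le> x" "x \<le> b"
    have x0: "0 < x" using x assms by simp
    have "((\<lambda>x. ln (G x) - t * ln x) has_real_derivative (G' x / G x - t / x)) (at x)"
      using G[OF x] x0 by (auto intro!: derivative_eq_intros)
    moreover have "t / x \<le> (x * G' x / G x) / x" using G[OF x] x0 by (intro divide_right_mono) auto
    then have "0 \<le> G' x / G x - t / x" using x0 by simp
    ultimately show "\<exists>y. ((\<lambda>x. ln (G x) - t * ln x) has_real_derivative y) (at x) \<and> 0 \<le> y" by blast
  qed
  then have "ln (G a) + t * (ln b - ln a) \<le> ln (G b)" by (simp add: algebra_simps)
  then have "exp (ln (G a) + t * (ln b - ln a)) \<le> exp (ln (G b))" by simp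
  moreover have "exp (t * (ln b - ln a)) = (b / a) powr t"
    using assms by (simp add: powr_def ln_div)
  ultimately show ?thesis using G[of a] G[of b] assms by (simp add: exp_add)
qed

text \<open>This is the preceding estimate for \<open>1 / G\<close>, whose logarithmic derivative
  has the opposite sign.\<close>

lemma log_derivative_le:
  fixes G :: "real \<Rightarrow> real"
  assumes "0 < a" "a \<le> b"
    and G: "\<And>x. a \<le> x \<Longrightarrow> x \<le> b \<Longrightarrow> 0 < G x \<and> (G has_real_derivative G' x) (at x) \<and> x * G' x / G x \<le> t"
  shows "G b \<le> G a * (b / a) powr t"
proof -
  have "(\<lambda>x. 1 / G x) a * (b / a) powr (- t) \<le> (\<lambda>x. 1 / G x) b"
  proof (rule log_derivative_ge[where G' = "\<lambda>x. - G' x / (G x)\<^sup>2"])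
    fix x assume x: "a \<le> x" "x \<le> b"
    show "0 < 1 / G x \<and> ((\<lambda>x. 1 / G x) has_real_derivative - G' x / (G x)\<^sup>2) (at x) \<and> - t \<le> x * (- G' x / (G x)\<^sup>2) / (1 / G x)"
      using G[OF x] by (auto intro!: derivative_eq_intros simp: power2_eq_square)
  qed (use assms in auto)
  then show ?thesis
    using G[of a] G[of b] assms by (simp add: powr_minus field_simps)
qed

lemma prior_growth:
  assumes pos: "\<forall>\<eta>>0. 0 < G \<eta>" and G1: "cond_G1 G t1 t2"
  obtains r C c where "1 \<le> r" "1 \<le> C" "0 < c"
    "\<And>a \<eta>. r \<le> a \<Longrightarrow> \<eta> / 2 \<le> a \<Longrightarrow> a \<le> 2 * \<eta> \<Longrightarrow> r \<le> \<eta> \<Longrightarrow> G a \<le> C * G \<eta>"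
    "\<And>\<eta>. r \<le> \<eta> \<Longrightarrow> c * \<eta> powr t1 \<le> G \<eta>"
proof -
  from G1 obtain r1 where "0 < r1" and r1: "\<And>\<eta>. r1 \<le> \<eta> \<Longrightarrow> t1 \<le> \<eta> * deriv G \<eta> / G \<eta> \<and> \<eta> * deriv G \<eta> / G \<eta> \<le> t2"
    by (auto simp: cond_G1_def)
  obtain D where "\<And>x. 0 < x \<Longrightarrow> (G has_vector_derivative D x) (at x)"
    using G1 by (auto simp: cond_G1_def C1_differentiable_on_def)
  then have D: "(G has_real_derivative deriv G x) (at x)" if "0 < x" for x
    using that by (metis DERIV_imp_deriv has_real_derivative_iff_has_vector_derivative)
  define r where "r = max 1 r1"
  have r: "1 \<le> r" "r1 \<le> r" by (auto simp: r_def)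
  have ge: "G a * (b / a) powr t1 \<le> G b" if "r \<le> a" "a \<le> b" for a b
    using that r pos D r1 by (intro log_derivative_ge[where G'="deriv G"]) auto
  have le: "G b \<le> G a * (b / a) powr t2" if "r \<le> a" "a \<le> b" for a b
    using that r pos D r1 by (intro log_derivative_le[where G'="deriv G"]) auto
  \<comment> \<open>The absolute values bound each power of a ratio between 1 and 2 whatever the
    sign of its exponent. The exponent \<open>t1\<close> is needed for
    \<open>a \<le> \<eta>\<close>, and \<open>t2\<close> for \<open>a > \<eta>\<close>.\<close>
  define C where "C = 2 powr \<bar>t1\<bar> + 2 powr \<bar>t2\<bar>"
  have pb: "y powr t \<le> 2 powr \<bar>t\<bar>" if "1 \<le> y" "y \<le> 2" for y t :: real
    using that by (smt (verit) powr_mono powr_mono2)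
  have [simp]: "0 \<le> 2 powr \<bar>t\<bar>" for t :: real by simp
  have "G a \<le> C * G \<eta>" if a: "r \<le> a" "\<eta> / 2 \<le> a" "a \<le> 2 * \<eta>" "r \<le> \<eta>" for a \<eta>
  proof (cases "a \<le> \<eta>")
    case True
    have Ga: "0 < G a" "0 < G \<eta>" using pos a r by auto
    have y: "1 \<le> \<eta> / a" "\<eta> / a \<le> 2" using True a r by (auto simp: field_simps)
    have "1 = (\<eta> / a) powr t1 * (\<eta> / a) powr (- t1)" using a r by (simp add: powr_minus)
    also have "\<dots> \<le> (\<eta> / a) powr t1 * 2 powr \<bar>t1\<bar>" using pb[of "\<eta> / a" "- t1"] y by (intro mult_left_mono) auto
    finally have "G a * 1 \<le> G a * ((\<eta> / a) powr t1 * 2 powr \<bar>t1\<bar>)" using Ga by (intro mult_left_mono) auto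
    also have "\<dots> \<le> G \<eta> * 2 powr \<bar>t1\<bar>" using mult_right_mono[OF ge[OF a(1) True], of "2 powr \<bar>t1\<bar>"] by (simp add: mult.assoc)
    also have "\<dots> \<le> G \<eta> * C" using Ga by (intro mult_left_mono) (auto simp: C_def)
    finally show ?thesis by (simp add: mult.commute)
  next
    case False
    have G: "0 < G \<eta>" using pos a r by auto
    have y: "1 \<le> a / \<eta>" "a / \<eta> \<le> 2" using False a r by (auto simp: field_simps)
    have "G a \<le> G \<eta> * (a / \<eta>) powr t2" using le[of \<eta> a] a False by simp
    also have "\<dots> \<le> G \<eta> * C"
      using G pb[OF y, of t2] by (intro mult_left_mono) (auto simp: C_def intro: order_trans)
    finally show ?thesis by (simp add: mult.commute)
  qed
  moreover have "G r * r powr (- t1) * \<eta> powr t1 \<le> G \<eta>" if "r \<le> \<eta>" for \<eta>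
    using ge[of r \<eta>] that r by (simp add: powr_divide powr_minus field_simps)
  moreover have "0 < G r * r powr (- t1)" using pos r by simp
  moreover have "1 \<le> C" unfolding C_def using ge_one_powr_ge_zero[of 2 "\<bar>t1\<bar>"] by (simp add: add_increasing2)
  ultimately show ?thesis using r by (intro that[of r C "G r * r powr (- t1)"]) auto
qed

text \<open>At 0 the logarithmic derivative of \<open>\<eta> ^ (p - 1) * G \<eta>\<close>,
  multiplied by \<eta>, has the positive limit \<open>t0 + p - 1\<close>, so this product increases
  near 0; on the remaining compact interval it is continuous. The result is the bound at the origin
  that \<open>nn_integral_radial_finite\<close> asks for.\<close>

lemma prior_near_0:
  assumes pos: "\<forall>\<eta>>0. 0 < G \<eta>" and G1: "cond_G1 G t1 t2" and G3: "cond_G3 p G" and "0 < R" "0 < p"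
  obtains M where "0 < M" "\<And>\<eta>. 0 < \<eta> \<Longrightarrow> \<eta> \<le> R \<Longrightarrow> \<eta> ^ (p - 1) * G \<eta> \<le> M"
proof -
  obtain D where D': "\<And>x. 0 < x \<Longrightarrow> (G has_vector_derivative D x) (at x)"
    using G1 by (auto simp: cond_G1_def C1_differentiable_on_def)
  then have D: "(G has_real_derivative deriv G x) (at x)" if "0 < x" for x
    using that by (metis DERIV_imp_deriv has_real_derivative_iff_has_vector_derivative)
  obtain t0 where t0: "1 - real p < t0" "((\<lambda>\<eta>. \<eta> * deriv G \<eta> / G \<eta>) \<longlongrightarrow> t0) (at_right 0)"
    using G3 by (auto simp: cond_G3_def)
  from order_tendstoD(1)[OF t0(2,1)]
  obtain b where b: "0 < b" "\<And>x. 0 < x \<Longrightarrow> x < b \<Longrightarrow> 1 - real p < x * deriv G x / G x"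
    unfolding eventually_at_right_field by auto
  \<comment> \<open>Half of \<open>b\<close>, because the bound on the logarithmic derivative holds
    only strictly below \<open>b\<close>.\<close>
  define \<epsilon> where "\<epsilon> = min (b / 2) R"
  have \<epsilon>: "0 < \<epsilon>" "\<epsilon> < b" "\<epsilon> \<le> R" using b \<open>0 < R\<close> by (auto simp: \<epsilon>_def min_def)
  have near: "\<eta> ^ (p - 1) * G \<eta> \<le> \<epsilon> ^ (p - 1) * G \<epsilon>" if \<eta>: "0 < \<eta>" "\<eta> \<le> \<epsilon>" for \<eta>
  proof -
    have "G \<eta> * (\<epsilon> / \<eta>) powr (1 - real p) \<le> G \<epsilon>"
    proof (rule log_derivative_ge[where G'="deriv G"])
      fix x assume "\<eta> \<le> x" "x \<le> \<epsilon>"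
      then show "0 < G x \<and> (G has_real_derivative deriv G x) (at x) \<and> 1 - real p \<le> x * deriv G x / G x"
        using pos D[of x] b(2)[of x] \<eta> \<epsilon> by auto
    qed (use \<eta> in auto)
    moreover have "(\<epsilon> / \<eta>) powr (1 - real p) = \<eta> ^ (p - 1) / \<epsilon> ^ (p - 1)"
    proof -
      have "(\<epsilon> / \<eta>) powr (1 - real p) = (\<epsilon> / \<eta>) powr (- real (p - 1))"
        using \<open>0 < p\<close> by (simp add: of_nat_diff)
      also have "\<dots> = inverse ((\<epsilon> / \<eta>) ^ (p - 1))" using \<eta> \<epsilon> by (simp add: powr_minus powr_realpow)
      finally show ?thesis by (simp add: power_divide)
    qed
    ultimately show ?thesis using \<epsilon> by (simp add: field_simps)
  qed
  have "continuous_on {\<epsilon>..R} (\<lambda>\<eta>. \<eta> ^ (p - 1) * G \<eta>)"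
  proof (intro continuous_intros continuous_at_imp_continuous_on ballI)
    fix x assume "x \<in> {\<epsilon>..R}"
    then show "isCont G x" using D[of x] \<epsilon> by (auto intro: DERIV_isCont)
  qed
  then have "bounded ((\<lambda>\<eta>. \<eta> ^ (p - 1) * G \<eta>) ` {\<epsilon>..R})"
    by (intro compact_imp_bounded compact_continuous_image) auto
  then obtain M where M: "0 < M" "\<And>\<eta>. \<epsilon> \<le> \<eta> \<Longrightarrow> \<eta> \<le> R \<Longrightarrow> norm (\<eta> ^ (p - 1) * G \<eta>) \<le> M"
    unfolding bounded_pos by auto
  show ?thesis
  proof (rule that[OF M(1)])
    fix \<eta> assume \<eta>: "0 < \<eta>" "\<eta> \<le> R"
    show "\<eta> ^ (p - 1) * G \<eta> \<le> M"
    proof (cases "\<epsilon> \<le> \<eta>")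
      case True
      then show ?thesis using M(2)[of \<eta>] \<eta> by simp
    next
      case False
      have "\<epsilon> ^ (p - 1) * G \<epsilon> \<le> M" using M(2)[of \<epsilon>] \<epsilon> by simp
      with near[of \<eta>] \<eta> False show ?thesis by simp
    qed
  qed
qed

section \<open>Blyth's method\<close>

definition marginal :: "(real \<Rightarrow> real) \<Rightarrow> (real^'n \<Rightarrow> real) \<Rightarrow> real^'n \<Rightarrow> real" where
  "marginal f w x = (\<integral>\<theta>. f (norm (x - \<theta>)) * w \<theta> \<partial>lborel)"

lemma marginal_measurable:
  fixes w :: "real^'n \<Rightarrow> real"
  assumes [measurable]: "(\<lambda>y. f (norm (y :: real^'n))) \<in> borel_measurable borel" "w \<in> borel_measurable borel"
  shows "marginal f w \<in> borel_measurable borel"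
proof -
  have [measurable]: "(\<lambda>(x, \<theta>). f (norm (x - \<theta> :: real^'n))) \<in> borel_measurable (borel \<Otimes>\<^sub>M lborel)"
    using measurable_compose[of "\<lambda>(x, \<theta>). x - \<theta> :: real^'n" "borel \<Otimes>\<^sub>M lborel" borel, OF _ assms(1)]
    by (simp add: case_prod_beta')
  show ?thesis unfolding marginal_def by measurable
qed

lemma gen_bayes_measurable:
  fixes w :: "real^'n \<Rightarrow> real"
  assumes [measurable]: "(\<lambda>y. f (norm (y :: real^'n))) \<in> borel_measurable borel" "w \<in> borel_measurable borel"
  shows "gen_bayes f w \<in> borel_measurable borel"
proof -
  have [measurable]: "(\<lambda>(x, \<theta>). f (norm (x - \<theta> :: real^'n))) \<in> borel_measurable (borel \<Otimes>\<^sub>M lborel)"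
    using measurable_compose[of "\<lambda>(x, \<theta>). x - \<theta> :: real^'n" "borel \<Otimes>\<^sub>M lborel" borel, OF _ assms(1)]
    by (simp add: case_prod_beta')
  show ?thesis unfolding gen_bayes_def[abs_def] by measurable
qed

section \<open>Quadratic loss and its posterior decomposition\<close>

lemma positive_definite_sym:
  fixes Q :: "real^'n^'n"
  assumes "positive_definite Q"
  shows "x \<bullet> (Q *v y) = y \<bullet> (Q *v x)"
  using assms dot_lmul_matrix[of x Q y] transpose_matrix_vector[of Q x]
  by (simp add: positive_definite_def inner_commute)

lemma quadratic_loss_nonneg: "positive_definite Q \<Longrightarrow> 0 \<le> quadratic_loss Q \<theta> a"
  by (cases "a = \<theta>") (auto simp: quadratic_loss_def positive_definite_def intro: less_imp_le)

lemma quadratic_loss_eq_0: "positive_definite Q \<Longrightarrow> quadratic_loss Q \<theta> a = 0 \<Longrightarrow> a = \<theta>"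
  by (auto simp: quadratic_loss_def positive_definite_def) (metis eq_iff_diff_eq_0 less_irrefl)

lemma quadratic_loss_measurable [measurable (raw)]:
  fixes Q :: "real^'n^'n"
  assumes [measurable]: "a \<in> borel_measurable M" "b \<in> borel_measurable M"
  shows "(\<lambda>x. quadratic_loss Q (a x) (b x)) \<in> borel_measurable M"
proof -
  have [measurable]: "(\<lambda>x. Q *v x) \<in> borel_measurable borel"
    by (intro borel_measurable_continuous_onI linear_continuous_on matrix_vector_mul_bounded_linear)
  show ?thesis unfolding quadratic_loss_def by measurable
qed

lemma quadratic_loss_le:
  fixes Q :: "real^'n^'n"
  obtains C where "0 \<le> C" "\<And>a b. quadratic_loss Q a b \<le> C * (norm (a - b))\<^sup>2"
proof -
  obtain C where C: "0 < C" "\<And>x. norm (Q *v x) \<le> norm x * C"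
    using bounded_linear.pos_bounded[OF matrix_vector_mul_bounded_linear[of Q]] by blast
  have "quadratic_loss Q a b \<le> C * (norm (a - b))\<^sup>2" for a b
  proof -
    have "quadratic_loss Q a b \<le> norm (b - a) * norm (Q *v (b - a))"
      unfolding quadratic_loss_def by (rule norm_cauchy_schwarz)
    also have "\<dots> \<le> norm (b - a) * (norm (b - a) * C)" using C by (intro mult_left_mono) auto
    finally show ?thesis by (simp add: power2_eq_square norm_minus_commute mult_ac)
  qed
  with C show ?thesis by (intro that[of C]) auto
qed

text \<open>Parallelogram law: the quadratic forms of \<open>u + v\<close> and \<open>v - u\<close>
  add up to twice those of \<open>u\<close> and \<open>v\<close>, and the first is
  nonnegative.\<close>

lemma quadratic_loss_triangle:
  fixes Q :: "real^'n^'n"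
  assumes Q: "positive_definite Q"
  shows "quadratic_loss Q a c \<le> 2 * quadratic_loss Q b a + 2 * quadratic_loss Q b c"
proof -
  define u v where "u = a - b" and "v = c - b"
  have "0 \<le> (u + v) \<bullet> (Q *v (u + v))"
    using quadratic_loss_nonneg[OF Q, of 0 "u + v"] by (simp add: quadratic_loss_def)
  then have "(v - u) \<bullet> (Q *v (v - u)) \<le> 2 * (u \<bullet> (Q *v u)) + 2 * (v \<bullet> (Q *v v))"
    using positive_definite_sym[OF Q, of u v]
    by (simp add: matrix_vector_mult_diff_distrib matrix_vector_right_distrib inner_simps)
  then show ?thesis by (simp add: quadratic_loss_def u_def v_def)
qed

lemma integrable_weighted_mean:
  fixes u :: "'a::euclidean_space \<Rightarrow> real"
  assumes [measurable]: "u \<in> borel_measurable borel" and "\<And>\<theta>. 0 \<le> u \<theta>"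
    and u: "integrable lborel u" and u2: "integrable lborel (\<lambda>\<theta>. u \<theta> * (norm \<theta>)\<^sup>2)"
  shows "integrable lborel (\<lambda>\<theta>. u \<theta> *\<^sub>R \<theta>)"
proof (rule Bochner_Integration.integrable_bound)
  show "integrable lborel (\<lambda>\<theta>. u \<theta> + u \<theta> * (norm \<theta>)\<^sup>2)" using u u2 by simp
  have "norm \<theta> \<le> 1 + (norm \<theta>)\<^sup>2" for \<theta> :: 'a
    using zero_le_power2[of "norm \<theta> - 1"] norm_ge_zero[of \<theta>] unfolding power2_diff one_power2 mult_1_right by linarith
  then have "u \<theta> * norm \<theta> \<le> u \<theta> * (1 + (norm \<theta>)\<^sup>2)" for \<theta>
    using assms(2) by (intro mult_left_mono)
  then show "AE \<theta> in lborel. norm (u \<theta> *\<^sub>R \<theta>) \<le> norm (u \<theta> + u \<theta> * (norm \<theta>)\<^sup>2)"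
    using assms(2) by (intro AE_I2) (simp add: abs_mult distrib_left)
qed measurable

text \<open>Pythagoras for the form \<open>Q\<close>: the cross term integrates to zero at the
  weighted mean \<open>m\<close>. The first summand does not involve \<open>a\<close>, so it cancels
  when two actions are compared.\<close>

lemma weighted_quadratic_loss:
  fixes u :: "real^'n \<Rightarrow> real" and Q :: "real^'n^'n"
  assumes Q: "positive_definite Q"
    and [measurable]: "u \<in> borel_measurable borel" and nn: "\<And>\<theta>. 0 \<le> u \<theta>"
    and u: "integrable lborel u" and u2: "integrable lborel (\<lambda>\<theta>. u \<theta> * (norm \<theta>)\<^sup>2)"
    and W: "0 < (\<integral>\<theta>. u \<theta> \<partial>lborel)"
  defines "m \<equiv> (\<integral>\<theta>. u \<theta> *\<^sub>R \<theta> \<partial>lborel) /\<^sub>R (\<integral>\<theta>. u \<theta> \<partial>lborel)"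
  shows "(\<integral>\<^sup>+\<theta>. ennreal (u \<theta> * quadratic_loss Q \<theta> a) \<partial>lborel) =
    ennreal (\<integral>\<theta>. u \<theta> * quadratic_loss Q \<theta> m \<partial>lborel) + ennreal ((\<integral>\<theta>. u \<theta> \<partial>lborel) * quadratic_loss Q m a)"
proof -
  have u1: "integrable lborel (\<lambda>\<theta>. u \<theta> *\<^sub>R \<theta>)"
    using assms by (intro integrable_weighted_mean) auto
  obtain C where C: "0 \<le> C" "\<And>a b. quadratic_loss Q a b \<le> C * (norm (a - b))\<^sup>2"
    using quadratic_loss_le[of Q] by blast
  have int: "integrable lborel (\<lambda>\<theta>. u \<theta> * quadratic_loss Q \<theta> b)" for b
  proof (rule Bochner_Integration.integrable_bound)
    show "integrable lborel (\<lambda>\<theta>. 2 * C * (u \<theta> * (norm \<theta>)\<^sup>2) + 2 * C * (norm b)\<^sup>2 * u \<theta>)"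
      using u u2 by simp
    have "quadratic_loss Q \<theta> b \<le> 2 * C * (norm \<theta>)\<^sup>2 + 2 * C * (norm b)\<^sup>2" for \<theta>
    proof -
      have "(norm (\<theta> - b))\<^sup>2 \<le> (norm \<theta> + norm b)\<^sup>2" by (intro power_mono norm_triangle_ineq4) auto
      also have "\<dots> \<le> 2 * (norm \<theta>)\<^sup>2 + 2 * (norm b)\<^sup>2" using sum_squares_bound[of "norm \<theta>" "norm b"] by (simp add: power2_sum)
      finally have "C * (norm (\<theta> - b))\<^sup>2 \<le> C * (2 * (norm \<theta>)\<^sup>2 + 2 * (norm b)\<^sup>2)" using C by (intro mult_left_mono)
      then show ?thesis using C(2)[of \<theta> b] by (simp add: algebra_simps)
    qed
    then have "u \<theta> * quadratic_loss Q \<theta> b \<le> u \<theta> * (2 * C * (norm \<theta>)\<^sup>2 + 2 * C * (norm b)\<^sup>2)" for \<theta>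
      using nn by (intro mult_left_mono)
    then show "AE \<theta> in lborel. norm (u \<theta> * quadratic_loss Q \<theta> b) \<le> norm (2 * C * (u \<theta> * (norm \<theta>)\<^sup>2) + 2 * C * (norm b)\<^sup>2 * u \<theta>)"
      using nn C quadratic_loss_nonneg[OF Q, of _ b] by (intro AE_I2) (simp add: abs_mult algebra_simps)
  qed measurable
  have expand: "u \<theta> * quadratic_loss Q \<theta> a = u \<theta> * quadratic_loss Q \<theta> m + u \<theta> * quadratic_loss Q m a +
      2 * ((u \<theta> *\<^sub>R m - u \<theta> *\<^sub>R \<theta>) \<bullet> (Q *v (a - m)))" for \<theta>
  proof -
    have "a - \<theta> = (a - m) + (m - \<theta>)" by simp
    then have "quadratic_loss Q \<theta> a = quadratic_loss Q \<theta> m + quadratic_loss Q m a + 2 * ((m - \<theta>) \<bullet> (Q *v (a - m)))"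
      unfolding quadratic_loss_def using positive_definite_sym[OF Q, of "a - m" "m - \<theta>"]
      by (simp only: matrix_vector_right_distrib inner_add_left inner_add_right)
    moreover have "(u \<theta> *\<^sub>R m - u \<theta> *\<^sub>R \<theta>) \<bullet> (Q *v (a - m)) = u \<theta> * ((m - \<theta>) \<bullet> (Q *v (a - m)))"
      by (simp flip: scaleR_diff_right)
    ultimately show ?thesis by (simp add: distrib_left)
  qed
  have "(\<integral>\<theta>. (u \<theta> *\<^sub>R m - u \<theta> *\<^sub>R \<theta>) \<bullet> (Q *v (a - m)) \<partial>lborel) = (\<integral>\<theta>. u \<theta> *\<^sub>R m - u \<theta> *\<^sub>R \<theta> \<partial>lborel) \<bullet> (Q *v (a - m))"
    using u u1 by (intro integral_inner_left) auto
  also have "(\<integral>\<theta>. u \<theta> *\<^sub>R m - u \<theta> *\<^sub>R \<theta> \<partial>lborel) = 0"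
    using u u1 W by (simp add: m_def)
  finally have cross: "(\<integral>\<theta>. (u \<theta> *\<^sub>R m - u \<theta> *\<^sub>R \<theta>) \<bullet> (Q *v (a - m)) \<partial>lborel) = 0" by simp
  have ci: "integrable lborel (\<lambda>\<theta>. (u \<theta> *\<^sub>R m - u \<theta> *\<^sub>R \<theta>) \<bullet> (Q *v (a - m)))" using u u1 by auto
  have "(\<integral>\<theta>. u \<theta> * quadratic_loss Q \<theta> a \<partial>lborel) = (\<integral>\<theta>. u \<theta> * quadratic_loss Q \<theta> m \<partial>lborel) + (\<integral>\<theta>. u \<theta> \<partial>lborel) * quadratic_loss Q m a"
    unfolding expand[abs_def] using u int[of m] ci cross by (subst Bochner_Integration.integral_add; simp)+
  moreover have "(\<integral>\<^sup>+\<theta>. ennreal (u \<theta> * quadratic_loss Q \<theta> a) \<partial>lborel) = ennreal (\<integral>\<theta>. u \<theta> * quadratic_loss Q \<theta> a \<partial>lborel)"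
    using int nn quadratic_loss_nonneg[OF Q] by (intro nn_integral_eq_integral AE_I2) auto
  ultimately show ?thesis
    using W nn quadratic_loss_nonneg[OF Q] by (simp add: ennreal_plus Bochner_Integration.integral_nonneg)
qed


lemma gen_bayes_quadratic_loss:
  fixes w :: "real^'n \<Rightarrow> real" and Q :: "real^'n^'n"
  assumes Q: "positive_definite Q"
    and [measurable]: "(\<lambda>y. f (norm (y :: real^'n))) \<in> borel_measurable borel" "w \<in> borel_measurable borel"
    and nn: "\<And>y :: real^'n. 0 \<le> f (norm y)" "\<And>\<theta>. 0 \<le> w \<theta>"
    and "integrable lborel (\<lambda>\<theta>. f (norm (x - \<theta>)) * w \<theta>)"
    and "integrable lborel (\<lambda>\<theta>. f (norm (x - \<theta>)) * w \<theta> * (norm \<theta>)\<^sup>2)"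
    and "0 < marginal f w x"
  shows "(\<integral>\<^sup>+\<theta>. ennreal (f (norm (x - \<theta>)) * w \<theta> * quadratic_loss Q \<theta> a) \<partial>lborel) =
    ennreal (\<integral>\<theta>. f (norm (x - \<theta>)) * w \<theta> * quadratic_loss Q \<theta> (gen_bayes f w x) \<partial>lborel) +
    ennreal (marginal f w x * quadratic_loss Q (gen_bayes f w x) a)"
proof -
  have "(\<lambda>\<theta>. f (norm (x - \<theta>))) \<in> borel_measurable borel"
    using measurable_compose[of "\<lambda>\<theta>. x - \<theta>" borel borel, OF _ assms(2)] by simp
  then have "(\<lambda>\<theta>. f (norm (x - \<theta>)) * w \<theta>) \<in> borel_measurable borel" by measurable
  then show ?thesis
    unfolding gen_bayes_def marginal_def
    using assms by (intro weighted_quadratic_loss) (auto simp: marginal_def)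
qed

text \<open>Tonelli turns the Bayes risk into an integral over observations, where the posterior
  decomposition can be applied for almost every \<open>x\<close>.\<close>

lemma nn_integral_risk:
  fixes w :: "real^'n \<Rightarrow> real" and Q :: "real^'n^'n"
  assumes Q: "positive_definite Q"
    and [measurable]: "(\<lambda>y. f (norm (y :: real^'n))) \<in> borel_measurable borel" "w \<in> borel_measurable borel"
      "\<delta> \<in> borel_measurable borel"
    and nn: "\<And>y :: real^'n. 0 \<le> f (norm y)" "\<And>\<theta>. 0 \<le> w \<theta>"
  shows "(\<integral>\<^sup>+\<theta>. ennreal (w \<theta>) * risk f Q \<theta> \<delta> \<partial>lborel) =
    (\<integral>\<^sup>+x. \<integral>\<^sup>+\<theta>. ennreal (f (norm (x - \<theta>)) * w \<theta> * quadratic_loss Q \<theta> (\<delta> x)) \<partial>lborel \<partial>lborel)"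
proof -
  have [measurable]: "(\<lambda>(\<theta>, x). f (norm (x - \<theta> :: real^'n))) \<in> borel_measurable (lborel \<Otimes>\<^sub>M lborel)"
    using measurable_compose[of "\<lambda>(\<theta>, x). x - \<theta> :: real^'n" "lborel \<Otimes>\<^sub>M lborel" borel, OF _ assms(2)]
    by (simp add: case_prod_beta')
  have "(\<integral>\<^sup>+\<theta>. ennreal (w \<theta>) * risk f Q \<theta> \<delta> \<partial>lborel) =
      (\<integral>\<^sup>+\<theta>. \<integral>\<^sup>+x. ennreal (f (norm (x - \<theta>)) * w \<theta> * quadratic_loss Q \<theta> (\<delta> x)) \<partial>lborel \<partial>lborel)"
  proof (rule nn_integral_cong)
    fix \<theta> :: "real^'n"
    have [measurable]: "(\<lambda>x. f (norm (x - \<theta>))) \<in> borel_measurable borel"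
      using measurable_compose[of "\<lambda>x. x - \<theta>" borel borel, OF _ assms(2)] by simp
    have "ennreal (w \<theta>) * risk f Q \<theta> \<delta> =
        ennreal (w \<theta>) * (\<integral>\<^sup>+x. ennreal (f (norm (x - \<theta>))) * ennreal (quadratic_loss Q \<theta> (\<delta> x)) \<partial>lborel)"
      unfolding risk_def location_distr_def by (subst nn_integral_density) auto
    also have "\<dots> = (\<integral>\<^sup>+x. ennreal (w \<theta>) * (ennreal (f (norm (x - \<theta>))) * ennreal (quadratic_loss Q \<theta> (\<delta> x))) \<partial>lborel)"
      by (rule nn_integral_cmult[symmetric]) measurable
    finally show "ennreal (w \<theta>) * risk f Q \<theta> \<delta> =
        (\<integral>\<^sup>+x. ennreal (f (norm (x - \<theta>)) * w \<theta> * quadratic_loss Q \<theta> (\<delta> x)) \<partial>lborel)"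
      using nn quadratic_loss_nonneg[OF Q] by (simp add: ennreal_mult mult_ac)
  qed
  also have "\<dots> = (\<integral>\<^sup>+x. \<integral>\<^sup>+\<theta>. ennreal (f (norm (x - \<theta>)) * w \<theta> * quadratic_loss Q \<theta> (\<delta> x)) \<partial>lborel \<partial>lborel)"
    by (rule lborel_pair.Fubini'[symmetric]) measurable
  finally show ?thesis .
qed

text \<open>A competitor is shown to agree with \<delta> almost everywhere, which replaces an
  argument from continuity of the risk. Its Bayes risk under \<open>w i\<close> does not exceed that
  of \<delta>, so neither does its weighted squared distance from the Bayes estimator. The triangle
  inequality then bounds the distance between the two estimators by a multiple of the excess risk of
  \<delta>, which tends to 0.\<close>

theorem blyth_admissible:
  fixes w :: "nat \<Rightarrow> real^'n \<Rightarrow> real" and Q :: "real^'n^'n"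
  assumes Q: "positive_definite Q"
    and meas[measurable]: "(\<lambda>y. f (norm (y :: real^'n))) \<in> borel_measurable borel" "\<And>i. w i \<in> borel_measurable borel"
      "\<delta> \<in> borel_measurable borel"
    and nn: "\<And>y :: real^'n. 0 \<le> f (norm y)" "\<And>i \<theta>. 0 \<le> w i \<theta>"
    and fin: "\<And>i. (\<integral>\<^sup>+\<theta>. ennreal (w i \<theta>) * risk f Q \<theta> \<delta> \<partial>lborel) < \<infinity>"
    and mom: "\<And>i. AE x in lborel. integrable lborel (\<lambda>\<theta>. f (norm (x - \<theta>)) * w i \<theta>) \<and>
      integrable lborel (\<lambda>\<theta>. f (norm (x - \<theta>)) * w i \<theta> * (norm \<theta>)\<^sup>2)"
    and pos: "\<And>i. AE x in lborel. 0 < marginal f (w 0) x \<and> marginal f (w 0) x \<le> marginal f (w i) x"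
    and lim: "(\<lambda>i. \<integral>\<^sup>+x. ennreal (marginal f (w i) x * quadratic_loss Q (gen_bayes f (w i) x) (\<delta> x)) \<partial>lborel) \<longlonglongrightarrow> 0"
  shows "admissible_estimator f Q \<delta>"
  unfolding admissible_estimator_def
proof (intro conjI notI)
  show "estimator \<delta>" using meas by (simp add: estimator_def)
  assume "\<exists>\<delta>'. estimator \<delta>' \<and> (\<forall>\<theta>. risk f Q \<theta> \<delta>' \<le> risk f Q \<theta> \<delta>) \<and> (\<exists>\<theta>. risk f Q \<theta> \<delta>' < risk f Q \<theta> \<delta>)"
  then obtain \<delta>' \<theta>' where [measurable]: "\<delta>' \<in> borel_measurable borel"
    and le: "\<And>\<theta>. risk f Q \<theta> \<delta>' \<le> risk f Q \<theta> \<delta>" and less: "risk f Q \<theta>' \<delta>' < risk f Q \<theta>' \<delta>"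
    by (auto simp: estimator_def)
  note [measurable] = marginal_measurable[OF meas(1) meas(2)] gen_bayes_measurable[OF meas(1) meas(2)]
  define m where "m i = gen_bayes f (w i)" for i
  define M where "M i = marginal f (w i)" for i
  have [measurable]: "m i \<in> borel_measurable borel" "M i \<in> borel_measurable borel" for i
    unfolding m_def M_def by measurable
  define \<Delta> where "\<Delta> i = (\<integral>\<^sup>+x. ennreal (M i x * quadratic_loss Q (m i x) (\<delta> x)) \<partial>lborel)" for i
  have le\<Delta>: "(\<integral>\<^sup>+x. ennreal (M i x * quadratic_loss Q (m i x) (\<delta>' x)) \<partial>lborel) \<le> \<Delta> i" for i
  proof -
    \<comment> \<open>The posterior risk of the Bayes estimator itself, the share of the Bayes risk
      that all estimators have in common. By \<open>fin\<close> its integral is finite, so it can be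
      cancelled in the extended reals.\<close>
    define V where "V x = ennreal (\<integral>\<theta>. f (norm (x - \<theta>)) * w i \<theta> * quadratic_loss Q \<theta> (m i x) \<partial>lborel)" for x
    have [measurable]: "(\<lambda>(x, \<theta>). f (norm (x - \<theta> :: real^'n))) \<in> borel_measurable (borel \<Otimes>\<^sub>M lborel)"
      using measurable_compose[of "\<lambda>(x, \<theta>). x - \<theta> :: real^'n" "borel \<Otimes>\<^sub>M lborel" borel, OF _ meas(1)]
      by (simp add: case_prod_beta')
    have [measurable]: "V \<in> borel_measurable borel"
      unfolding V_def by measurable
    have dec: "(\<integral>\<^sup>+\<theta>. ennreal (w i \<theta>) * risk f Q \<theta> d \<partial>lborel) =
        (\<integral>\<^sup>+x. V x \<partial>lborel) + (\<integral>\<^sup>+x. ennreal (M i x * quadratic_loss Q (m i x) (d x)) \<partial>lborel)"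
      if [measurable]: "d \<in> borel_measurable borel" for d
    proof -
      have "(\<integral>\<^sup>+\<theta>. ennreal (w i \<theta>) * risk f Q \<theta> d \<partial>lborel) =
          (\<integral>\<^sup>+x. V x + ennreal (M i x * quadratic_loss Q (m i x) (d x)) \<partial>lborel)"
        unfolding nn_integral_risk[OF Q meas(1) meas(2) that nn]
      proof (rule nn_integral_cong_AE, use mom[of i] pos[of i] in eventually_elim)
        case (elim x)
        then have "0 < marginal f (w i) x" by linarith
        with elim show ?case
          unfolding V_def M_def m_def
          by (intro gen_bayes_quadratic_loss[OF Q meas(1) meas(2) nn]) simp_all
      qed
      then show ?thesis by (simp add: nn_integral_add)
    qed
    have "(\<integral>\<^sup>+\<theta>. ennreal (w i \<theta>) * risk f Q \<theta> \<delta>' \<partial>lborel) \<le> (\<integral>\<^sup>+\<theta>. ennreal (w i \<theta>) * risk f Q \<theta> \<delta> \<partial>lborel)"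
      using le by (intro nn_integral_mono mult_left_mono) auto
    moreover have "(\<integral>\<^sup>+x. V x \<partial>lborel) \<noteq> \<infinity>"
      using fin[of i] unfolding dec[OF meas(3)] by auto
    ultimately show ?thesis
      by (simp add: dec \<Delta>_def ennreal_add_left_cancel_le)
  qed
  \<comment> \<open>The weight on the left is \<open>M 0\<close> for every \<open>i\<close>, so the
    left side stays fixed while the right side tends to 0.\<close>
  have bound: "(\<integral>\<^sup>+x. ennreal (M 0 x * quadratic_loss Q (\<delta>' x) (\<delta> x)) \<partial>lborel) \<le> 4 * \<Delta> i" for i
  proof -
    have "(\<integral>\<^sup>+x. ennreal (M 0 x * quadratic_loss Q (\<delta>' x) (\<delta> x)) \<partial>lborel) \<le>
      (\<integral>\<^sup>+x. 2 * ennreal (M i x * quadratic_loss Q (m i x) (\<delta>' x)) + 2 * ennreal (M i x * quadratic_loss Q (m i x) (\<delta> x)) \<partial>lborel)"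
    proof (intro nn_integral_mono_AE, use pos[of i] in eventually_elim)
      fix x assume x: "0 < marginal f (w 0) x \<and> marginal f (w 0) x \<le> marginal f (w i) x"
      then have "M 0 x * quadratic_loss Q (\<delta>' x) (\<delta> x) \<le> M i x * (2 * quadratic_loss Q (m i x) (\<delta>' x) + 2 * quadratic_loss Q (m i x) (\<delta> x))"
        using quadratic_loss_nonneg[OF Q] quadratic_loss_triangle[OF Q]
        by (intro mult_mono) (auto simp: M_def intro: less_imp_le)
      then have "ennreal (M 0 x * quadratic_loss Q (\<delta>' x) (\<delta> x)) \<le>
          ennreal (2 * (M i x * quadratic_loss Q (m i x) (\<delta>' x)) + 2 * (M i x * quadratic_loss Q (m i x) (\<delta> x)))"
        by (intro ennreal_leI) (simp add: algebra_simps)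
      also have "\<dots> = 2 * ennreal (M i x * quadratic_loss Q (m i x) (\<delta>' x)) + 2 * ennreal (M i x * quadratic_loss Q (m i x) (\<delta> x))"
        using x quadratic_loss_nonneg[OF Q] by (simp add: M_def ennreal_mult)
      finally show "ennreal (M 0 x * quadratic_loss Q (\<delta>' x) (\<delta> x)) \<le>
        2 * ennreal (M i x * quadratic_loss Q (m i x) (\<delta>' x)) + 2 * ennreal (M i x * quadratic_loss Q (m i x) (\<delta> x))" .
    qed
    also have "\<dots> = 2 * (\<integral>\<^sup>+x. ennreal (M i x * quadratic_loss Q (m i x) (\<delta>' x)) \<partial>lborel) + 2 * \<Delta> i"
      by (simp add: nn_integral_add nn_integral_cmult \<Delta>_def)
    also have "\<dots> \<le> 2 * \<Delta> i + 2 * \<Delta> i" using le\<Delta>[of i] by (intro add_right_mono mult_left_mono) auto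
    also have "\<dots> = 4 * \<Delta> i" unfolding distrib_right[symmetric] by simp
    finally show ?thesis .
  qed
  have "(\<lambda>i. 4 * \<Delta> i) \<longlonglongrightarrow> 4 * 0"
    using lim by (intro ennreal_tendsto_cmult) (auto simp: \<Delta>_def M_def m_def)
  from LIMSEQ_le_const[OF this] bound
  have "(\<integral>\<^sup>+x. ennreal (M 0 x * quadratic_loss Q (\<delta>' x) (\<delta> x)) \<partial>lborel) \<le> 4 * 0"
    by blast
  then have "(\<integral>\<^sup>+x. ennreal (M 0 x * quadratic_loss Q (\<delta>' x) (\<delta> x)) \<partial>lborel) = 0"
    by simp
  then have "AE x in lborel. ennreal (M 0 x * quadratic_loss Q (\<delta>' x) (\<delta> x)) = 0"
    using nn_integral_0_iff_AE[of "\<lambda>x. ennreal (M 0 x * quadratic_loss Q (\<delta>' x) (\<delta> x))" lborel] by simp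
  then have eq: "AE x in lborel. \<delta>' x = \<delta> x"
    using pos[of 0]
  proof eventually_elim
    case (elim x)
    then have "quadratic_loss Q (\<delta>' x) (\<delta> x) \<le> 0"
      by (auto simp: M_def ennreal_eq_0_iff mult_le_0_iff)
    then have "quadratic_loss Q (\<delta>' x) (\<delta> x) = 0"
      using quadratic_loss_nonneg[OF Q, of "\<delta>' x" "\<delta> x"] by simp
    then show ?case using quadratic_loss_eq_0[OF Q] by metis
  qed
  have [measurable]: "(\<lambda>x. f (norm (x - \<theta>'))) \<in> borel_measurable borel"
    using measurable_compose[of "\<lambda>x. x - \<theta>'" borel borel, OF _ meas(1)] by simp
  \<comment> \<open>The sampling distribution is absolutely continuous, so changes on a Lebesgue
    null set do not affect the risk at any parameter.\<close>
  have "AE x in location_distr f \<theta>'. \<delta>' x = \<delta> x"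
    unfolding location_distr_def by (subst AE_density) (use eq in auto)
  then have "risk f Q \<theta>' \<delta>' = risk f Q \<theta>' \<delta>"
    unfolding risk_def by (intro nn_integral_cong_AE) auto
  with less show False by simp
qed

section \<open>Estimates uniform over the sequence of priors\<close>

lemma distr_lborel_reflect:
  fixes x :: "'a::euclidean_space"
  shows "distr lborel borel (\<lambda>\<theta>. x - \<theta>) = lborel"
  using lborel_affine[of "-1" x] by (simp add: density_1)

lemma nn_integral_reflect:
  fixes x :: "'a::euclidean_space"
  assumes [measurable]: "\<phi> \<in> borel_measurable borel"
  shows "(\<integral>\<^sup>+\<theta>. \<phi> (x - \<theta>) \<partial>lborel) = (\<integral>\<^sup>+y. \<phi> y \<partial>lborel)"
proof -
  have "(\<integral>\<^sup>+y. \<phi> y \<partial>lborel) = (\<integral>\<^sup>+y. \<phi> y \<partial>distr lborel borel (\<lambda>\<theta>. x - \<theta>))"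
    by (simp add: distr_lborel_reflect)
  also have "\<dots> = (\<integral>\<^sup>+\<theta>. \<phi> (x - \<theta>) \<partial>lborel)"
    by (subst nn_integral_distr) auto
  finally show ?thesis ..
qed

lemma nn_integral_translate:
  fixes \<theta> :: "'a::euclidean_space"
  assumes [measurable]: "\<phi> \<in> borel_measurable borel"
  shows "(\<integral>\<^sup>+x. \<phi> (x - \<theta>) \<partial>lborel) = (\<integral>\<^sup>+y. \<phi> y \<partial>lborel)"
proof -
  have "(\<integral>\<^sup>+y. \<phi> y \<partial>lborel) = (\<integral>\<^sup>+y. \<phi> y \<partial>distr lborel borel ((+) (- \<theta>)))"
    by (simp add: lborel_distr_plus)
  also have "\<dots> = (\<integral>\<^sup>+x. \<phi> (x - \<theta>) \<partial>lborel)"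
    by (subst nn_integral_distr) auto
  finally show ?thesis ..
qed

lemma integral_reflect:
  fixes x :: "'a::euclidean_space" and \<phi> :: "'a \<Rightarrow> real"
  assumes "integrable lborel \<phi>"
  shows "integrable lborel (\<lambda>\<theta>. \<phi> (x - \<theta>))" "(\<integral>\<theta>. \<phi> (x - \<theta>) \<partial>lborel) = (\<integral>y. \<phi> y \<partial>lborel)"
proof -
  have [measurable]: "\<phi> \<in> borel_measurable borel" using assms by auto
  show "integrable lborel (\<lambda>\<theta>. \<phi> (x - \<theta>))"
    using assms integrable_distr_eq[of "\<lambda>\<theta>. x - \<theta>" lborel borel \<phi>] by (simp add: distr_lborel_reflect)
  show "(\<integral>\<theta>. \<phi> (x - \<theta>) \<partial>lborel) = (\<integral>y. \<phi> y \<partial>lborel)"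
    using integral_distr[of "\<lambda>\<theta>. x - \<theta>" lborel borel \<phi>] by (simp add: distr_lborel_reflect)
qed

text \<open>Expanding the nonnegative integral of
  \<open>u \<theta> * (norm (v \<theta> - c))\<^sup>2\<close> at the weighted mean \<open>c\<close>
  gives the difference of the two sides.\<close>

lemma weighted_mean_Jensen:
  fixes v :: "'a \<Rightarrow> 'b::euclidean_space"
  assumes nn: "\<And>\<theta>. 0 \<le> u \<theta>"
    and u: "integrable M u" and u1: "integrable M (\<lambda>\<theta>. u \<theta> *\<^sub>R v \<theta>)" and u2: "integrable M (\<lambda>\<theta>. u \<theta> * (norm (v \<theta>))\<^sup>2)"
    and W: "0 < (\<integral>\<theta>. u \<theta> \<partial>M)"
  shows "(\<integral>\<theta>. u \<theta> \<partial>M) * (norm ((\<integral>\<theta>. u \<theta> *\<^sub>R v \<theta> \<partial>M) /\<^sub>R (\<integral>\<theta>. u \<theta> \<partial>M)))\<^sup>2 \<le> (\<integral>\<theta>. u \<theta> * (norm (v \<theta>))\<^sup>2 \<partial>M)"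
proof -
  define W where "W = (\<integral>\<theta>. u \<theta> \<partial>M)"
  define c where "c = (\<integral>\<theta>. u \<theta> *\<^sub>R v \<theta> \<partial>M) /\<^sub>R W"
  have Wc: "(\<integral>\<theta>. u \<theta> *\<^sub>R v \<theta> \<partial>M) = W *\<^sub>R c" using W by (simp add: c_def W_def)
  have eq: "u \<theta> * (norm (v \<theta> - c))\<^sup>2 = u \<theta> * (norm (v \<theta>))\<^sup>2 - 2 * ((u \<theta> *\<^sub>R v \<theta>) \<bullet> c) + u \<theta> * (norm c)\<^sup>2" for \<theta>
    unfolding power2_norm_eq_inner by (simp add: inner_simps inner_commute algebra_simps)
  have i: "integrable M (\<lambda>\<theta>. (u \<theta> *\<^sub>R v \<theta>) \<bullet> c)" by (rule integrable_inner_left) (use u1 in auto)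
  have "0 \<le> (\<integral>\<theta>. u \<theta> * (norm (v \<theta> - c))\<^sup>2 \<partial>M)" using nn by (intro Bochner_Integration.integral_nonneg) auto
  also have "\<dots> = (\<integral>\<theta>. u \<theta> * (norm (v \<theta>))\<^sup>2 \<partial>M) - 2 * (\<integral>\<theta>. (u \<theta> *\<^sub>R v \<theta>) \<bullet> c \<partial>M) + W * (norm c)\<^sup>2"
    unfolding eq[abs_def] using u u2 i by (simp add: W_def)
  also have "(\<integral>\<theta>. (u \<theta> *\<^sub>R v \<theta>) \<bullet> c \<partial>M) = W * (norm c)\<^sup>2"
    using integral_inner_left[of c M "\<lambda>\<theta>. u \<theta> *\<^sub>R v \<theta>"] u1 Wc by (simp add: power2_norm_eq_inner)
  finally show ?thesis by (simp add: c_def W_def)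
qed

text \<open>The parameters \<open>p\<close>, \<open>a\<close>, \<open>m1\<close> and \<open>m2\<close> abbreviate the terms in the first assumptions: as definitions
  inside the locale, \<open>p\<close>, \<open>m1\<close> and \<open>m2\<close> would carry an extra argument for the type \<open>'n\<close>.\<close>

locale prior_sequence =
  fixes N :: "real^'n \<Rightarrow> real" and f G D :: "real \<Rightarrow> real" and h :: "nat \<Rightarrow> real \<Rightarrow> real"
    and p \<kappa> r0 L s R C c t1 e b a m1 m2 :: real
  assumes p_def: "p = real CARD('n)" and a_def: "a = p + s - 1 - b"
    and m1_def: "m1 = (\<integral>y. f (norm (y::real^'n)) * norm y \<partial>lborel)"
    and m2_def: "m2 = (\<integral>y. f (norm (y::real^'n)) * (norm y)\<^sup>2 \<partial>lborel)"
    and N_meas[measurable]: "N \<in> borel_measurable borel"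
    and N_ge: "norm x \<le> N x" and N_le: "N x \<le> \<kappa> * norm x"
    and N_diff: "\<bar>N x - N y\<bar> \<le> N (x - y)"
    and f_meas[measurable]: "(\<lambda>y. f (norm (y :: real^'n))) \<in> borel_measurable borel"
    and f_nonneg: "0 \<le> r \<Longrightarrow> 0 \<le> f r"
    and f_int: "(\<integral>\<^sup>+y. ennreal (f (norm (y :: real^'n))) \<partial>lborel) = 1"
    and f_tail: "r0 \<le> r \<Longrightarrow> f r \<le> L * r powr (- (p + s))"
    and r0: "1 \<le> r0" and L: "0 < L"
    and f_moment: "(\<integral>\<^sup>+y. ennreal (f (norm (y :: real^'n)) * (norm y)\<^sup>2) \<partial>lborel) < \<infinity>"
    and G_meas[measurable]: "G \<in> borel_measurable borel" and G_pos: "0 \<le> \<eta> \<Longrightarrow> 0 < G \<eta>"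
    and R: "1 \<le> R" and C: "1 \<le> C" and c: "0 < c"
    and G_doubling: "R \<le> u \<Longrightarrow> \<eta> / 2 \<le> u \<Longrightarrow> u \<le> 2 * \<eta> \<Longrightarrow> R \<le> \<eta> \<Longrightarrow> G u \<le> C * G \<eta>"
    and G_lower: "R \<le> \<eta> \<Longrightarrow> c * \<eta> powr t1 \<le> G \<eta>"
    and h_meas[measurable]: "\<And>i. h i \<in> borel_measurable borel" and D_meas[measurable]: "D \<in> borel_measurable borel"
    and h_pos: "\<And>i. 0 \<le> \<eta> \<Longrightarrow> 0 < h i \<eta>" and h_0_le: "\<And>i. 0 \<le> \<eta> \<Longrightarrow> h 0 \<eta> \<le> h i \<eta>" and h_le_1: "\<And>i. 0 \<le> \<eta> \<Longrightarrow> h i \<eta> \<le> 1"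
    and h_lim: "0 \<le> \<eta> \<Longrightarrow> (\<lambda>i. h i \<eta>) \<longlonglongrightarrow> 1"
    and h_doubling: "\<And>i. 0 \<le> \<eta> \<Longrightarrow> \<eta> / 2 \<le> u \<Longrightarrow> u \<le> 2 * \<eta> \<Longrightarrow> h i u \<le> C * h i \<eta>"
      "\<And>i. 0 \<le> \<eta> \<Longrightarrow> \<eta> / 2 \<le> u \<Longrightarrow> u \<le> 2 * \<eta> \<Longrightarrow> h i \<eta> \<le> C * h i u"
    and h_Lipschitz: "\<And>i. 0 \<le> \<eta> \<Longrightarrow> \<eta> / 2 \<le> u \<Longrightarrow> u \<le> 2 * \<eta> \<Longrightarrow> \<bar>h i u - h i \<eta>\<bar> \<le> C * \<bar>u - \<eta>\<bar> * D \<eta>"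
    and D_pos: "0 \<le> \<eta> \<Longrightarrow> 0 < D \<eta>"
    and h_lower: "0 \<le> \<eta> \<Longrightarrow> c * (1 + \<eta>) powr (- e) \<le> h 0 \<eta>" and e: "0 \<le> e"
    and b: "0 \<le> b" "b \<le> p + s - 2" "0 \<le> a + t1"
      "p < 2 * a + t1 - 2 * e"
    and G_int: "(\<integral>\<^sup>+\<theta>. ennreal (G (N \<theta>) * (1 + N \<theta>) powr (- b)) \<partial>lborel) < \<infinity>"
    and GD_int: "(\<integral>\<^sup>+\<theta>. ennreal (G (N \<theta>) * (D (N \<theta>))\<^sup>2) * indicator {\<theta>. 1 \<le> N \<theta>} \<theta> \<partial>lborel) < \<infinity>"
    and Gh_int: "\<And>i. (\<integral>\<^sup>+\<theta>. ennreal (G (N \<theta>) * (h i (N \<theta>))\<^sup>2) \<partial>lborel) < \<infinity>"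
    and power_int: "\<And>q. p < q \<Longrightarrow> (\<integral>\<^sup>+\<theta>. ennreal (N \<theta> powr (- q)) * indicator {\<theta>. 1 \<le> N \<theta>} \<theta> \<partial>lborel) < \<infinity>"
begin

section \<open>Kernel, priors and observations with finite posterior second moment\<close>

abbreviation k :: "real^'n \<Rightarrow> real^'n \<Rightarrow> real" where "k x \<theta> \<equiv> f (norm (x - \<theta>))"
definition g :: "real^'n \<Rightarrow> real" where "g \<theta> = G (N \<theta>)"
definition w :: "nat \<Rightarrow> real^'n \<Rightarrow> real" where "w i \<theta> = g \<theta> * (h i (N \<theta>))\<^sup>2"

lemma N_nonneg [simp]: "0 \<le> N x"
  using N_ge[of x] norm_ge_zero[of x] by linarith

lemma \<kappa>: "1 \<le> \<kappa>"
proof -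
  obtain y :: "real^'n" where "norm y = 1" using vector_choose_size[of 1] by auto
  then show ?thesis using N_ge[of y] N_le[of y] by simp
qed

lemma g_meas [measurable]: "g \<in> borel_measurable borel" unfolding g_def by measurable
lemma w_meas [measurable]: "w i \<in> borel_measurable borel" unfolding w_def by measurable
lemma g_pos: "0 < g \<theta>" by (simp add: g_def G_pos)
lemma w_pos: "0 < w i \<theta>" using h_pos[of "N \<theta>" i] by (simp add: w_def g_pos)
lemma k_nonneg [simp]: "0 \<le> k x \<theta>" by (simp add: f_nonneg)

lemma w_le_g: "w i \<theta> \<le> g \<theta>"
proof -
  have "(h i (N \<theta>))\<^sup>2 \<le> 1" using h_pos[of "N \<theta>" i] h_le_1[of "N \<theta>" i] by (simp add: power_le_one)
  then show ?thesis using g_pos[of \<theta>] by (simp add: w_def)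
qed

lemma w_0_le: "w 0 \<theta> \<le> w i \<theta>"
  unfolding w_def using h_0_le[of "N \<theta>" i] h_pos[of "N \<theta>" 0] g_pos[of \<theta>]
  by (intro mult_left_mono power_mono) auto

lemma k_meas [measurable]: "(\<lambda>x. k x \<theta>) \<in> borel_measurable borel"
  by (rule measurable_compose[OF _ f_meas]) measurable

text \<open>At such observations the Bochner integrals in \<open>marginal\<close> and
  \<open>gen_bayes\<close> converge and are not the default value 0. The summand 1 covers the
  marginal, the square the second moment.\<close>

definition good :: "real^'n \<Rightarrow> bool" where
  "good x \<longleftrightarrow> (\<integral>\<^sup>+\<theta>. ennreal (k x \<theta> * g \<theta> * (1 + (norm (\<theta> - x))\<^sup>2)) \<partial>lborel) < \<infinity>"

text \<open>Since \<open>f\<close> may be unbounded below \<open>r0\<close>, the kernel has to stay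
  on the right, to be integrated over \<open>x\<close> afterwards. The summand 1 covers the tail,
  where \<open>b \<le> p + s - 2\<close> leaves at least \<open>b\<close> powers of decay once the
  square is taken out.\<close>

lemma kernel_local_bound:
  assumes "0 \<le> \<rho>"
  obtains K where "0 \<le> K" "\<And>x \<theta>. N x \<le> \<rho> \<Longrightarrow> k x \<theta> * (1 + (norm (\<theta> - x))\<^sup>2) \<le> K * (1 + N \<theta>) powr (- b) * (k x \<theta> + 1)"
proof -
  \<comment> \<open>\<open>V\<close> bounds \<open>1 + N \<theta>\<close> for all \<theta> within
    distance \<open>r0\<close> of an \<open>x\<close> with \<open>N x \<le> \<rho>\<close>.\<close>
  define V where "V = 1 + \<rho> + \<kappa> * r0"
  define K where "K = (1 + r0\<^sup>2) * V powr b + 2 * L * (1 + \<rho> + \<kappa>) powr b"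
  have V: "1 \<le> V" using assms \<kappa> r0 by (simp add: V_def)
  have K: "0 \<le> K" using L by (simp add: K_def)
  have "k x \<theta> * (1 + (norm (\<theta> - x))\<^sup>2) \<le> K * (1 + N \<theta>) powr (- b) * (k x \<theta> + 1)" if x: "N x \<le> \<rho>" for x \<theta>
  proof -
    define t where "t = norm (\<theta> - x)"
    have kt: "k x \<theta> = f t" by (simp add: t_def norm_minus_commute)
    have ft: "0 \<le> f t" by (simp add: f_nonneg t_def)
    have N\<theta>: "N \<theta> \<le> \<rho> + \<kappa> * t" using N_diff[of \<theta> x] N_le[of "\<theta> - x"] x by (simp add: t_def)
    have P0: "0 \<le> (1 + N \<theta>) powr (- b)" by simp
    show ?thesis
    proof (cases "t \<le> r0")
      case True
      have "1 + N \<theta> \<le> V" using N\<theta> \<kappa> mult_left_mono[OF True, of \<kappa>] unfolding V_def by linarith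
      then have "V powr (- b) \<le> (1 + N \<theta>) powr (- b)" using b by (intro powr_mono2') (auto simp: add_pos_nonneg)
      then have "V powr b * V powr (- b) \<le> V powr b * (1 + N \<theta>) powr (- b)" by (intro mult_left_mono) auto
      then have 1: "1 \<le> V powr b * (1 + N \<theta>) powr (- b)" using V by (simp flip: powr_add)
      have "t\<^sup>2 \<le> r0\<^sup>2" using True by (intro power_mono) (auto simp: t_def)
      then have "f t * (1 + t\<^sup>2) \<le> f t * ((1 + r0\<^sup>2) * (V powr b * (1 + N \<theta>) powr (- b)))"
        using ft 1 mult_mono[of "1 + t\<^sup>2" "1 + r0\<^sup>2" 1 "V powr b * (1 + N \<theta>) powr (- b)"] by (intro mult_left_mono) auto
      also have "\<dots> = ((1 + r0\<^sup>2) * V powr b) * (1 + N \<theta>) powr (- b) * f t" by simp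
      also have "\<dots> \<le> K * (1 + N \<theta>) powr (- b) * (f t + 1)"
        using ft L by (intro mult_mono) (auto simp: K_def)
      finally show ?thesis by (simp add: kt t_def)
    next
      case False
      then have t: "1 \<le> t" "r0 \<le> t" using r0 by auto
      have "t\<^sup>2 \<ge> 1" using t by (simp add: one_le_power)
      have "f t * (1 + t\<^sup>2) \<le> (L * t powr (- (p + s))) * (2 * t\<^sup>2)"
        using f_tail[OF t(2)] ft \<open>t\<^sup>2 \<ge> 1\<close> L by (intro mult_mono) auto
      also have "\<dots> = 2 * L * (t powr (- (p + s)) * t powr 2)" using t by simp
      also have "\<dots> = 2 * L * t powr (2 - p - s)" by (simp flip: powr_add add: algebra_simps)
      also have "\<dots> \<le> 2 * L * t powr (- b)" using b t L by (intro mult_left_mono powr_mono) auto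
      also have "\<dots> \<le> 2 * L * ((1 + \<rho> + \<kappa>) powr b * (1 + N \<theta>) powr (- b))"
      proof -
        have "1 + N \<theta> \<le> 1 + \<rho> + \<kappa> * t" using N\<theta> by simp
        also have "\<dots> \<le> (1 + \<rho> + \<kappa>) * t" using t assms mult_left_mono[of 1 t "1 + \<rho>"] by (simp add: algebra_simps)
        finally have "(1 + N \<theta>) / (1 + \<rho> + \<kappa>) \<le> t" using assms \<kappa> by (simp add: field_simps)
        then have "t powr (- b) \<le> ((1 + N \<theta>) / (1 + \<rho> + \<kappa>)) powr (- b)"
          using b assms \<kappa> by (intro powr_mono2') (auto intro!: divide_pos_pos add_pos_nonneg)
        also have "\<dots> = (1 + \<rho> + \<kappa>) powr b * (1 + N \<theta>) powr (- b)"
          using assms \<kappa> by (simp add: powr_divide powr_minus field_simps)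
        finally show ?thesis using L by (intro mult_left_mono) auto
      qed
      also have "\<dots> = (2 * L * (1 + \<rho> + \<kappa>) powr b) * (1 + N \<theta>) powr (- b) * 1" by simp
      also have "\<dots> \<le> K * (1 + N \<theta>) powr (- b) * (f t + 1)"
        using ft L by (intro mult_mono) (auto simp: K_def)
      finally show ?thesis by (simp add: kt t_def)
    qed
  qed
  with K show ?thesis by (rule that)
qed

lemma nn_integral_k_\<theta>: "(\<integral>\<^sup>+\<theta>. ennreal (k x \<theta>) \<partial>lborel) = 1"
  using nn_integral_reflect[of "\<lambda>y. ennreal (f (norm y))" x] f_int by simp

lemma nn_integral_k_x: "(\<integral>\<^sup>+x. ennreal (k x \<theta>) \<partial>lborel) = 1"
  using nn_integral_translate[of "\<lambda>y. ennreal (f (norm y))" \<theta>] f_int by simp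

text \<open>Integrated over \<open>x\<close> first, the kernel has mass 1 and the sublevel set has
  finite volume, so the whole is at most a multiple of the integral in \<open>G_int\<close>.\<close>

lemma local_second_moment:
  "(\<integral>\<^sup>+x. (\<integral>\<^sup>+\<theta>. ennreal (k x \<theta> * g \<theta> * (1 + (norm (\<theta> - x))\<^sup>2)) \<partial>lborel) * indicator {x. N x \<le> \<rho>} x \<partial>lborel) < \<infinity>"
proof (cases "0 \<le> \<rho>")
  case False
  then have "{x. N x \<le> \<rho>} = {}" using N_nonneg by (smt (verit) Collect_empty_eq)
  then show ?thesis by simp
next
  case True
  obtain K where K: "0 \<le> K" "\<And>x \<theta>. N x \<le> \<rho> \<Longrightarrow> k x \<theta> * (1 + (norm (\<theta> - x))\<^sup>2) \<le> K * (1 + N \<theta>) powr (- b) * (k x \<theta> + 1)"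
    using kernel_local_bound[OF True] by blast
  let ?v = "\<lambda>\<theta>. g \<theta> * (1 + N \<theta>) powr (- b)"
  let ?I = "indicator {x. N x \<le> \<rho>} :: real^'n \<Rightarrow> ennreal"
  have [measurable]: "{x. N x \<le> \<rho>} \<in> sets borel" by measurable
  have "emeasure lborel {x. N x \<le> \<rho>} \<le> emeasure lborel (cball (0::real^'n) \<rho>)"
    using order_trans[OF N_ge] by (intro emeasure_mono) auto
  also have "\<dots> < \<infinity>" by (intro emeasure_bounded_finite bounded_cball)
  finally have vol: "emeasure lborel {x. N x \<le> \<rho>} < \<infinity>" .
  have "(\<integral>\<^sup>+x. (\<integral>\<^sup>+\<theta>. ennreal (k x \<theta> * g \<theta> * (1 + (norm (\<theta> - x))\<^sup>2)) \<partial>lborel) * ?I x \<partial>lborel) \<le>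
    (\<integral>\<^sup>+x. (\<integral>\<^sup>+\<theta>. ennreal K * (ennreal (?v \<theta>) * (ennreal (k x \<theta>) + ?I x)) \<partial>lborel) \<partial>lborel)"
  proof (intro nn_integral_mono)
    fix x
    show "(\<integral>\<^sup>+\<theta>. ennreal (k x \<theta> * g \<theta> * (1 + (norm (\<theta> - x))\<^sup>2)) \<partial>lborel) * ?I x \<le>
      (\<integral>\<^sup>+\<theta>. ennreal K * (ennreal (?v \<theta>) * (ennreal (k x \<theta>) + ?I x)) \<partial>lborel)"
    proof (cases "N x \<le> \<rho>")
      case True
      have "ennreal (k x \<theta> * g \<theta> * (1 + (norm (\<theta> - x))\<^sup>2)) \<le> ennreal K * (ennreal (?v \<theta>) * (ennreal (k x \<theta>) + 1))" for \<theta>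
      proof -
        have "g \<theta> * (k x \<theta> * (1 + (norm (\<theta> - x))\<^sup>2)) \<le> g \<theta> * (K * (1 + N \<theta>) powr (- b) * (k x \<theta> + 1))"
          using K(2)[OF True, of \<theta>] g_pos[of \<theta>] by (intro mult_left_mono) auto
        then have "ennreal (k x \<theta> * g \<theta> * (1 + (norm (\<theta> - x))\<^sup>2)) \<le> ennreal (K * (?v \<theta> * (k x \<theta> + 1)))"
          by (intro ennreal_leI) (simp add: mult_ac)
        also have "\<dots> = ennreal K * (ennreal (?v \<theta>) * (ennreal (k x \<theta>) + 1))"
          using K(1) g_pos[of \<theta>] by (simp add: ennreal_mult ennreal_plus)
        finally show ?thesis .
      qed
      then show ?thesis using True by (simp add: nn_integral_mono)
    qed simp
  qed
  also have "\<dots> = (\<integral>\<^sup>+\<theta>. (\<integral>\<^sup>+x. ennreal K * (ennreal (?v \<theta>) * (ennreal (k x \<theta>) + ?I x)) \<partial>lborel) \<partial>lborel)"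
    by (rule lborel_pair.Fubini'[symmetric]) (simp add: case_prod_beta')
  also have "\<dots> = (\<integral>\<^sup>+\<theta>. ennreal K * (1 + emeasure lborel {x. N x \<le> \<rho>}) * ennreal (?v \<theta>) \<partial>lborel)"
    by (intro nn_integral_cong) (simp add: nn_integral_cmult nn_integral_add nn_integral_k_x mult_ac)
  also have "\<dots> = ennreal K * (1 + emeasure lborel {x. N x \<le> \<rho>}) * (\<integral>\<^sup>+\<theta>. ennreal (?v \<theta>) \<partial>lborel)"
    by (rule nn_integral_cmult) measurable
  also have "\<dots> < \<infinity>"
    using vol G_int by (simp add: ennreal_mult_less_top g_def)
  finally show ?thesis .
qed

text \<open>A finite integral over a sublevel set makes almost all of its points good, and countably
  many sublevel sets cover the space.\<close>

lemma AE_good: "AE x in lborel. good x"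
proof -
  have "AE x in lborel. N x \<le> real n \<longrightarrow> good x" for n
  proof -
    have "AE x in lborel. (\<integral>\<^sup>+\<theta>. ennreal (k x \<theta> * g \<theta> * (1 + (norm (\<theta> - x))\<^sup>2)) \<partial>lborel) * indicator {x. N x \<le> real n} x \<noteq> \<infinity>"
      by (rule nn_integral_PInf_AE) (use local_second_moment[of "real n"] in \<open>auto simp: case_prod_beta'\<close>)
    then show ?thesis
      by eventually_elim (auto simp: good_def less_top split: split_indicator_asm)
  qed
  then have "AE x in lborel. \<forall>n. N x \<le> real n \<longrightarrow> good x" unfolding AE_all_countable by blast
  then show ?thesis
    by eventually_elim (use real_arch_simple in blast)
qed


section \<open>Posterior integrals for priors dominated by \<open>g\<close>\<close>

definition weight :: "(real^'n \<Rightarrow> real) \<Rightarrow> bool" where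
  "weight W \<longleftrightarrow> W \<in> borel_measurable borel \<and> (\<forall>\<theta>. 0 < W \<theta> \<and> W \<theta> \<le> g \<theta>)"

lemma weight_g: "weight g" by (simp add: weight_def g_pos)
lemma weight_w: "weight (w i)" by (simp add: weight_def w_pos w_le_g)

text \<open>A single majorant, the integrand in \<open>good\<close>, dominates every integrand up to
  a factor depending on \<open>x\<close>. The formulation with \<open>weight\<close> serves
  \<open>g\<close> and all \<open>w i\<close> at once.\<close>

lemma good_integrable:
  assumes x: "good x" and W: "weight W"
  shows "integrable lborel (\<lambda>\<theta>. k x \<theta> * W \<theta>)"
    and "integrable lborel (\<lambda>\<theta>. k x \<theta> * W \<theta> * norm (\<theta> - x))"
    and "integrable lborel (\<lambda>\<theta>. k x \<theta> * W \<theta> * (norm (\<theta> - x))\<^sup>2)"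
    and "integrable lborel (\<lambda>\<theta>. k x \<theta> * W \<theta> * (norm \<theta>)\<^sup>2)"
    and "integrable lborel (\<lambda>\<theta>. (k x \<theta> * W \<theta>) *\<^sub>R (\<theta> - x))"
    and "integrable lborel (\<lambda>\<theta>. (k x \<theta> * W \<theta>) *\<^sub>R \<theta>)"
proof -
  have [measurable]: "W \<in> borel_measurable borel" and W0: "\<And>\<theta>. 0 < W \<theta>" and Wg: "\<And>\<theta>. W \<theta> \<le> g \<theta>"
    using W by (auto simp: weight_def)
  have base: "integrable lborel (\<lambda>\<theta>. k x \<theta> * g \<theta> * (1 + (norm (\<theta> - x))\<^sup>2))"
    using x g_pos by (intro integrableI_nonneg) (auto simp: good_def intro!: mult_nonneg_nonneg less_imp_le[OF g_pos])
  have *: "integrable lborel (\<lambda>\<theta>. (k x \<theta> * W \<theta>) *\<^sub>R v \<theta>)"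
    if [measurable]: "v \<in> borel_measurable borel" and v: "\<And>\<theta>. norm (v \<theta>) \<le> K * (1 + (norm (\<theta> - x))\<^sup>2)"
    for v :: "real^'n \<Rightarrow> 'b::{banach, second_countable_topology}" and K
  proof (rule Bochner_Integration.integrable_bound)
    show "integrable lborel (\<lambda>\<theta>. K * (k x \<theta> * g \<theta> * (1 + (norm (\<theta> - x))\<^sup>2)))" using base by simp
    show "AE \<theta> in lborel. norm ((k x \<theta> * W \<theta>) *\<^sub>R v \<theta>) \<le> norm (K * (k x \<theta> * g \<theta> * (1 + (norm (\<theta> - x))\<^sup>2)))"
    proof (rule AE_I2)
      fix \<theta>
      have "norm ((k x \<theta> * W \<theta>) *\<^sub>R v \<theta>) = (k x \<theta> * W \<theta>) * norm (v \<theta>)"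
        using less_imp_le[OF W0[of \<theta>]] by (simp add: abs_mult)
      also have "\<dots> \<le> (k x \<theta> * g \<theta>) * (K * (1 + (norm (\<theta> - x))\<^sup>2))"
        using less_imp_le[OF g_pos[of \<theta>]] by (intro mult_mono mult_left_mono v Wg mult_nonneg_nonneg) auto
      finally show "norm ((k x \<theta> * W \<theta>) *\<^sub>R v \<theta>) \<le> norm (K * (k x \<theta> * g \<theta> * (1 + (norm (\<theta> - x))\<^sup>2)))"
        by (simp add: mult_ac)
    qed
  qed measurable
  have sq: "t \<le> 1 + t\<^sup>2" for t :: real
    using zero_le_power2[of "t - 1"] zero_le_power2[of t] unfolding power2_diff one_power2 mult_1_right by linarith
  have nx: "(norm \<theta>)\<^sup>2 \<le> (2 + 2 * (norm x)\<^sup>2) * (1 + (norm (\<theta> - x))\<^sup>2)" for \<theta>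
  proof -
    have "norm \<theta> \<le> norm (\<theta> - x) + norm x" using norm_triangle_ineq[of "\<theta> - x" x] by simp
    then have "(norm \<theta>)\<^sup>2 \<le> (norm (\<theta> - x) + norm x)\<^sup>2" by (intro power_mono) auto
    also have "\<dots> \<le> 2 * (norm (\<theta> - x))\<^sup>2 + 2 * (norm x)\<^sup>2" using sum_squares_bound[of "norm (\<theta> - x)" "norm x"] by (simp add: power2_sum)
    also have "\<dots> \<le> (2 + 2 * (norm x)\<^sup>2) * (1 + (norm (\<theta> - x))\<^sup>2)" by (simp add: algebra_simps)
    finally show ?thesis .
  qed
  show "integrable lborel (\<lambda>\<theta>. k x \<theta> * W \<theta>)" using *[of "\<lambda>_. 1::real" 1] by simp
  show "integrable lborel (\<lambda>\<theta>. k x \<theta> * W \<theta> * norm (\<theta> - x))" using *[of "\<lambda>\<theta>. norm (\<theta> - x)" 1] sq by simp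
  show "integrable lborel (\<lambda>\<theta>. k x \<theta> * W \<theta> * (norm (\<theta> - x))\<^sup>2)" using *[of "\<lambda>\<theta>. (norm (\<theta> - x))\<^sup>2" 1] by simp
  show "integrable lborel (\<lambda>\<theta>. k x \<theta> * W \<theta> * (norm \<theta>)\<^sup>2)" using *[of "\<lambda>\<theta>. (norm \<theta>)\<^sup>2" "2 + 2 * (norm x)\<^sup>2"] nx by simp
  show s: "integrable lborel (\<lambda>\<theta>. (k x \<theta> * W \<theta>) *\<^sub>R (\<theta> - x))" using *[of "\<lambda>\<theta>. \<theta> - x" 1] sq by simp
  have "integrable lborel (\<lambda>\<theta>. (k x \<theta> * W \<theta>) *\<^sub>R x)" using *[of "\<lambda>_. x" "norm x"] by (simp add: distrib_left)
  from Bochner_Integration.integrable_add[OF s this] show "integrable lborel (\<lambda>\<theta>. (k x \<theta> * W \<theta>) *\<^sub>R \<theta>)"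
    by (simp flip: scaleR_add_right)
qed

text \<open>As a function of \<theta> the kernel is a probability density, so it cannot vanish
  almost everywhere, and the weight is positive.\<close>

lemma marginal_pos:
  assumes x: "good x" and W: "weight W"
  shows "0 < marginal f W x"
proof -
  have [measurable]: "W \<in> borel_measurable borel" and W0: "\<And>\<theta>. 0 < W \<theta>" and Wg: "\<And>\<theta>. W \<theta> \<le> g \<theta>"
    using W by (auto simp: weight_def)
  have nn: "0 \<le> k x \<theta> * W \<theta>" for \<theta> using less_imp_le[OF W0[of \<theta>]] by simp
  have "marginal f W x \<noteq> 0"
  proof
    assume "marginal f W x = 0"
    then have "AE \<theta> in lborel. k x \<theta> * W \<theta> = 0"
      using integral_nonneg_eq_0_iff_AE[OF good_integrable(1)[OF x W]] nn by (simp add: marginal_def)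
    then have "AE \<theta> in lborel. ennreal (k x \<theta>) = 0"
      by eventually_elim (use W0 in \<open>auto simp: less_le\<close>)
    then have "(\<integral>\<^sup>+\<theta>. ennreal (k x \<theta>) \<partial>lborel) = (\<integral>\<^sup>+\<theta>. 0 \<partial>(lborel :: (real^'n) measure))" by (rule nn_integral_cong_AE)
    then show False by (simp add: nn_integral_k_\<theta>)
  qed
  moreover have "0 \<le> marginal f W x" unfolding marginal_def using nn by (intro Bochner_Integration.integral_nonneg)
  ultimately show ?thesis by simp
qed

lemma marginal_mono:
  assumes x: "good x" and W: "weight W" "weight W'" and le: "\<And>\<theta>. W \<theta> \<le> W' \<theta>"
  shows "marginal f W x \<le> marginal f W' x"
  unfolding marginal_def using good_integrable[OF x] W le by (intro integral_mono mult_left_mono) auto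

lemma gen_bayes_shift:
  assumes x: "good x" and W: "weight W"
  shows "gen_bayes f W x - x = (\<integral>\<theta>. (k x \<theta> * W \<theta>) *\<^sub>R (\<theta> - x) \<partial>lborel) /\<^sub>R marginal f W x"
proof -
  have "(\<integral>\<theta>. (k x \<theta> * W \<theta>) *\<^sub>R (\<theta> - x) \<partial>lborel) =
      (\<integral>\<theta>. (k x \<theta> * W \<theta>) *\<^sub>R \<theta> \<partial>lborel) - marginal f W x *\<^sub>R x"
    unfolding scaleR_diff_right marginal_def using good_integrable[OF x W] by (subst Bochner_Integration.integral_diff) auto
  then show ?thesis
    using marginal_pos[OF x W] by (simp add: gen_bayes_def marginal_def[symmetric] scaleR_diff_right)
qed

section \<open>Bounds and limits at a fixed observation\<close>

definition S :: "real^'n \<Rightarrow> real" where "S x = (\<integral>\<theta>. k x \<theta> * g \<theta> * (norm (\<theta> - x))\<^sup>2 \<partial>lborel)"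

text \<open>Jensen bounds the squared shift by the second moment under \<open>W\<close>; then
  \<open>W \<le> g\<close> frees the bound from the weight.\<close>

lemma marginal_Jensen:
  assumes x: "good x" and W: "weight W"
  shows "marginal f W x * (norm (gen_bayes f W x - x))\<^sup>2 \<le> S x"
proof -
  have W0: "\<And>\<theta>. 0 < W \<theta>" and Wg: "\<And>\<theta>. W \<theta> \<le> g \<theta>"
    using W by (auto simp: weight_def)
  have "marginal f W x * (norm (gen_bayes f W x - x))\<^sup>2 \<le> (\<integral>\<theta>. k x \<theta> * W \<theta> * (norm (\<theta> - x))\<^sup>2 \<partial>lborel)"
    unfolding gen_bayes_shift[OF x W] marginal_def
    by (rule weighted_mean_Jensen)
       (use good_integrable[OF x W] marginal_pos[OF x W] less_imp_le[OF W0] in \<open>auto simp: marginal_def\<close>)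
  also have "\<dots> \<le> S x"
    unfolding S_def using good_integrable[OF x] W weight_g Wg by (intro integral_mono mult_right_mono mult_left_mono) auto
  finally show ?thesis .
qed

text \<open>Meant for observations in a bounded region, where no smallness is available: both
  estimators are compared with \<open>x\<close>. The bound is independent of \<open>i\<close>, as
  dominated convergence requires.\<close>

lemma deviation_local:
  assumes x: "good x"
  shows "marginal f (w i) x * (norm (gen_bayes f (w i) x - gen_bayes f g x))\<^sup>2 \<le> 4 * S x"
proof -
  let ?M = "marginal f (w i) x" and ?u = "gen_bayes f (w i) x - x" and ?v = "gen_bayes f g x - x"
  have M: "0 < ?M" "?M \<le> marginal f g x"
    using marginal_pos[OF x weight_w] marginal_mono[OF x weight_w weight_g w_le_g] by auto
  have "norm (?u - ?v) \<le> norm ?u + norm ?v" by (rule norm_triangle_ineq4)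
  then have "(norm (?u - ?v))\<^sup>2 \<le> (norm ?u + norm ?v)\<^sup>2" by (intro power_mono) auto
  also have "\<dots> \<le> 2 * (norm ?u)\<^sup>2 + 2 * (norm ?v)\<^sup>2" using sum_squares_bound[of "norm ?u" "norm ?v"] by (simp add: power2_sum)
  finally have "?M * (norm (?u - ?v))\<^sup>2 \<le> ?M * (2 * (norm ?u)\<^sup>2 + 2 * (norm ?v)\<^sup>2)" using M by (intro mult_left_mono) auto
  moreover have "?M * (norm ?v)\<^sup>2 \<le> marginal f g x * (norm ?v)\<^sup>2" using M by (intro mult_right_mono) auto
  ultimately show ?thesis
    using marginal_Jensen[OF x weight_w, of i] marginal_Jensen[OF x weight_g] by (simp add: algebra_simps)
qed

lemma gen_bayes_limit:
  assumes x: "good x"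
  shows "(\<lambda>i. marginal f (w i) x) \<longlonglongrightarrow> marginal f g x" "(\<lambda>i. gen_bayes f (w i) x) \<longlonglongrightarrow> gen_bayes f g x"
proof -
  have lim: "(\<lambda>i. w i \<theta>) \<longlonglongrightarrow> g \<theta>" for \<theta>
    using tendsto_mult[OF tendsto_const tendsto_power[OF h_lim[of "N \<theta>"], of 2], of "g \<theta>"] by (simp add: w_def)
  show 1: "(\<lambda>i. marginal f (w i) x) \<longlonglongrightarrow> marginal f g x"
    unfolding marginal_def
  proof (rule integral_dominated_convergence)
    show "integrable lborel (\<lambda>\<theta>. k x \<theta> * g \<theta>)" using good_integrable[OF x weight_g] by simp
    show "AE \<theta> in lborel. (\<lambda>i. k x \<theta> * w i \<theta>) \<longlonglongrightarrow> k x \<theta> * g \<theta>" by (intro AE_I2 tendsto_intros lim)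
    show "AE \<theta> in lborel. norm (k x \<theta> * w i \<theta>) \<le> k x \<theta> * g \<theta>" for i
      using less_imp_le[OF w_pos] w_le_g by (intro AE_I2) (auto simp: abs_mult intro!: mult_left_mono)
  qed measurable
  have "(\<lambda>i. \<integral>\<theta>. (k x \<theta> * w i \<theta>) *\<^sub>R \<theta> \<partial>lborel) \<longlonglongrightarrow> (\<integral>\<theta>. (k x \<theta> * g \<theta>) *\<^sub>R \<theta> \<partial>lborel)"
  proof (rule integral_dominated_convergence)
    show "integrable lborel (\<lambda>\<theta>. norm ((k x \<theta> * g \<theta>) *\<^sub>R \<theta>))" using good_integrable(6)[OF x weight_g] by (rule integrable_norm)
    show "AE \<theta> in lborel. (\<lambda>i. (k x \<theta> * w i \<theta>) *\<^sub>R \<theta>) \<longlonglongrightarrow> (k x \<theta> * g \<theta>) *\<^sub>R \<theta>" by (intro AE_I2 tendsto_intros lim)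
    show "AE \<theta> in lborel. norm ((k x \<theta> * w i \<theta>) *\<^sub>R \<theta>) \<le> norm ((k x \<theta> * g \<theta>) *\<^sub>R \<theta>)" for i
      using less_imp_le[OF w_pos] less_imp_le[OF g_pos] w_le_g
      by (intro AE_I2) (auto simp: abs_mult intro!: mult_left_mono mult_right_mono)
  qed measurable
  with 1 marginal_pos[OF x weight_g] show "(\<lambda>i. gen_bayes f (w i) x) \<longlonglongrightarrow> gen_bayes f g x"
    unfolding gen_bayes_def marginal_def by (intro tendsto_intros) auto
qed

section \<open>Observations far from the origin\<close>

lemma k_moments:
  shows "integrable lborel (\<lambda>\<theta>. k x \<theta>)" "(\<integral>\<theta>. k x \<theta> \<partial>lborel) = 1"
    and "integrable lborel (\<lambda>\<theta>. k x \<theta> * norm (\<theta> - x))" "(\<integral>\<theta>. k x \<theta> * norm (\<theta> - x) \<partial>lborel) = m1"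
    and "integrable lborel (\<lambda>\<theta>. k x \<theta> * (norm (\<theta> - x))\<^sup>2)" "(\<integral>\<theta>. k x \<theta> * (norm (\<theta> - x))\<^sup>2 \<partial>lborel) = m2"
    and "0 \<le> m1" "0 \<le> m2"
proof -
  have i0: "integrable lborel (\<lambda>y::real^'n. f (norm y))"
    using f_int by (intro integrableI_nonneg) (auto simp: f_nonneg)
  have "(\<integral>y. f (norm (y::real^'n)) \<partial>lborel) = enn2real (\<integral>\<^sup>+y. ennreal (f (norm (y::real^'n))) \<partial>lborel)"
    by (intro integral_eq_nn_integral) (auto simp: f_nonneg)
  then have e0: "(\<integral>y. f (norm (y::real^'n)) \<partial>lborel) = 1" using f_int by simp
  have i2: "integrable lborel (\<lambda>y::real^'n. f (norm y) * (norm y)\<^sup>2)"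
    using f_moment by (intro integrableI_nonneg) (auto simp: f_nonneg)
  have sq: "t \<le> 1 + t\<^sup>2" for t :: real
    using zero_le_power2[of "t - 1"] zero_le_power2[of t] unfolding power2_diff one_power2 mult_1_right by linarith
  have i1: "integrable lborel (\<lambda>y::real^'n. f (norm y) * norm y)"
  proof (rule Bochner_Integration.integrable_bound)
    show "integrable lborel (\<lambda>y::real^'n. f (norm y) + f (norm y) * (norm y)\<^sup>2)" using i0 i2 by simp
    have "f (norm y) * norm y \<le> f (norm y) * (1 + (norm y)\<^sup>2)" for y :: "real^'n"
      using sq by (intro mult_left_mono) (auto simp: f_nonneg)
    then show "AE y::real^'n in lborel. norm (f (norm y) * norm y) \<le> norm (f (norm y) + f (norm y) * (norm y)\<^sup>2)"
      by (intro AE_I2) (simp add: abs_mult f_nonneg distrib_left)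
  qed measurable
  show "integrable lborel (\<lambda>\<theta>. k x \<theta>)" "(\<integral>\<theta>. k x \<theta> \<partial>lborel) = 1"
    using integral_reflect[OF i0, of x] e0 by auto
  show "integrable lborel (\<lambda>\<theta>. k x \<theta> * norm (\<theta> - x))" "(\<integral>\<theta>. k x \<theta> * norm (\<theta> - x) \<partial>lborel) = m1"
    using integral_reflect[OF i1, of x] by (auto simp: m1_def norm_minus_commute)
  show "integrable lborel (\<lambda>\<theta>. k x \<theta> * (norm (\<theta> - x))\<^sup>2)" "(\<integral>\<theta>. k x \<theta> * (norm (\<theta> - x))\<^sup>2 \<partial>lborel) = m2"
    using integral_reflect[OF i2, of x] by (auto simp: m2_def norm_minus_commute)
  show "0 \<le> m1" "0 \<le> m2" unfolding m1_def m2_def by (auto intro!: Bochner_Integration.integral_nonneg simp: f_nonneg)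
qed

text \<open>For \<open>R1 \<le> N x\<close>, each \<theta> with
  \<open>N (\<theta> - x) \<le> N x / 2\<close> lies beyond the threshold \<open>R\<close> for
  \<open>G\<close>, and each other \<theta> has distance at least \<open>r0 + m2 + 1\<close> from
  \<open>x\<close>. That distance is in the tail of \<open>f\<close> and large enough for
  Chebyshev's inequality in \<open>marginal_lower\<close>.\<close>

definition R1 where "R1 = 2 * R + 2 * \<kappa> * (r0 + m2 + 1)"

lemma R1: "2 * R \<le> R1" "1 \<le> R1" "0 \<le> a"
proof -
  have "0 \<le> 2 * \<kappa> * (r0 + m2 + 1)" using \<kappa> r0 k_moments(8) by (intro mult_nonneg_nonneg) auto
  then show "2 * R \<le> R1" "1 \<le> R1" "0 \<le> a" using R b unfolding R1_def a_def by linarith+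
qed

lemma far_distance:
  assumes x: "R1 \<le> N x" and far: "N x / 2 < N (\<theta> - x)"
  shows "r0 + m2 + 1 \<le> norm (\<theta> - x)" "N x \<le> 2 * \<kappa> * norm (\<theta> - x)" "1 + N \<theta> \<le> 4 * \<kappa> * norm (\<theta> - x)"
proof -
  show 1: "N x \<le> 2 * \<kappa> * norm (\<theta> - x)" using far N_le[of "\<theta> - x"] by linarith
  then have "2 * \<kappa> * (r0 + m2 + 1) \<le> 2 * \<kappa> * norm (\<theta> - x)" using x R unfolding R1_def by linarith
  then show 2: "r0 + m2 + 1 \<le> norm (\<theta> - x)" using \<kappa> by simp
  have "1 \<le> norm (\<theta> - x)" using 2 r0 k_moments(8) by linarith
  then have "1 \<le> N (\<theta> - x)" using N_ge[of "\<theta> - x"] by linarith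
  moreover have "N \<theta> \<le> N x + N (\<theta> - x)" using N_diff[of \<theta> x] by linarith
  ultimately have "1 + N \<theta> \<le> 4 * N (\<theta> - x)" using far by linarith
  also have "\<dots> \<le> 4 * \<kappa> * norm (\<theta> - x)" using N_le[of "\<theta> - x"] by simp
  finally show "1 + N \<theta> \<le> 4 * \<kappa> * norm (\<theta> - x)" .
qed

definition C1 where "C1 = L * (2 * \<kappa>) powr a * (4 * \<kappa>) powr b"

lemma C1: "0 \<le> C1" using L by (simp add: C1_def)

text \<open>Here the distance \<open>t\<close>, up to constants, dominates both \<open>N x\<close>
  and \<open>1 + N \<theta>\<close>. Its exponent \<open>- (p + s) + 1\<close> splits as
  \<open>- a - b\<close>: the first part becomes decay in \<open>x\<close>, the second makes the
  prior integrable in \<theta>.\<close>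

lemma far_kernel:
  assumes x: "R1 \<le> N x" and far: "N x / 2 < N (\<theta> - x)"
  shows "k x \<theta> * norm (\<theta> - x) \<le> C1 * N x powr (- a) * (1 + N \<theta>) powr (- b)"
proof -
  define t where "t = norm (\<theta> - x)"
  note fd = far_distance[OF x far, folded t_def]
  have t: "r0 \<le> t" "1 \<le> t" using fd r0 k_moments(8) by linarith+
  have kt: "k x \<theta> = f t" by (simp add: t_def norm_minus_commute)
  have "f t * t \<le> L * t powr (- (p + s)) * t" using f_tail[OF t(1)] t by (intro mult_right_mono) auto
  also have "\<dots> = L * (t powr (- a) * t powr (- b))"
  proof -
    have "t powr (- a) * t powr (- b) = t powr (- a + - b)" by (rule powr_add[symmetric])
    also have "- a + - b = - (p + s) + 1" by (simp add: a_def)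
    also have "t powr (- (p + s) + 1) = t powr (- (p + s)) * t" unfolding powr_add using t by simp
    finally show ?thesis by simp
  qed
  also have "\<dots> \<le> L * (((2 * \<kappa>) powr a * N x powr (- a)) * ((4 * \<kappa>) powr b * (1 + N \<theta>) powr (- b)))"
  proof (intro mult_left_mono mult_mono)
    have "t powr (- a) \<le> (N x / (2 * \<kappa>)) powr (- a)"
      using fd(2) \<kappa> R1 x by (intro powr_mono2') (auto simp: field_simps)
    then show "t powr (- a) \<le> (2 * \<kappa>) powr a * N x powr (- a)"
      using \<kappa> by (simp add: powr_divide powr_minus field_simps)
    have "t powr (- b) \<le> ((1 + N \<theta>) / (4 * \<kappa>)) powr (- b)"
      using fd(3) \<kappa> b by (intro powr_mono2') (auto simp: field_simps intro!: divide_pos_pos add_pos_nonneg)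
    then show "t powr (- b) \<le> (4 * \<kappa>) powr b * (1 + N \<theta>) powr (- b)"
      using \<kappa> by (simp add: powr_divide powr_minus field_simps)
  qed (use L in auto)
  finally show ?thesis by (simp add: kt t_def C1_def mult_ac)
qed

lemma near_norm:
  assumes "N (\<theta> - x) \<le> N x / 2"
  shows "N x / 2 \<le> N \<theta>" "N \<theta> \<le> 2 * N x"
  using N_diff[of \<theta> x] assms N_nonneg[of x] by linarith+

text \<open>Chebyshev's inequality: \<open>2 * m2 \<le> T\<^sup>2\<close> puts at least half of the
  kernel's mass within distance \<open>T\<close>. The factor
  \<open>1 - (norm (\<theta> - x))\<^sup>2 / T\<^sup>2\<close> replaces an indicator: it is at most
  1 everywhere, and at most 0 for far \<theta>, where only the sign of \<open>W\<close> is
  used.\<close>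

lemma marginal_lower:
  assumes gx: "good x" and W: "weight W" and x: "R1 \<le> N x" and m: "0 \<le> m"
    and near: "\<And>\<theta>. N (\<theta> - x) \<le> N x / 2 \<Longrightarrow> m \<le> W \<theta>"
  shows "m / 2 \<le> marginal f W x"
proof -
  define T where "T = r0 + m2 + 1"
  have T: "1 \<le> T" "2 * m2 \<le> T\<^sup>2"
  proof -
    show "1 \<le> T" using r0 k_moments(8) by (simp add: T_def)
    have "(m2 + 1)\<^sup>2 \<le> T\<^sup>2" using r0 k_moments(8) by (intro power_mono) (auto simp: T_def)
    moreover have "2 * m2 \<le> (m2 + 1)\<^sup>2" by (simp add: power2_sum)
    ultimately show "2 * m2 \<le> T\<^sup>2" by linarith
  qed
  have "m * (1 - m2 / T\<^sup>2) = (\<integral>\<theta>. m * (k x \<theta> - k x \<theta> * (norm (\<theta> - x))\<^sup>2 / T\<^sup>2) \<partial>lborel)"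
    using k_moments(1-6)[of x] by simp
  also have "\<dots> \<le> marginal f W x"
    unfolding marginal_def
  proof (rule integral_mono)
    show "integrable lborel (\<lambda>\<theta>. m * (k x \<theta> - k x \<theta> * (norm (\<theta> - x))\<^sup>2 / T\<^sup>2))" using k_moments(1-6)[of x] by simp
    show "integrable lborel (\<lambda>\<theta>. k x \<theta> * W \<theta>)" using good_integrable[OF gx W] by simp
    fix \<theta>
    have W0: "0 < W \<theta>" using W by (simp add: weight_def)
    have "m * (1 - (norm (\<theta> - x))\<^sup>2 / T\<^sup>2) \<le> W \<theta>"
    proof (cases "N (\<theta> - x) \<le> N x / 2")
      case True
      have "m * (1 - (norm (\<theta> - x))\<^sup>2 / T\<^sup>2) \<le> m * 1" using m by (intro mult_left_mono) auto
      then show ?thesis using near[OF True] by simp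
    next
      case False
      then have "T \<le> norm (\<theta> - x)" using far_distance(1)[OF x, of \<theta>] by (simp add: T_def)
      then have "T\<^sup>2 \<le> (norm (\<theta> - x))\<^sup>2" using T by (intro power_mono) auto
      then have "1 - (norm (\<theta> - x))\<^sup>2 / T\<^sup>2 \<le> 0" using T by (simp add: field_simps)
      then have "m * (1 - (norm (\<theta> - x))\<^sup>2 / T\<^sup>2) \<le> 0" using m by (rule mult_nonneg_nonpos[rotated])
      then show ?thesis using W0 by linarith
    qed
    then have "k x \<theta> * (m * (1 - (norm (\<theta> - x))\<^sup>2 / T\<^sup>2)) \<le> k x \<theta> * W \<theta>" by (intro mult_left_mono) auto
    then show "m * (k x \<theta> - k x \<theta> * (norm (\<theta> - x))\<^sup>2 / T\<^sup>2) \<le> k x \<theta> * W \<theta>" by (simp add: algebra_simps)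
  qed
  finally have "m * (1 - m2 / T\<^sup>2) \<le> marginal f W x" .
  moreover have "m * (1 / 2) \<le> m * (1 - m2 / T\<^sup>2)" using T m by (intro mult_left_mono) (auto simp: field_simps)
  ultimately show ?thesis by linarith
qed

lemma G_near:
  assumes x: "R1 \<le> N x" and near: "N (\<theta> - x) \<le> N x / 2"
  shows "g \<theta> \<le> C * g x" "g x \<le> C * g \<theta>"
  using near_norm[OF near] x R1(1) R G_doubling[of "N \<theta>" "N x"] G_doubling[of "N x" "N \<theta>"] by (auto simp: g_def)

definition J where "J = (\<integral>\<theta>. g \<theta> * (1 + N \<theta>) powr (- b) \<partial>lborel)"

lemma J: "integrable lborel (\<lambda>\<theta>. g \<theta> * (1 + N \<theta>) powr (- b))" "0 \<le> J"
  using G_int unfolding J_def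
  by (auto intro!: integrableI_nonneg Bochner_Integration.integral_nonneg mult_nonneg_nonneg less_imp_le[OF g_pos] simp: g_def[symmetric])

lemma g_lower: "R1 \<le> N x \<Longrightarrow> c * N x powr t1 \<le> g x"
  using G_lower[of "N x"] R1(1) R by (simp add: g_def)

text \<open>The near part of the numerator is at most \<open>C * g x * m1\<close>. The far part
  decays like \<open>N x powr (- a)\<close>, which \<open>0 \<le> a + t1\<close> and the lower bound
  on \<open>g\<close> turn into a multiple of \<open>g x\<close>. Both cancel against the marginal,
  which is at least \<open>g x / (2 * C)\<close>.\<close>

lemma gen_bayes_bounded:
  obtains A where "0 \<le> A" "\<And>x. good x \<Longrightarrow> R1 \<le> N x \<Longrightarrow> norm (gen_bayes f g x - x) \<le> A"
proof -
  define A where "A = 2 * C\<^sup>2 * m1 + 2 * C * C1 * J / c"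
  have A: "0 \<le> A" using C c C1 J k_moments(7) by (simp add: A_def)
  have "norm (gen_bayes f g x - x) \<le> A" if gx: "good x" and x: "R1 \<le> N x" for x
  proof -
    have Nx: "1 \<le> N x" using x R1 by linarith
    have M: "g x / C / 2 \<le> marginal f g x"
      by (rule marginal_lower[OF gx weight_g x]) (use G_near[OF x] g_pos[of x] C in \<open>auto simp: field_simps less_imp_le\<close>)
    have "norm (\<integral>\<theta>. (k x \<theta> * g \<theta>) *\<^sub>R (\<theta> - x) \<partial>lborel) \<le> (\<integral>\<theta>. norm ((k x \<theta> * g \<theta>) *\<^sub>R (\<theta> - x)) \<partial>lborel)"
      by (rule integral_norm_bound)
    also have "\<dots> \<le> (\<integral>\<theta>. C * g x * (k x \<theta> * norm (\<theta> - x)) + C1 * N x powr (- a) * (g \<theta> * (1 + N \<theta>) powr (- b)) \<partial>lborel)"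
    proof (rule integral_mono)
      show "integrable lborel (\<lambda>\<theta>. norm ((k x \<theta> * g \<theta>) *\<^sub>R (\<theta> - x)))"
        using good_integrable(5)[OF gx weight_g] by (rule integrable_norm)
      show "integrable lborel (\<lambda>\<theta>. C * g x * (k x \<theta> * norm (\<theta> - x)) + C1 * N x powr (- a) * (g \<theta> * (1 + N \<theta>) powr (- b)))"
        using k_moments(1-6)[of x] J by simp
      fix \<theta>
      have nn: "0 \<le> C * g x * (k x \<theta> * norm (\<theta> - x))" "0 \<le> C1 * N x powr (- a) * (g \<theta> * (1 + N \<theta>) powr (- b))"
        using C C1 less_imp_le[OF g_pos] by auto
      have eq: "norm ((k x \<theta> * g \<theta>) *\<^sub>R (\<theta> - x)) = g \<theta> * (k x \<theta> * norm (\<theta> - x))"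
        using less_imp_le[OF g_pos] by (simp add: abs_mult)
      show "norm ((k x \<theta> * g \<theta>) *\<^sub>R (\<theta> - x)) \<le> C * g x * (k x \<theta> * norm (\<theta> - x)) + C1 * N x powr (- a) * (g \<theta> * (1 + N \<theta>) powr (- b))"
      proof (cases "N (\<theta> - x) \<le> N x / 2")
        case True
        have "g \<theta> * (k x \<theta> * norm (\<theta> - x)) \<le> C * g x * (k x \<theta> * norm (\<theta> - x))"
          using G_near(1)[OF x True] by (intro mult_right_mono) auto
        then show ?thesis using nn unfolding eq by linarith
      next
        case False
        then have "g \<theta> * (k x \<theta> * norm (\<theta> - x)) \<le> g \<theta> * (C1 * N x powr (- a) * (1 + N \<theta>) powr (- b))"
          using less_imp_le[OF g_pos] by (intro mult_left_mono far_kernel[OF x]) auto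
        then show ?thesis using nn unfolding eq by (simp add: mult_ac)
      qed
    qed
    also have "\<dots> = C * g x * m1 + C1 * N x powr (- a) * J"
      using k_moments(1-6)[of x] J(1) by (simp add: J_def)
    finally have num: "norm (\<integral>\<theta>. (k x \<theta> * g \<theta>) *\<^sub>R (\<theta> - x) \<partial>lborel) \<le> C * g x * m1 + C1 * N x powr (- a) * J" .
    have "N x powr (- a) \<le> N x powr t1" using Nx b(3) by (intro powr_mono) (auto simp: a_def)
    then have "c * N x powr (- a) \<le> c * N x powr t1" using c by (intro mult_left_mono) auto
    then have "c * N x powr (- a) \<le> g x" using g_lower[OF x] by linarith
    then have "N x powr (- a) \<le> g x / c" using c by (simp add: field_simps)
    then have "C1 * N x powr (- a) * J \<le> C1 * (g x / c) * J" using C1 J by (intro mult_right_mono mult_left_mono) auto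
    moreover have "A * (g x / C / 2) = C * g x * m1 + C1 * (g x / c) * J"
      using C c by (simp add: A_def field_simps power2_eq_square)
    ultimately have "C * g x * m1 + C1 * N x powr (- a) * J \<le> A * (g x / C / 2)"
      by linarith
    also have "\<dots> \<le> A * marginal f g x" using M A by (intro mult_left_mono)
    finally show ?thesis
      using num marginal_pos[OF gx weight_g] unfolding gen_bayes_shift[OF gx weight_g]
      by (simp add: field_simps)
  qed
  with A show ?thesis by (rule that)
qed


text \<open>Factoring the difference of squares keeps a factor \<open>h i (N x)\<close>. Without it,
  the division by a marginal of order \<open>g * h\<^sub>i\<^sup>2\<close> could not be uniform in
  \<open>i\<close>.\<close>

lemma h_square_difference:
  assumes x: "R1 \<le> N x" and near: "N (\<theta> - x) \<le> N x / 2"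
  shows "\<bar>(h i (N \<theta>))\<^sup>2 - (h i (N x))\<^sup>2\<bar> \<le> C * (C + 1) * \<kappa> * (h i (N x) * D (N x)) * norm (\<theta> - x)"
proof -
  let ?h = "h i (N \<theta>)" and ?hx = "h i (N x)"
  note n = near_norm[OF near]
  have h: "0 < ?h" "0 < ?hx" "?h \<le> C * ?hx" "\<bar>?h - ?hx\<bar> \<le> C * \<bar>N \<theta> - N x\<bar> * D (N x)"
    using h_pos h_doubling(1) h_Lipschitz n by auto
  have "\<bar>N \<theta> - N x\<bar> \<le> \<kappa> * norm (\<theta> - x)" using N_diff[of \<theta> x] N_le[of "\<theta> - x"] by linarith
  then have "C * \<bar>N \<theta> - N x\<bar> * D (N x) \<le> C * (\<kappa> * norm (\<theta> - x)) * D (N x)"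
    using C D_pos[of "N x"] by (intro mult_right_mono mult_left_mono) auto
  then have l: "\<bar>?h - ?hx\<bar> \<le> C * (\<kappa> * norm (\<theta> - x)) * D (N x)" using h by linarith
  have "?h\<^sup>2 - ?hx\<^sup>2 = (?h + ?hx) * (?h - ?hx)" by (simp add: power2_eq_square algebra_simps)
  then have "\<bar>?h\<^sup>2 - ?hx\<^sup>2\<bar> = (?h + ?hx) * \<bar>?h - ?hx\<bar>" using h by (simp add: abs_mult)
  also have "\<dots> \<le> ((C + 1) * ?hx) * (C * (\<kappa> * norm (\<theta> - x)) * D (N x))"
    using h l C by (intro mult_mono) (auto simp: algebra_simps)
  finally show ?thesis by (simp add: mult_ac)
qed

text \<open>Turns the squared far remainder, divided by the prior, into a pure power, uniformly in
  \<open>i\<close> because \<open>h 0 \<le> h i\<close>. Squaring the lower bound of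
  \<open>h 0\<close> costs \<open>2 * e\<close> powers and gives \<open>c ^ 2\<close>; the third
  factor \<open>c\<close> comes from \<open>g\<close>.\<close>

lemma w_lower:
  assumes x: "R1 \<le> N x"
  shows "N x powr (- (2 * a)) / w i x \<le> 4 powr e / c ^ 3 * N x powr (- (2 * a + t1 - 2 * e))"
proof -
  have Nx: "1 \<le> N x" using x R1 by linarith
  have "c * (2 * N x) powr (- e) \<le> c * (1 + N x) powr (- e)"
    using Nx c e by (intro mult_left_mono powr_mono2') auto
  also have "\<dots> \<le> h i (N x)" using h_lower[of "N x"] h_0_le[of "N x" i] by simp
  finally have "(c * (2 * N x) powr (- e))\<^sup>2 \<le> (h i (N x))\<^sup>2" using c by (intro power_mono) auto
  then have "(c * N x powr t1) * (c * (2 * N x) powr (- e))\<^sup>2 \<le> w i x"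
    unfolding w_def using g_lower[OF x] c less_imp_le[OF g_pos[of x]] by (intro mult_mono) auto
  also have "(c * N x powr t1) * (c * (2 * N x) powr (- e))\<^sup>2 = c ^ 3 * (N x powr t1 * (2 * N x) powr (- (2 * e)))"
  proof -
    have "((2 * N x) powr (- e))\<^sup>2 = (2 * N x) powr (- (2 * e))"
      unfolding power2_eq_square powr_add[symmetric] by simp
    then show ?thesis by (simp add: power_mult_distrib power2_eq_square power3_eq_cube)
  qed
  also have "\<dots> = c ^ 3 * 4 powr (- e) * N x powr (t1 - 2 * e)"
  proof -
    have "(4::real) powr (- e) = (2 * 2) powr (- e)" by simp
    also have "\<dots> = 2 powr (- e) * 2 powr (- e)" by (subst powr_mult) auto
    also have "\<dots> = 2 powr (- (2 * e))" unfolding powr_add[symmetric] by simp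
    finally have "(2 * N x) powr (- (2 * e)) = 4 powr (- e) * N x powr (- (2 * e))"
      using Nx by (simp add: powr_mult)
    moreover have "N x powr t1 * N x powr (- (2 * e)) = N x powr (t1 - 2 * e)" unfolding powr_add[symmetric] by simp
    ultimately show ?thesis by simp
  qed
  finally have le: "c ^ 3 * 4 powr (- e) * N x powr (t1 - 2 * e) \<le> w i x" .
  have "N x powr (- (2 * a)) / w i x \<le> N x powr (- (2 * a)) / (c ^ 3 * 4 powr (- e) * N x powr (t1 - 2 * e))"
    using le c Nx w_pos[of i x] by (intro divide_left_mono mult_pos_pos) auto
  also have "\<dots> = 4 powr e / c ^ 3 * (N x powr (- (2 * a)) * N x powr (- (t1 - 2 * e)))"
    unfolding powr_minus_divide[of 4 e] powr_minus_divide[of "N x" "t1 - 2 * e"] by simp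
  also have "N x powr (- (2 * a)) * N x powr (- (t1 - 2 * e)) = N x powr (- (2 * a + t1 - 2 * e))"
    unfolding powr_add[symmetric] by (simp add: algebra_simps)
  finally show ?thesis .
qed

text \<open>The integral of \<open>\<theta> - \<delta>\<close> against kernel and \<open>g\<close>
  vanishes because \<delta> is the posterior mean for \<open>g\<close>; hence the constant
  \<open>(h i (N x))\<^sup>2\<close> may be subtracted.\<close>

lemma deviation_eq:
  fixes i :: nat
  assumes gx: "good x"
  defines "\<delta> \<equiv> gen_bayes f g x"
  defines "v \<equiv> \<lambda>\<theta>. (k x \<theta> * g \<theta> * ((h i (N \<theta>))\<^sup>2 - (h i (N x))\<^sup>2)) *\<^sub>R (\<theta> - \<delta>)"
  shows "integrable lborel v" "(\<integral>\<theta>. v \<theta> \<partial>lborel) = marginal f (w i) x *\<^sub>R (gen_bayes f (w i) x - \<delta>)"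
proof -
  have int: "integrable lborel (\<lambda>\<theta>. (k x \<theta> * W \<theta>) *\<^sub>R (\<theta> - \<delta>))"
    "(\<integral>\<theta>. (k x \<theta> * W \<theta>) *\<^sub>R (\<theta> - \<delta>) \<partial>lborel) = marginal f W x *\<^sub>R (gen_bayes f W x - \<delta>)" if W: "weight W" for W
  proof -
    note I = good_integrable[OF gx W]
    have 1: "integrable lborel (\<lambda>\<theta>. (k x \<theta> * W \<theta>) *\<^sub>R \<delta>)" using I(1) by (intro integrable_scaleR_left)
    show "integrable lborel (\<lambda>\<theta>. (k x \<theta> * W \<theta>) *\<^sub>R (\<theta> - \<delta>))"
      unfolding scaleR_diff_right using I(6) 1 by (rule Bochner_Integration.integrable_diff)
    have "(\<integral>\<theta>. (k x \<theta> * W \<theta>) *\<^sub>R (\<theta> - \<delta>) \<partial>lborel) = (\<integral>\<theta>. (k x \<theta> * W \<theta>) *\<^sub>R \<theta> \<partial>lborel) - marginal f W x *\<^sub>R \<delta>"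
      unfolding scaleR_diff_right using I 1 by (subst Bochner_Integration.integral_diff) (auto simp: marginal_def)
    also have "(\<integral>\<theta>. (k x \<theta> * W \<theta>) *\<^sub>R \<theta> \<partial>lborel) = marginal f W x *\<^sub>R gen_bayes f W x"
      using marginal_pos[OF gx W] by (simp add: gen_bayes_def marginal_def[symmetric])
    finally show "(\<integral>\<theta>. (k x \<theta> * W \<theta>) *\<^sub>R (\<theta> - \<delta>) \<partial>lborel) = marginal f W x *\<^sub>R (gen_bayes f W x - \<delta>)"
      by (simp add: scaleR_diff_right)
  qed
  have v: "v = (\<lambda>\<theta>. (k x \<theta> * w i \<theta>) *\<^sub>R (\<theta> - \<delta>) - (h i (N x))\<^sup>2 *\<^sub>R ((k x \<theta> * g \<theta>) *\<^sub>R (\<theta> - \<delta>)))"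
    by (auto simp: v_def w_def fun_eq_iff right_diff_distrib scaleR_diff_left mult_ac)
  have i2: "integrable lborel (\<lambda>\<theta>. (h i (N x))\<^sup>2 *\<^sub>R ((k x \<theta> * g \<theta>) *\<^sub>R (\<theta> - \<delta>)))"
    using int(1)[OF weight_g] by (intro integrable_scaleR_right)
  show "integrable lborel v" unfolding v
    using int(1)[OF weight_w] i2 by (rule Bochner_Integration.integrable_diff)
  have "(\<integral>\<theta>. v \<theta> \<partial>lborel) = marginal f (w i) x *\<^sub>R (gen_bayes f (w i) x - \<delta>) - (h i (N x))\<^sup>2 *\<^sub>R (marginal f g x *\<^sub>R (gen_bayes f g x - \<delta>))"
    unfolding v Bochner_Integration.integral_diff[OF int(1)[OF weight_w] i2] integral_scaleR_right
      int(2)[OF weight_w] int(2)[OF weight_g] by (rule refl)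
  then show "(\<integral>\<theta>. v \<theta> \<partial>lborel) = marginal f (w i) x *\<^sub>R (gen_bayes f (w i) x - \<delta>)" by (simp add: \<delta>_def)
qed

text \<open>\<open>deviation_eq\<close> leads to a near and a far bound for \<open>M * z\<close>.
  Their squares are divided by \<open>M\<close>, which is at least of order
  \<open>g x * hx\<^sup>2\<close>: this cancels \<open>hx\<^sup>2\<close> in the near term and
  leaves \<open>g x * Dx\<^sup>2\<close>, while \<open>w_lower\<close> treats the far term.\<close>

lemma deviation_far:
  obtains K where "0 \<le> K" "\<And>i x. good x \<Longrightarrow> R1 \<le> N x \<Longrightarrow>
    marginal f (w i) x * (norm (gen_bayes f (w i) x - gen_bayes f g x))\<^sup>2 \<le>
    K * (g x * (D (N x))\<^sup>2 + N x powr (- (2 * a + t1 - 2 * e)))"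
proof -
  obtain A where A: "0 \<le> A" "\<And>x. good x \<Longrightarrow> R1 \<le> N x \<Longrightarrow> norm (gen_bayes f g x - x) \<le> A"
    using gen_bayes_bounded by blast
  define C2 where "C2 = C * (C * (C + 1) * \<kappa>)"
  define C3 where "C3 = C2 * (m2 + A * m1)"
  define C4 where "C4 = (1 + A) * C1 * J"
  define K where "K = 4 * C ^ 3 * C3\<^sup>2 + 4 * C ^ 3 * C4\<^sup>2 * (4 powr e / c ^ 3)"
  have C2: "0 \<le> C2" using C \<kappa> by (simp add: C2_def)
  have C3: "0 \<le> C3" using C2 A k_moments(7,8) by (simp add: C3_def)
  have C4: "0 \<le> C4" using C1 J A by (simp add: C4_def)
  have K: "0 \<le> K" using C c by (simp add: K_def)
  have "marginal f (w i) x * (norm (gen_bayes f (w i) x - gen_bayes f g x))\<^sup>2 \<le>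
    K * (g x * (D (N x))\<^sup>2 + N x powr (- (2 * a + t1 - 2 * e)))" if gx: "good x" and x: "R1 \<le> N x" for i x
  proof -
    define \<delta> where "\<delta> = gen_bayes f g x"
    define hx where "hx = h i (N x)"
    define Dx where "Dx = D (N x)"
    define v where "v = (\<lambda>\<theta>. (k x \<theta> * g \<theta> * ((h i (N \<theta>))\<^sup>2 - (h i (N x))\<^sup>2)) *\<^sub>R (\<theta> - \<delta>))"
    define M where "M = marginal f (w i) x"
    define z where "z = norm (gen_bayes f (w i) x - \<delta>)"
    note v = deviation_eq[OF gx, of i, folded \<delta>_def, folded v_def]
    have pos: "0 < g x" "0 < hx" "0 < Dx" "0 < M"
      using g_pos h_pos D_pos marginal_pos[OF gx weight_w] by (auto simp: hx_def Dx_def M_def)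
    \<comment> \<open>One factor \<open>C\<close> comes from \<open>G_near\<close>, two from
      doubling of \<open>h i\<close> under the square.\<close>
    have Mlow: "w i x / C ^ 3 / 2 \<le> M"
      unfolding M_def
    proof (rule marginal_lower[OF gx weight_w x])
      show "0 \<le> w i x / C ^ 3" using less_imp_le[OF w_pos] C by simp
      fix \<theta> assume near: "N (\<theta> - x) \<le> N x / 2"
      have "hx \<le> C * h i (N \<theta>)" using h_doubling(2) near_norm[OF near] by (simp add: hx_def)
      then have "hx\<^sup>2 \<le> (C * h i (N \<theta>))\<^sup>2" using pos by (intro power_mono) auto
      then have "g x * hx\<^sup>2 \<le> (C * g \<theta>) * (C * h i (N \<theta>))\<^sup>2"
        using G_near(2)[OF x near] pos C less_imp_le[OF g_pos] by (intro mult_mono) auto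
      also have "\<dots> = C ^ 3 * w i \<theta>" by (simp add: w_def power2_eq_square power3_eq_cube)
      finally show "w i x / C ^ 3 \<le> w i \<theta>" using C by (simp add: w_def hx_def field_simps)
    qed
    \<comment> \<open>Centring at \<delta> instead of \<open>x\<close> costs only the constant
      \<open>A\<close>, which brings in the first moment \<open>m1\<close>.\<close>
    have \<delta>x: "norm (\<theta> - \<delta>) \<le> norm (\<theta> - x) + A" for \<theta>
      using A(2)[OF gx x] norm_triangle_ineq4[of "\<theta> - x" "\<delta> - x"] by (simp add: \<delta>_def)
    have "M * z = norm (\<integral>\<theta>. v \<theta> \<partial>lborel)" using v pos by (simp add: M_def z_def)
    also have "\<dots> \<le> (\<integral>\<theta>. norm (v \<theta>) \<partial>lborel)" by (rule integral_norm_bound)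
    also have "\<dots> \<le> (\<integral>\<theta>. C2 * (g x * hx * Dx) * (k x \<theta> * (norm (\<theta> - x))\<^sup>2 + A * (k x \<theta> * norm (\<theta> - x)))
        + (1 + A) * C1 * N x powr (- a) * (g \<theta> * (1 + N \<theta>) powr (- b)) \<partial>lborel)"
    proof (rule integral_mono)
      show "integrable lborel (\<lambda>\<theta>. norm (v \<theta>))" using v(1) by (rule integrable_norm)
      show "integrable lborel (\<lambda>\<theta>. C2 * (g x * hx * Dx) * (k x \<theta> * (norm (\<theta> - x))\<^sup>2 + A * (k x \<theta> * norm (\<theta> - x)))
        + (1 + A) * C1 * N x powr (- a) * (g \<theta> * (1 + N \<theta>) powr (- b)))"
        using k_moments(1-6)[of x] J(1) by auto
      fix \<theta>
      let ?t = "norm (\<theta> - x)" and ?d = "\<bar>(h i (N \<theta>))\<^sup>2 - (h i (N x))\<^sup>2\<bar>"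
      have nn: "0 \<le> C2 * (g x * hx * Dx) * (k x \<theta> * ?t\<^sup>2 + A * (k x \<theta> * ?t))"
        "0 \<le> (1 + A) * C1 * N x powr (- a) * (g \<theta> * (1 + N \<theta>) powr (- b))"
        using C2 pos A(1) C1 less_imp_le[OF g_pos] by auto
      have "norm (v \<theta>) = k x \<theta> * g \<theta> * ?d * norm (\<theta> - \<delta>)"
        using less_imp_le[OF g_pos[of \<theta>]] by (simp add: v_def abs_mult)
      also have "\<dots> \<le> k x \<theta> * g \<theta> * ?d * (?t + A)"
        using less_imp_le[OF g_pos[of \<theta>]] by (intro mult_left_mono \<delta>x) auto
      finally have le: "norm (v \<theta>) \<le> k x \<theta> * g \<theta> * ?d * (?t + A)" .
      show "norm (v \<theta>) \<le> C2 * (g x * hx * Dx) * (k x \<theta> * ?t\<^sup>2 + A * (k x \<theta> * ?t))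
        + (1 + A) * C1 * N x powr (- a) * (g \<theta> * (1 + N \<theta>) powr (- b))"
      proof (cases "N (\<theta> - x) \<le> N x / 2")
        case True
        have "k x \<theta> * g \<theta> * ?d * (?t + A) = (g \<theta> * ?d) * (k x \<theta> * (?t + A))" by simp
        also have "\<dots> \<le> ((C * g x) * (C * (C + 1) * \<kappa> * (hx * Dx) * ?t)) * (k x \<theta> * (?t + A))"
          using G_near(1)[OF x True] h_square_difference[OF x True, of i] pos C A(1)
          by (intro mult_right_mono mult_mono) (auto simp: hx_def Dx_def)
        also have "\<dots> = C2 * (g x * hx * Dx) * (k x \<theta> * ?t\<^sup>2 + A * (k x \<theta> * ?t))"
          by (simp add: C2_def power2_eq_square algebra_simps)
        finally show ?thesis using le nn by linarith
      next
        case False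
        \<comment> \<open>A distance of at least 1 absorbs \<open>A\<close>: the sum
          \<open>?t + A\<close> is at most \<open>(1 + A) * ?t\<close>.\<close>
        have t1: "1 \<le> ?t" using far_distance(1)[OF x, of \<theta>] False r0 k_moments(8) by linarith
        have "(h i (N \<theta>))\<^sup>2 \<le> 1" "(h i (N x))\<^sup>2 \<le> 1"
          using h_pos h_le_1 by (auto intro!: power_le_one simp: less_imp_le)
        then have d1: "?d \<le> 1" using zero_le_power2[of "h i (N \<theta>)"] zero_le_power2[of "h i (N x)"] by linarith
        have "k x \<theta> * g \<theta> * ?d * (?t + A) \<le> k x \<theta> * g \<theta> * 1 * ((1 + A) * ?t)"
          using d1 t1 A(1) less_imp_le[OF g_pos[of \<theta>]] mult_left_mono[OF t1 A(1)]
          by (intro mult_mono mult_left_mono) (auto simp: algebra_simps)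
        also have "\<dots> = (1 + A) * (g \<theta> * (k x \<theta> * ?t))" by simp
        also have "\<dots> \<le> (1 + A) * (g \<theta> * (C1 * N x powr (- a) * (1 + N \<theta>) powr (- b)))"
          using A(1) less_imp_le[OF g_pos[of \<theta>]] False by (intro mult_left_mono far_kernel[OF x]) auto
        also have "\<dots> = (1 + A) * C1 * N x powr (- a) * (g \<theta> * (1 + N \<theta>) powr (- b))" by simp
        finally show ?thesis using le nn by linarith
      qed
    qed
    also have "\<dots> = C2 * (g x * hx * Dx) * (m2 + A * m1) + (1 + A) * C1 * N x powr (- a) * J"
      using k_moments(1-6)[of x] J(1) by (simp add: J_def)
    also have "\<dots> = C3 * (g x * hx * Dx) + C4 * N x powr (- a)" by (simp add: C3_def C4_def)
    finally have Mz: "M * z \<le> C3 * (g x * hx * Dx) + C4 * N x powr (- a)" .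
    have z: "0 \<le> z" by (simp add: z_def)
    define u1 where "u1 = C3 * (g x * hx * Dx)"
    define u2 where "u2 = C4 * N x powr (- a)"
    have "(M * z)\<^sup>2 \<le> (u1 + u2)\<^sup>2" using Mz pos z by (intro power_mono) (auto simp: u1_def u2_def)
    also have "\<dots> \<le> 2 * u1\<^sup>2 + 2 * u2\<^sup>2" using sum_squares_bound[of u1 u2] by (simp add: power2_sum)
    finally have sq: "(M * z)\<^sup>2 \<le> 2 * u1\<^sup>2 + 2 * u2\<^sup>2" .
    have wx: "0 < w i x" by (rule w_pos)
    have "M * z\<^sup>2 = (M * z)\<^sup>2 / M" using pos by (simp add: power2_eq_square)
    also have "\<dots> \<le> (2 * u1\<^sup>2 + 2 * u2\<^sup>2) / (w i x / C ^ 3 / 2)"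
      using sq Mlow pos wx C by (intro frac_le) auto
    also have "\<dots> = 4 * C ^ 3 * (u1\<^sup>2 / w i x) + 4 * C ^ 3 * (u2\<^sup>2 / w i x)"
      using C wx by (simp add: field_simps)
    also have "u1\<^sup>2 / w i x = C3\<^sup>2 * (g x * Dx\<^sup>2)"
      using pos by (simp add: u1_def w_def hx_def[symmetric] power2_eq_square)
    also have "u2\<^sup>2 / w i x = C4\<^sup>2 * (N x powr (- (2 * a)) / w i x)"
    proof -
      have "(N x powr (- a))\<^sup>2 = N x powr (- (2 * a))" unfolding power2_eq_square powr_add[symmetric] by simp
      then show ?thesis by (simp add: u2_def power_mult_distrib)
    qed
    also have "4 * C ^ 3 * (C3\<^sup>2 * (g x * Dx\<^sup>2)) + 4 * C ^ 3 * (C4\<^sup>2 * (N x powr (- (2 * a)) / w i x)) \<le>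
        4 * C ^ 3 * (C3\<^sup>2 * (g x * Dx\<^sup>2)) + 4 * C ^ 3 * (C4\<^sup>2 * (4 powr e / c ^ 3 * N x powr (- (2 * a + t1 - 2 * e))))"
      using C w_lower[OF x, of i] by (intro add_left_mono mult_left_mono) auto
    also have "\<dots> = (4 * C ^ 3 * C3\<^sup>2) * (g x * Dx\<^sup>2) + (4 * C ^ 3 * C4\<^sup>2 * (4 powr e / c ^ 3)) * N x powr (- (2 * a + t1 - 2 * e))"
      by simp
    also have "\<dots> \<le> K * (g x * Dx\<^sup>2) + K * N x powr (- (2 * a + t1 - 2 * e))"
      using pos C c by (intro add_mono mult_right_mono) (auto simp: K_def)
    also have "\<dots> = K * (g x * Dx\<^sup>2 + N x powr (- (2 * a + t1 - 2 * e)))" by (simp add: distrib_left)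
    finally show ?thesis by (simp add: M_def z_def \<delta>_def Dx_def)
  qed
  with K show ?thesis by (rule that)
qed

section \<open>Finite Bayes risk and passage to the limit\<close>

lemma S_le: "good x \<Longrightarrow> ennreal (S x) \<le> (\<integral>\<^sup>+\<theta>. ennreal (k x \<theta> * g \<theta> * (1 + (norm (\<theta> - x))\<^sup>2)) \<partial>lborel)"
proof -
  assume x: "good x"
  have "ennreal (S x) = (\<integral>\<^sup>+\<theta>. ennreal (k x \<theta> * g \<theta> * (norm (\<theta> - x))\<^sup>2) \<partial>lborel)"
    unfolding S_def using good_integrable(3)[OF x weight_g] less_imp_le[OF g_pos]
    by (intro nn_integral_eq_integral[symmetric]) auto
  also have "\<dots> \<le> (\<integral>\<^sup>+\<theta>. ennreal (k x \<theta> * g \<theta> * (1 + (norm (\<theta> - x))\<^sup>2)) \<partial>lborel)"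
    using less_imp_le[OF g_pos] by (intro nn_integral_mono ennreal_leI mult_left_mono) auto
  finally show ?thesis .
qed

lemma nn_integral_marginal: "(\<integral>\<^sup>+x. ennreal (marginal f (w i) x) \<partial>lborel) = (\<integral>\<^sup>+\<theta>. ennreal (w i \<theta>) \<partial>lborel)"
proof -
  have "(\<integral>\<^sup>+x. ennreal (marginal f (w i) x) \<partial>lborel) = (\<integral>\<^sup>+x. (\<integral>\<^sup>+\<theta>. ennreal (k x \<theta> * w i \<theta>) \<partial>lborel) \<partial>lborel)"
  proof (intro nn_integral_cong_AE, use AE_good in eventually_elim)
    case (elim x)
    then show ?case unfolding marginal_def
      using good_integrable(1)[OF elim weight_w] less_imp_le[OF w_pos] by (intro nn_integral_eq_integral[symmetric]) auto
  qed
  also have "\<dots> = (\<integral>\<^sup>+\<theta>. (\<integral>\<^sup>+x. ennreal (k x \<theta> * w i \<theta>) \<partial>lborel) \<partial>lborel)"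
    by (rule lborel_pair.Fubini'[symmetric]) (simp add: case_prod_beta')
  also have "\<dots> = (\<integral>\<^sup>+\<theta>. ennreal (w i \<theta>) \<partial>lborel)"
    using less_imp_le[OF w_pos] by (intro nn_integral_cong) (simp add: ennreal_mult nn_integral_multc nn_integral_k_x)
  finally show ?thesis .
qed

lemma nn_integral_k_square:
  "(\<integral>\<^sup>+x. (\<integral>\<^sup>+\<theta>. ennreal (k x \<theta> * w i \<theta> * (norm (\<theta> - x))\<^sup>2) \<partial>lborel) \<partial>lborel) < \<infinity>"
proof -
  have "(\<integral>\<^sup>+x. (\<integral>\<^sup>+\<theta>. ennreal (k x \<theta> * w i \<theta> * (norm (\<theta> - x))\<^sup>2) \<partial>lborel) \<partial>lborel) =
      (\<integral>\<^sup>+\<theta>. (\<integral>\<^sup>+x. ennreal (k x \<theta> * w i \<theta> * (norm (\<theta> - x))\<^sup>2) \<partial>lborel) \<partial>lborel)"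
    by (rule lborel_pair.Fubini'[symmetric]) (simp add: case_prod_beta')
  also have "\<dots> = (\<integral>\<^sup>+\<theta>. ennreal (w i \<theta>) * (\<integral>\<^sup>+y. ennreal (f (norm (y :: real^'n)) * (norm y)\<^sup>2) \<partial>lborel) \<partial>lborel)"
  proof (rule nn_integral_cong)
    fix \<theta>
    have "(\<integral>\<^sup>+x. ennreal (k x \<theta> * w i \<theta> * (norm (\<theta> - x))\<^sup>2) \<partial>lborel) = (\<integral>\<^sup>+x. ennreal (w i \<theta>) * ennreal (k x \<theta> * (norm (x - \<theta>))\<^sup>2) \<partial>lborel)"
      using less_imp_le[OF w_pos] by (intro nn_integral_cong) (simp add: ennreal_mult norm_minus_commute mult_ac)
    also have "\<dots> = ennreal (w i \<theta>) * (\<integral>\<^sup>+x. ennreal (k x \<theta> * (norm (x - \<theta>))\<^sup>2) \<partial>lborel)"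
      by (rule nn_integral_cmult) measurable
    finally show "(\<integral>\<^sup>+x. ennreal (k x \<theta> * w i \<theta> * (norm (\<theta> - x))\<^sup>2) \<partial>lborel) =
        ennreal (w i \<theta>) * (\<integral>\<^sup>+y. ennreal (f (norm (y :: real^'n)) * (norm y)\<^sup>2) \<partial>lborel)"
      using nn_integral_translate[of "\<lambda>y. ennreal (f (norm y) * (norm y)\<^sup>2)" \<theta>] by simp
  qed
  also have "\<dots> = (\<integral>\<^sup>+\<theta>. ennreal (w i \<theta>) \<partial>lborel) * (\<integral>\<^sup>+y. ennreal (f (norm (y :: real^'n)) * (norm y)\<^sup>2) \<partial>lborel)"
    by (rule nn_integral_multc) measurable
  also have "\<dots> < \<infinity>" using Gh_int[of i] f_moment by (simp add: ennreal_mult_less_top w_def g_def)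
  finally show ?thesis .
qed

lemma gen_bayes_g_meas [measurable]: "gen_bayes f g \<in> borel_measurable borel" "gen_bayes f (w i) \<in> borel_measurable borel"
  "marginal f (w i) \<in> borel_measurable borel"
  using gen_bayes_measurable[OF f_meas g_meas] gen_bayes_measurable[OF f_meas w_meas] marginal_measurable[OF f_meas w_meas] by auto

text \<open>Comparing \<theta> and the estimator with \<open>x\<close> separately leaves three
  finite quantities: the second moment of \<open>f\<close> times the mass of \<open>w i\<close>, the
  bound \<open>A\<^sup>2\<close> times the same mass far from the origin, and the local second
  moment near it.\<close>

lemma finite_Bayes_risk:
  assumes Q: "positive_definite Q"
  shows "(\<integral>\<^sup>+\<theta>. ennreal (w i \<theta>) * risk f Q \<theta> (gen_bayes f g) \<partial>lborel) < \<infinity>"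
proof -
  obtain A where A: "0 \<le> A" "\<And>x. good x \<Longrightarrow> R1 \<le> N x \<Longrightarrow> norm (gen_bayes f g x - x) \<le> A"
    using gen_bayes_bounded by blast
  obtain q where q: "0 \<le> q" "\<And>a b. quadratic_loss Q a b \<le> q * (norm (a - b))\<^sup>2"
    using quadratic_loss_le[of Q] by blast
  let ?I = "indicator {x. N x \<le> R1} :: real^'n \<Rightarrow> ennreal"
  let ?T = "\<lambda>x. \<integral>\<^sup>+\<theta>. ennreal (k x \<theta> * g \<theta> * (1 + (norm (\<theta> - x))\<^sup>2)) \<partial>lborel"
  let ?U = "\<lambda>x. \<integral>\<^sup>+\<theta>. ennreal (k x \<theta> * w i \<theta> * (norm (\<theta> - x))\<^sup>2) \<partial>lborel"
  have [measurable]: "?T \<in> borel_measurable borel" "?U \<in> borel_measurable borel" "{x. N x \<le> R1} \<in> sets borel"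
    by measurable
  have "(\<integral>\<^sup>+\<theta>. ennreal (w i \<theta>) * risk f Q \<theta> (gen_bayes f g) \<partial>lborel) =
    (\<integral>\<^sup>+x. \<integral>\<^sup>+\<theta>. ennreal (k x \<theta> * w i \<theta> * quadratic_loss Q \<theta> (gen_bayes f g x)) \<partial>lborel \<partial>lborel)"
    using less_imp_le[OF w_pos] by (intro nn_integral_risk[OF Q]) (auto simp: f_nonneg)
  also have "\<dots> \<le> (\<integral>\<^sup>+x. ennreal (2 * q) * ?U x + (ennreal (2 * q * A\<^sup>2) * ennreal (marginal f (w i) x) + ennreal (2 * q) * (?T x * ?I x)) \<partial>lborel)"
  proof (intro nn_integral_mono_AE, use AE_good in eventually_elim)
    case (elim x)
    let ?\<delta> = "gen_bayes f g x" and ?M = "marginal f (w i) x"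
    have M: "0 < ?M" "?M \<le> marginal f g x"
      using marginal_pos[OF elim weight_w] marginal_mono[OF elim weight_w weight_g w_le_g] by auto
    have "(\<integral>\<^sup>+\<theta>. ennreal (k x \<theta> * w i \<theta> * quadratic_loss Q \<theta> ?\<delta>) \<partial>lborel) \<le>
      (\<integral>\<^sup>+\<theta>. ennreal (2 * q) * ennreal (k x \<theta> * w i \<theta> * (norm (\<theta> - x))\<^sup>2) +
        ennreal (2 * q * (norm (?\<delta> - x))\<^sup>2) * ennreal (k x \<theta> * w i \<theta>) \<partial>lborel)"
    proof (rule nn_integral_mono)
      fix \<theta>
      have "(norm (\<theta> - ?\<delta>))\<^sup>2 \<le> (norm (\<theta> - x) + norm (?\<delta> - x))\<^sup>2"
        using norm_triangle_ineq4[of "\<theta> - x" "?\<delta> - x"] by (intro power_mono) auto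
      also have "\<dots> \<le> 2 * (norm (\<theta> - x))\<^sup>2 + 2 * (norm (?\<delta> - x))\<^sup>2"
        using sum_squares_bound[of "norm (\<theta> - x)" "norm (?\<delta> - x)"] by (simp add: power2_sum)
      finally have "q * (norm (\<theta> - ?\<delta>))\<^sup>2 \<le> q * (2 * (norm (\<theta> - x))\<^sup>2 + 2 * (norm (?\<delta> - x))\<^sup>2)"
        using q(1) by (rule mult_left_mono)
      then have "quadratic_loss Q \<theta> ?\<delta> \<le> q * (2 * (norm (\<theta> - x))\<^sup>2 + 2 * (norm (?\<delta> - x))\<^sup>2)"
        using q(2)[of \<theta> ?\<delta>] by linarith
      then have "k x \<theta> * w i \<theta> * quadratic_loss Q \<theta> ?\<delta> \<le> k x \<theta> * w i \<theta> * (q * (2 * (norm (\<theta> - x))\<^sup>2 + 2 * (norm (?\<delta> - x))\<^sup>2))"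
        using less_imp_le[OF w_pos] by (intro mult_left_mono) auto
      then have "ennreal (k x \<theta> * w i \<theta> * quadratic_loss Q \<theta> ?\<delta>) \<le>
          ennreal (2 * q * (k x \<theta> * w i \<theta> * (norm (\<theta> - x))\<^sup>2) + 2 * q * (norm (?\<delta> - x))\<^sup>2 * (k x \<theta> * w i \<theta>))"
        by (intro ennreal_leI) (simp add: algebra_simps)
      also have "\<dots> = ennreal (2 * q) * ennreal (k x \<theta> * w i \<theta> * (norm (\<theta> - x))\<^sup>2) +
          ennreal (2 * q * (norm (?\<delta> - x))\<^sup>2) * ennreal (k x \<theta> * w i \<theta>)"
        using q(1) less_imp_le[OF w_pos[of i \<theta>]] by (subst ennreal_plus) (auto simp: ennreal_mult)
      finally show "ennreal (k x \<theta> * w i \<theta> * quadratic_loss Q \<theta> ?\<delta>) \<le>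
          ennreal (2 * q) * ennreal (k x \<theta> * w i \<theta> * (norm (\<theta> - x))\<^sup>2) +
          ennreal (2 * q * (norm (?\<delta> - x))\<^sup>2) * ennreal (k x \<theta> * w i \<theta>)" .
    qed
    also have "\<dots> = ennreal (2 * q) * ?U x + ennreal (2 * q * (norm (?\<delta> - x))\<^sup>2) * (\<integral>\<^sup>+\<theta>. ennreal (k x \<theta> * w i \<theta>) \<partial>lborel)"
      by (subst nn_integral_add; (subst nn_integral_cmult)?; measurable?) (simp add: nn_integral_cmult)
    also have "(\<integral>\<^sup>+\<theta>. ennreal (k x \<theta> * w i \<theta>) \<partial>lborel) = ennreal ?M"
      unfolding marginal_def
      using good_integrable(1)[OF elim weight_w] less_imp_le[OF w_pos] by (intro nn_integral_eq_integral) auto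
    also have "ennreal (2 * q * (norm (?\<delta> - x))\<^sup>2) * ennreal ?M \<le>
        ennreal (2 * q * A\<^sup>2) * ennreal ?M + ennreal (2 * q) * (?T x * ?I x)"
    proof (cases "N x \<le> R1")
      case True
      have "ennreal (2 * q * (norm (?\<delta> - x))\<^sup>2) * ennreal ?M = ennreal (2 * q) * ennreal (?M * (norm (?\<delta> - x))\<^sup>2)"
        using q(1) M by (simp add: ennreal_mult mult_ac)
      also have "ennreal (?M * (norm (?\<delta> - x))\<^sup>2) \<le> ennreal (S x)"
        using marginal_Jensen[OF elim weight_g] mult_right_mono[OF M(2), of "(norm (?\<delta> - x))\<^sup>2"] by (intro ennreal_leI) auto
      also have "\<dots> \<le> ?T x" by (rule S_le[OF elim])
      finally have "ennreal (2 * q * (norm (?\<delta> - x))\<^sup>2) * ennreal ?M \<le> ennreal (2 * q) * ?T x" by (simp add: mult_left_mono)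
      also have "\<dots> \<le> ennreal (2 * q * A\<^sup>2) * ennreal ?M + ennreal (2 * q) * (?T x * ?I x)" using True by simp
      finally show ?thesis .
    next
      case False
      then have "(norm (?\<delta> - x))\<^sup>2 \<le> A\<^sup>2" using A(2)[OF elim] by (intro power_mono) auto
      then have "ennreal (2 * q * (norm (?\<delta> - x))\<^sup>2) * ennreal ?M \<le> ennreal (2 * q * A\<^sup>2) * ennreal ?M"
        using q(1) by (intro mult_right_mono ennreal_leI mult_left_mono) auto
      also have "\<dots> \<le> ennreal (2 * q * A\<^sup>2) * ennreal ?M + ennreal (2 * q) * (?T x * ?I x)" by simp
      finally show ?thesis .
    qed
    finally show ?case by (simp add: add_left_mono)
  qed
  also have "\<dots> = ennreal (2 * q) * (\<integral>\<^sup>+x. ?U x \<partial>lborel) +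
      (ennreal (2 * q * A\<^sup>2) * (\<integral>\<^sup>+x. ennreal (marginal f (w i) x) \<partial>lborel) + ennreal (2 * q) * (\<integral>\<^sup>+x. ?T x * ?I x \<partial>lborel))"
    by (simp add: nn_integral_add nn_integral_cmult)
  also have "\<dots> < \<infinity>"
    unfolding nn_integral_marginal using nn_integral_k_square[of i] local_second_moment[of R1] Gh_int[of i]
    by (simp add: ennreal_mult_less_top w_def g_def)
  finally show ?thesis .
qed

theorem gen_bayes_admissible:
  assumes Q: "positive_definite Q"
  shows "admissible_estimator f Q (gen_bayes f g)"
proof (rule blyth_admissible[where w=w])
  show "AE x in lborel. integrable lborel (\<lambda>\<theta>. k x \<theta> * w i \<theta>) \<and> integrable lborel (\<lambda>\<theta>. k x \<theta> * w i \<theta> * (norm \<theta>)\<^sup>2)" for i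
    using AE_good by eventually_elim (simp add: good_integrable weight_w)
  show "AE x in lborel. 0 < marginal f (w 0) x \<and> marginal f (w 0) x \<le> marginal f (w i) x" for i
    using AE_good by eventually_elim (simp add: marginal_pos marginal_mono weight_w w_0_le)
  obtain K where K: "0 \<le> K" "\<And>i x. good x \<Longrightarrow> R1 \<le> N x \<Longrightarrow>
    marginal f (w i) x * (norm (gen_bayes f (w i) x - gen_bayes f g x))\<^sup>2 \<le>
    K * (g x * (D (N x))\<^sup>2 + N x powr (- (2 * a + t1 - 2 * e)))"
    using deviation_far by blast
  obtain q where q: "0 \<le> q" "\<And>a b. quadratic_loss Q a b \<le> q * (norm (a - b))\<^sup>2"
    using quadratic_loss_le[of Q] by blast
  let ?I = "indicator {x. N x \<le> R1} :: real^'n \<Rightarrow> ennreal"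
  let ?I' = "indicator {x. 1 \<le> N x} :: real^'n \<Rightarrow> ennreal"
  let ?T = "\<lambda>x. \<integral>\<^sup>+\<theta>. ennreal (k x \<theta> * g \<theta> * (1 + (norm (\<theta> - x))\<^sup>2)) \<partial>lborel"
  let ?E = "2 * a + t1 - 2 * e"
  \<comment> \<open>The majorant for dominated convergence, independent of \<open>i\<close>. Its
    first term comes from \<open>deviation_local\<close>; the other two come from
    \<open>deviation_far\<close> and live on \<open>1 \<le> N x\<close>, which contains the region
    beyond \<open>R1\<close>.\<close>
  define W where "W x = ennreal (4 * q) * (?T x * ?I x) + (ennreal (q * K) * (ennreal (g x * (D (N x))\<^sup>2) * ?I' x) +
    ennreal (q * K) * (ennreal (N x powr (- ?E)) * ?I' x))" for x
  have [measurable]: "?T \<in> borel_measurable borel" "{x. N x \<le> R1} \<in> sets borel" "{x. 1 \<le> N x} \<in> sets borel"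
    by measurable
  have [measurable]: "W \<in> borel_measurable borel" unfolding W_def by measurable
  have Wfin: "(\<integral>\<^sup>+x. W x \<partial>lborel) < \<infinity>"
    unfolding W_def using local_second_moment[of R1] GD_int power_int[of ?E] b(4)
    by (simp add: nn_integral_add nn_integral_cmult ennreal_mult_less_top g_def)
  have dom: "ennreal (marginal f (w i) x * quadratic_loss Q (gen_bayes f (w i) x) (gen_bayes f g x)) \<le> W x" if x: "good x" for i x
  proof -
    let ?dev = "marginal f (w i) x * (norm (gen_bayes f (w i) x - gen_bayes f g x))\<^sup>2"
    have M: "0 < marginal f (w i) x" by (rule marginal_pos[OF x weight_w])
    have "marginal f (w i) x * quadratic_loss Q (gen_bayes f (w i) x) (gen_bayes f g x) \<le>
        marginal f (w i) x * (q * (norm (gen_bayes f (w i) x - gen_bayes f g x))\<^sup>2)"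
      using M q(2) by (intro mult_left_mono) auto
    then have le: "ennreal (marginal f (w i) x * quadratic_loss Q (gen_bayes f (w i) x) (gen_bayes f g x)) \<le> ennreal (q * ?dev)"
      by (intro ennreal_leI) (simp add: mult_ac)
    also have "\<dots> \<le> W x"
    proof (cases "N x \<le> R1")
      case True
      have "ennreal (q * ?dev) \<le> ennreal (4 * q * S x)"
        using deviation_local[OF x, of i] q(1) mult_left_mono[of ?dev "4 * S x" q] by (intro ennreal_leI) simp
      also have "\<dots> = ennreal (4 * q) * ennreal (S x)" using q(1) by (simp add: ennreal_mult')
      also have "\<dots> \<le> ennreal (4 * q) * ?T x" by (intro mult_left_mono S_le[OF x]) auto
      also have "\<dots> \<le> W x" using True by (simp add: W_def)
      finally show ?thesis .
    next
      case False
      then have "ennreal (q * ?dev) \<le> ennreal (q * (K * (g x * (D (N x))\<^sup>2 + N x powr (- ?E))))"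
        using K(2)[OF x, of i] q(1) by (intro ennreal_leI mult_left_mono) auto
      also have "\<dots> = ennreal (q * K * (g x * (D (N x))\<^sup>2) + q * K * N x powr (- ?E))" by (simp add: algebra_simps)
      also have "\<dots> = ennreal (q * K) * ennreal (g x * (D (N x))\<^sup>2) + ennreal (q * K) * ennreal (N x powr (- ?E))"
        using q(1) K(1) less_imp_le[OF g_pos[of x]] by (subst ennreal_plus) (auto simp: ennreal_mult)
      also have "\<dots> \<le> W x" using False R1(2) by (simp add: W_def)
      finally show ?thesis .
    qed
    finally show ?thesis .
  qed
  have lim: "(\<lambda>i. ennreal (marginal f (w i) x * quadratic_loss Q (gen_bayes f (w i) x) (gen_bayes f g x))) \<longlonglongrightarrow> 0" if x: "good x" for x
  proof -
    have "(\<lambda>i. marginal f (w i) x * (q * (norm (gen_bayes f (w i) x - gen_bayes f g x))\<^sup>2)) \<longlonglongrightarrow>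
        marginal f g x * (q * (norm (gen_bayes f g x - gen_bayes f g x))\<^sup>2)"
      by (intro tendsto_intros gen_bayes_limit[OF x])
    then have up: "(\<lambda>i. marginal f (w i) x * (q * (norm (gen_bayes f (w i) x - gen_bayes f g x))\<^sup>2)) \<longlonglongrightarrow> 0" by simp
    have "(\<lambda>i. marginal f (w i) x * quadratic_loss Q (gen_bayes f (w i) x) (gen_bayes f g x)) \<longlonglongrightarrow> 0"
    proof (rule tendsto_sandwich[OF _ _ tendsto_const up])
      show "\<forall>\<^sub>F i in sequentially. 0 \<le> marginal f (w i) x * quadratic_loss Q (gen_bayes f (w i) x) (gen_bayes f g x)"
        using less_imp_le[OF marginal_pos[OF x weight_w]] quadratic_loss_nonneg[OF Q] by (intro always_eventually) auto
      show "\<forall>\<^sub>F i in sequentially. marginal f (w i) x * quadratic_loss Q (gen_bayes f (w i) x) (gen_bayes f g x)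
          \<le> marginal f (w i) x * (q * (norm (gen_bayes f (w i) x - gen_bayes f g x))\<^sup>2)"
        using less_imp_le[OF marginal_pos[OF x weight_w]] q(2) by (intro always_eventually allI mult_left_mono) auto
    qed
    from tendsto_ennrealI[OF this] show ?thesis by simp
  qed
  have "(\<lambda>i. \<integral>\<^sup>+x. ennreal (marginal f (w i) x * quadratic_loss Q (gen_bayes f (w i) x) (gen_bayes f g x)) \<partial>lborel)
      \<longlonglongrightarrow> (\<integral>\<^sup>+x. 0 \<partial>(lborel :: (real^'n) measure))"
  proof (rule nn_integral_dominated_convergence[where w=W])
    show "AE x in lborel. ennreal (marginal f (w i) x * quadratic_loss Q (gen_bayes f (w i) x) (gen_bayes f g x)) \<le> W x" for i
      using AE_good by eventually_elim (rule dom)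
    show "AE x in lborel. (\<lambda>i. ennreal (marginal f (w i) x * quadratic_loss Q (gen_bayes f (w i) x) (gen_bayes f g x))) \<longlonglongrightarrow> 0"
      using AE_good by eventually_elim (rule lim)
  qed (use Wfin in auto)
  then show "(\<lambda>i. \<integral>\<^sup>+x. ennreal (marginal f (w i) x * quadratic_loss Q (gen_bayes f (w i) x) (gen_bayes f g x)) \<partial>lborel) \<longlonglongrightarrow> 0"
    by simp
qed (use Q finite_Bayes_risk[OF Q] less_imp_le[OF w_pos] f_nonneg in auto)

end

section \<open>Admissibility\<close>

text \<open>Exhibits \<open>norm_d\<close> as the Euclidean norm after a diagonal scaling, from
  which homogeneity and the reverse triangle inequality are inherited.\<close>

lemma norm_d_eq_norm: "norm_d d x = norm (\<chi> i. d $ i * x $ i)"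
  by (simp add: norm_d_def norm_vec_def L2_set_def power_mult_distrib)

lemma norm_d_properties:
  fixes d :: "real^'n"
  assumes d: "\<forall>i. 1 \<le> d $ i"
  shows "norm_d d \<in> borel_measurable borel"
    and "\<And>c x. 0 < c \<Longrightarrow> norm_d d (c *\<^sub>R x) = c * norm_d d x"
    and "norm x \<le> norm_d d x"
    and "norm_d d x \<le> (\<Sum>i\<in>UNIV. d $ i) * norm x"
    and "\<bar>norm_d d x - norm_d d y\<bar> \<le> norm_d d (x - y)"
proof -
  show "norm_d d \<in> borel_measurable borel"
    unfolding norm_d_def[abs_def] by (intro borel_measurable_continuous_onI continuous_intros)
  show "norm_d d (c *\<^sub>R x) = c * norm_d d x" if "0 < c" for c x
  proof -
    have "(\<chi> i. d $ i * (c *\<^sub>R x) $ i) = c *\<^sub>R (\<chi> i. d $ i * x $ i)" by (simp add: vec_eq_iff)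
    then show ?thesis using that by (simp add: norm_d_eq_norm)
  qed
  have nx: "norm x = sqrt (\<Sum>i\<in>UNIV. (x $ i)\<^sup>2)" for x :: "real^'n"
    by (simp add: norm_vec_def L2_set_def)
  show "norm x \<le> norm_d d x"
    unfolding nx norm_d_def
  proof (intro real_sqrt_le_mono sum_mono)
    fix i
    have "1 \<le> (d $ i)\<^sup>2" using d by (simp add: one_le_power)
    then show "(x $ i)\<^sup>2 \<le> (d $ i)\<^sup>2 * (x $ i)\<^sup>2" by (simp add: mult_le_cancel_right1)
  qed
  let ?k = "\<Sum>i\<in>UNIV. d $ i"
  have d0: "0 \<le> d $ i" for i using d[rule_format, of i] by linarith
  have "norm_d d x \<le> sqrt (\<Sum>i\<in>UNIV. ?k\<^sup>2 * (x $ i)\<^sup>2)"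
    unfolding norm_d_def
    using d0 by (intro real_sqrt_le_mono sum_mono mult_right_mono power_mono member_le_sum) auto
  also have "\<dots> = ?k * norm x"
    using d0 by (simp add: nx sum_distrib_left[symmetric] real_sqrt_mult sum_nonneg)
  finally show "norm_d d x \<le> ?k * norm x" .
  have "(\<chi> i. d $ i * (x - y) $ i) = (\<chi> i. d $ i * x $ i) - (\<chi> i. d $ i * y $ i)"
    by (simp add: vec_eq_iff right_diff_distrib)
  then show "\<bar>norm_d d x - norm_d d y\<bar> \<le> norm_d d (x - y)"
    by (simp add: norm_d_eq_norm norm_triangle_ineq3)
qed

text \<open>Permits changing the prior at the origin, where \<open>G 0\<close> is arbitrary. The
  integrals do not see the change, so the estimators agree at every \<open>x\<close>.\<close>

lemma gen_bayes_cong_AE: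
  fixes w w' :: "real^'n \<Rightarrow> real"
  assumes f: "(\<lambda>y. f (norm (y :: real^'n))) \<in> borel_measurable borel"
    and [measurable]: "w \<in> borel_measurable borel" "w' \<in> borel_measurable borel" and eq: "AE \<theta> in lborel. w \<theta> = w' \<theta>"
  shows "gen_bayes f w = gen_bayes f w'"
proof
  fix x :: "real^'n"
  have [measurable]: "(\<lambda>\<theta>. f (norm (x - \<theta>))) \<in> borel_measurable borel"
    using measurable_compose[of "\<lambda>\<theta>. x - \<theta>" borel borel, OF _ f] by simp
  have "(\<integral>\<theta>. (f (norm (x - \<theta>)) * w \<theta>) *\<^sub>R \<theta> \<partial>lborel) = (\<integral>\<theta>. (f (norm (x - \<theta>)) * w' \<theta>) *\<^sub>R \<theta> \<partial>lborel)"
  proof (rule integral_cong_AE)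
    show "AE \<theta> in lborel. (f (norm (x - \<theta>)) * w \<theta>) *\<^sub>R \<theta> = (f (norm (x - \<theta>)) * w' \<theta>) *\<^sub>R \<theta>"
      using eq by eventually_elim simp
  qed measurable
  moreover have "(\<integral>\<theta>. f (norm (x - \<theta>)) * w \<theta> \<partial>lborel) = (\<integral>\<theta>. f (norm (x - \<theta>)) * w' \<theta> \<partial>lborel)"
  proof (rule integral_cong_AE)
    show "AE \<theta> in lborel. f (norm (x - \<theta>)) * w \<theta> = f (norm (x - \<theta>)) * w' \<theta>"
      using eq by eventually_elim simp
  qed measurable
  ultimately show "gen_bayes f w x = gen_bayes f w' x" by (simp add: gen_bayes_def)
qed

lemma admissible_gen_bayes_radial:
  fixes f G \<beta> :: "real \<Rightarrow> real" and d :: "real^'n" and Q :: "real^'n^'n"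
  assumes d: "\<forall>i. 1 \<le> d $ i"
    and Q: "positive_definite Q"
    and f: "radial_density f TYPE(real^'n)"
    and G: "\<forall>\<eta>>0. 0 < G \<eta>"
    and \<beta>: "beta_function \<beta>"
    and G1: "cond_G1 G t1 t2"
    and G2: "cond_G2 CARD('n) \<beta> G \<gamma>"
    and G3: "cond_G3 CARD('n) G"
    and F1: "cond_F1 CARD('n) f s"
    and s: "3 < s" "3 + \<gamma> - t1 - real CARD('n) < s"
  shows "admissible_estimator f Q (gen_bayes f (\<lambda>\<theta>. G (norm_d d \<theta>)))"
proof -
  define p where "p = real CARD('n)"
  have p: "1 \<le> p" by (simp add: p_def Suc_leI)
  define N where "N = norm_d d"
  note N = norm_d_properties[OF d, folded N_def]
  define \<kappa> where "\<kappa> = (\<Sum>i\<in>UNIV. d $ i)"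
  \<comment> \<open>\<open>G 0\<close> is arbitrary; a positive value there makes the prior positive everywhere.\<close>
  define G0 where "G0 \<eta> = (if \<eta> \<in> {0<..} then G \<eta> else 1)" for \<eta>
  have G0pos: "0 < G0 \<eta>" for \<eta> using G by (simp add: G0_def)
  have G0eq: "0 < \<eta> \<Longrightarrow> G0 \<eta> = G \<eta>" for \<eta> by (simp add: G0_def)
  have cont: "continuous_on {0<..} G"
    using G1 by (auto simp: cond_G1_def intro: C1_differentiable_imp_continuous_on)
  have G0m[measurable]: "G0 \<in> borel_measurable borel"
    unfolding G0_def[abs_def] by (rule borel_measurable_continuous_on_if) (auto intro: cont)
  have [measurable]: "N \<in> borel_measurable borel" by (rule N)
  have N0: "0 < N \<theta>" if "\<theta> \<noteq> 0" for \<theta> using that N(3)[of \<theta>] zero_less_norm_iff[of \<theta>] by linarith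
  have "(\<lambda>\<theta>. G (N \<theta>)) = (\<lambda>\<theta>. if \<theta> = 0 then G (N 0) else G0 (N \<theta>))"
    using N0 G0eq by auto
  moreover have "(\<lambda>\<theta>. if \<theta> = 0 then G (N 0) else G0 (N \<theta>)) \<in> borel_measurable borel" by measurable
  ultimately have Gm: "(\<lambda>\<theta>. G (N \<theta>)) \<in> borel_measurable borel" by simp
  have fm[measurable]: "(\<lambda>y::real^'n. f (norm y)) \<in> borel_measurable borel"
  proof (rule measurable_compose[where f=norm and g=f])
    show "norm \<in> measurable borel (restrict_space borel {0..})"
      by (intro measurable_restrict_space2) auto
    show "f \<in> borel_measurable (restrict_space borel {0..})" using f by (simp add: radial_density_def)
  qed
  have fnn: "0 \<le> f r" if "0 \<le> r" for r using f that by (simp add: radial_density_def)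
  have fint: "(\<integral>\<^sup>+y. ennreal (f (norm (y :: real^'n))) \<partial>lborel) = 1" using f by (simp add: radial_density_def)
  obtain r0' L where L: "0 < L" "\<And>r. r0' \<le> r \<Longrightarrow> r powr (p + s) * f r \<le> L"
    using F1 by (auto simp: cond_F1_def p_def)
  define r0 where "r0 = max 1 r0'"
  have tail: "f r \<le> L * r powr (- (p + s))" if "r0 \<le> r" for r
  proof -
    have "f r \<le> L / r powr (p + s)" using L(2)[of r] that by (simp add: r0_def pos_le_divide_eq mult.commute)
    then show ?thesis unfolding powr_minus_divide by simp
  qed
  \<comment> \<open>Below \<open>r0\<close> the square is bounded and \<open>f\<close> has mass 1.
    Beyond it, \<open>3 < s\<close> makes the power \<open>p + s - 2\<close> exceed the
    dimension.\<close>
  have moment: "(\<integral>\<^sup>+y. ennreal (f (norm (y :: real^'n)) * (norm y)\<^sup>2) \<partial>lborel) < \<infinity>"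
  proof -
    have "(\<integral>\<^sup>+y. ennreal (f (norm (y :: real^'n)) * (norm y)\<^sup>2) \<partial>lborel) \<le>
      (\<integral>\<^sup>+y. ennreal (r0\<^sup>2) * ennreal (f (norm (y :: real^'n))) + ennreal L * (ennreal (norm y powr (- (p + s - 2))) * indicator {y. 1 \<le> norm y} y) \<partial>lborel)"
    proof (rule nn_integral_mono)
      fix y :: "real^'n"
      show "ennreal (f (norm y) * (norm y)\<^sup>2) \<le> ennreal (r0\<^sup>2) * ennreal (f (norm y)) + ennreal L * (ennreal (norm y powr (- (p + s - 2))) * indicator {y. 1 \<le> norm y} y)"
      proof (cases "norm y \<le> r0")
        case True
        then have "f (norm y) * (norm y)\<^sup>2 \<le> r0\<^sup>2 * f (norm y)"
          using fnn by (subst mult.commute) (intro mult_right_mono power_mono, auto)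
        then have "ennreal (f (norm y) * (norm y)\<^sup>2) \<le> ennreal (r0\<^sup>2) * ennreal (f (norm y))"
          using fnn by (simp add: ennreal_mult[symmetric] ennreal_leI)
        then show ?thesis by (simp add: add_increasing2)
      next
        case False
        then have y: "1 \<le> norm y" "r0 \<le> norm y" by (auto simp: r0_def)
        have "f (norm y) * (norm y)\<^sup>2 \<le> L * norm y powr (- (p + s)) * (norm y)\<^sup>2"
          using tail[OF y(2)] by (intro mult_right_mono) auto
        also have "\<dots> = L * norm y powr (- (p + s - 2))"
        proof -
          have e2: "- (p + s - 2) = - (p + s) + 2" by simp
          have "norm y powr (- (p + s - 2)) = norm y powr (- (p + s)) * (norm y)\<^sup>2"
            unfolding e2 powr_add using y by simp
          then show ?thesis by simp
        qed
        finally have "ennreal (f (norm y) * (norm y)\<^sup>2) \<le> ennreal (L * norm y powr (- (p + s - 2)))" by (rule ennreal_leI)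
        then show ?thesis using L y by (simp add: ennreal_mult add_increasing)
      qed
    qed
    also have "\<dots> = ennreal (r0\<^sup>2) + ennreal L * (\<integral>\<^sup>+y. ennreal (norm (y::real^'n) powr (- (p + s - 2))) * indicator {y. 1 \<le> norm y} y \<partial>lborel)"
      by (simp add: nn_integral_add nn_integral_cmult fint)
    also have "\<dots> < \<infinity>"
      using nn_integral_homogeneous_powr[of "norm :: real^'n \<Rightarrow> real" "p + s - 2"] s p by (simp add: p_def ennreal_mult_less_top)
    finally show ?thesis .
  qed
  have \<gamma>: "0 < \<gamma>" "\<gamma> \<le> 2" and G2int: "(\<integral>\<^sup>+\<eta>\<in>{1..}. ennreal (\<eta> powr (p - 1) * G \<eta> * H1 \<beta> \<eta> powr \<gamma>) \<partial>lborel) < \<infinity>"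
    using G2 by (auto simp: cond_G2_def p_def)
  \<comment> \<open>The slack in \<open>b \<le> p + s - 2\<close> and in
    \<open>p < 2 * a + t1 - 2 * e\<close> in the limiting case \<open>e = 1\<close>,
    \<open>b = \<gamma>\<close>.\<close>
  define gap where "gap = min (p + s - 2 - \<gamma>) (p + 2 * s - 4 - 2 * \<gamma> + t1)"
  have s': "3 + \<gamma> - t1 - p < s" using s by (simp add: p_def)
  have gap: "0 < gap" using s(1) s' p \<gamma> unfolding gap_def by simp
  \<comment> \<open>Raising \<open>e\<close> to \<open>1 + \<epsilon>\<close> uses up
    \<open>2 * (\<gamma> * \<epsilon>) + 2 * \<epsilon>\<close> of the second slack, which is at
    most \<open>6 * \<epsilon>\<close> and so at most half of \<open>gap\<close>. The cap 1/2 keeps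
    \<open>\<gamma> * \<epsilon>\<close> at most 1, as used for
    \<open>0 \<le> a + t1\<close>.\<close>
  define \<epsilon> where "\<epsilon> = min (1/2) (gap / 12)"
  have \<epsilon>: "0 < \<epsilon>" "\<epsilon> \<le> 1/2" "12 * \<epsilon> \<le> gap" using gap by (auto simp: \<epsilon>_def)
  have \<gamma>\<epsilon>: "0 \<le> \<gamma> * \<epsilon>" "\<gamma> * \<epsilon> \<le> 2 * \<epsilon>" using \<gamma> \<epsilon> by (auto intro: mult_right_mono)
  define e where "e = 1 + \<epsilon>"
  \<comment> \<open>The lower bound of \<open>H1\<close> by the power \<open>- e\<close>, raised to
    the power \<gamma>, becomes one by the power \<open>- b\<close>.\<close>
  define b where "b = \<gamma> * e"
  have b_eq: "b = \<gamma> + \<gamma> * \<epsilon>" by (simp add: b_def e_def algebra_simps)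
  define a where "a = p + s - 1 - b"
  have exps: "0 \<le> b" "b \<le> p + s - 2" "0 \<le> a + t1" "p < 2 * a + t1 - 2 * e" "0 \<le> e"
  proof -
    have "gap \<le> p + s - 2 - \<gamma>" "gap \<le> p + 2 * s - 4 - 2 * \<gamma> + t1" by (auto simp: gap_def)
    moreover have "2 * (\<gamma> * \<epsilon>) + 2 * \<epsilon> < gap" using \<epsilon> \<gamma>\<epsilon> by linarith
    moreover have "2 * a + t1 - 2 * e - p = (p + 2 * s - 4 - 2 * \<gamma> + t1) - (2 * (\<gamma> * \<epsilon>) + 2 * \<epsilon>)"
      unfolding a_def b_eq e_def by (simp add: algebra_simps)
    ultimately show "p < 2 * a + t1 - 2 * e" by linarith
  next
    have "gap \<le> p + s - 2 - \<gamma>" by (simp add: gap_def)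
    then show "0 \<le> b" "b \<le> p + s - 2" "0 \<le> a + t1" "0 \<le> e"
      using s(1) s' p \<gamma> \<epsilon> \<gamma>\<epsilon> unfolding a_def b_eq e_def by linarith+
  qed
  interpret beta_fun \<beta> by unfold_locales (rule \<beta>)
  obtain h D Ch where
    h: "\<And>i. h i \<in> borel_measurable borel" "D \<in> borel_measurable borel" "1 \<le> Ch"
      "\<And>i \<eta>. 0 \<le> \<eta> \<Longrightarrow> 0 < h i \<eta>" "\<And>i \<eta>. 0 \<le> \<eta> \<Longrightarrow> h 0 \<eta> \<le> h i \<eta>" "\<And>i \<eta>. 0 \<le> \<eta> \<Longrightarrow> h i \<eta> \<le> 1"
      "\<And>\<eta>. 0 \<le> \<eta> \<Longrightarrow> (\<lambda>i. h i \<eta>) \<longlonglongrightarrow> 1"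
      "\<And>i \<eta> u. 0 \<le> \<eta> \<Longrightarrow> \<eta> / 2 \<le> u \<Longrightarrow> u \<le> 2 * \<eta> \<Longrightarrow> h i u \<le> Ch * h i \<eta>"
      "\<And>i \<eta> u. 0 \<le> \<eta> \<Longrightarrow> \<eta> / 2 \<le> u \<Longrightarrow> u \<le> 2 * \<eta> \<Longrightarrow> h i \<eta> \<le> Ch * h i u"
      "\<And>i \<eta> u. 0 \<le> \<eta> \<Longrightarrow> \<eta> / 2 \<le> u \<Longrightarrow> u \<le> 2 * \<eta> \<Longrightarrow> \<bar>h i u - h i \<eta>\<bar> \<le> Ch * \<bar>u - \<eta>\<bar> * D \<eta>"
      "\<And>i \<eta>. 0 \<le> \<eta> \<Longrightarrow> h i \<eta> \<le> real (Suc i) * D \<eta>"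
      "\<And>\<eta>. 0 \<le> \<eta> \<Longrightarrow> 0 < D \<eta>"
      "\<And>\<eta>. 1 \<le> \<eta> \<Longrightarrow> D \<eta> \<le> Ch * H1 \<beta> \<eta>"
      "\<And>e. 1 < e \<Longrightarrow> \<exists>c>0. \<forall>\<eta>\<ge>0. c * (1 + \<eta>) powr (- e) \<le> h 0 \<eta> \<and> c * (1 + \<eta>) powr (- e) \<le> H1 \<beta> \<eta>"
    using beta_weights by blast
  have [measurable]: "h i \<in> borel_measurable borel" "D \<in> borel_measurable borel" for i by (rule h)+
  obtain ch where ch: "0 < ch" "\<And>\<eta>. 0 \<le> \<eta> \<Longrightarrow> ch * (1 + \<eta>) powr (- e) \<le> h 0 \<eta>" "\<And>\<eta>. 0 \<le> \<eta> \<Longrightarrow> ch * (1 + \<eta>) powr (- e) \<le> H1 \<beta> \<eta>"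
    using h(14)[of e] \<epsilon> by (auto simp: e_def)
  obtain R CG cG where R: "1 \<le> R" "1 \<le> CG" "0 < cG"
    "\<And>u \<eta>. R \<le> u \<Longrightarrow> \<eta> / 2 \<le> u \<Longrightarrow> u \<le> 2 * \<eta> \<Longrightarrow> R \<le> \<eta> \<Longrightarrow> G u \<le> CG * G \<eta>"
    "\<And>\<eta>. R \<le> \<eta> \<Longrightarrow> cG * \<eta> powr t1 \<le> G \<eta>"
    using prior_growth[OF G G1] by blast
  obtain M where M: "0 < M" "\<And>\<eta>. 0 < \<eta> \<Longrightarrow> \<eta> \<le> 1 \<Longrightarrow> \<eta> ^ (CARD('n) - 1) * G \<eta> \<le> M"
    using prior_near_0[OF G G1 G3, of 1] by auto
  have H1_le: "H1 \<beta> \<eta> \<le> 1" "0 \<le> H1 \<beta> \<eta>" if "0 \<le> \<eta>" for \<eta>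
    using H1_bounds(1)[OF that] order_trans[OF mult_nonneg_nonneg ch(3)[OF that]] ch(1) by auto
  \<comment> \<open>Transfers G2: whatever is at most a constant times
    \<open>H1 powr \<gamma>\<close> is integrable against the prior at infinity. It is applied to
    \<open>(1 + r) powr (- b)\<close> and to \<open>(D r)\<^sup>2\<close>.\<close>
  have radial: "(\<integral>\<^sup>+r\<in>{1..}. ennreal (G0 r * \<phi> r) * ennreal (r ^ (DIM(real^'n) - 1)) \<partial>lborel) < \<infinity>"
    if [measurable]: "\<phi> \<in> borel_measurable borel" and "0 < k" and \<phi>: "\<And>r. 1 \<le> r \<Longrightarrow> 0 \<le> \<phi> r \<and> k * \<phi> r \<le> H1 \<beta> r powr \<gamma>" for \<phi> k
  proof (rule nn_integral_finite_scale[OF _ \<open>0 < k\<close> _ G2int])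
    fix r
    show "ennreal k * (ennreal (G0 r * \<phi> r) * ennreal (r ^ (DIM(real^'n) - 1)) * indicator {1..} r) \<le>
        ennreal (r powr (p - 1) * G r * H1 \<beta> r powr \<gamma>) * indicator {1..} r"
    proof (cases "1 \<le> r")
      case True
      have "r powr (p - 1) = r ^ (CARD('n) - 1)"
        using True by (simp add: p_def powr_realpow[symmetric] of_nat_diff Suc_leI)
      then have "k * (G0 r * \<phi> r * r ^ (CARD('n) - 1)) = (r powr (p - 1) * G r) * (k * \<phi> r)" using True by (simp add: G0eq)
      also have "\<dots> \<le> (r powr (p - 1) * G r) * H1 \<beta> r powr \<gamma>"
        using \<phi>[OF True] G True by (intro mult_left_mono) (auto intro!: mult_nonneg_nonneg less_imp_le)
      finally show ?thesis
        using True \<open>0 < k\<close> \<phi>[OF True] less_imp_le[OF G0pos[of r]] by (simp add: ennreal_mult[symmetric] ennreal_leI)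
    qed simp
  qed measurable
  have Gb: "(\<integral>\<^sup>+\<theta>. ennreal (G0 (N \<theta>) * (1 + N \<theta>) powr (- b)) \<partial>lborel) < \<infinity>"
  proof (rule nn_integral_radial_finite[OF N(1-3), where \<psi>="\<lambda>r. ennreal (G0 r * (1 + r) powr (- b))"])
    show "ennreal (G0 r * (1 + r) powr (- b)) * ennreal (r ^ (DIM(real^'n) - 1)) \<le> ennreal M" if r: "0 < r" "r < 1" for r
    proof -
      have "(1 + r) powr (- b) \<le> 1" using r exps by (simp add: powr_minus ge_one_powr_ge_zero inverse_le_1_iff)
      then have "(r ^ (CARD('n) - 1) * G r) * (1 + r) powr (- b) \<le> M * 1"
        using M(2)[of r] M(1) r by (intro mult_mono) auto
      then show ?thesis
        using r G by (simp add: ennreal_mult'[symmetric] G0eq mult_ac ennreal_leI less_imp_le)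
    qed
    show "(\<integral>\<^sup>+r\<in>{1..}. ennreal (G0 r * (1 + r) powr (- b)) * ennreal (r ^ (DIM(real^'n) - 1)) \<partial>lborel) < \<infinity>"
    proof (rule radial)
      show "0 < ch powr \<gamma>" using ch by simp
      fix r :: real assume r: "1 \<le> r"
      have "ch powr \<gamma> * (1 + r) powr (- b) = (ch * (1 + r) powr (- e)) powr \<gamma>"
        using ch r by (simp add: powr_mult powr_powr b_def mult.commute)
      also have "\<dots> \<le> H1 \<beta> r powr \<gamma>" using ch r \<gamma> by (intro powr_mono2) auto
      finally show "0 \<le> (1 + r) powr (- b) \<and> ch powr \<gamma> * (1 + r) powr (- b) \<le> H1 \<beta> r powr \<gamma>" by simp
    qed measurable
  qed measurable
  have GD: "(\<integral>\<^sup>+\<theta>. ennreal (G0 (N \<theta>) * (D (N \<theta>))\<^sup>2) * indicator {\<theta>. 1 \<le> N \<theta>} \<theta> \<partial>lborel) < \<infinity>"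
  proof -
    have "(\<integral>\<^sup>+\<theta>. (\<lambda>r. ennreal (G0 r * (D r)\<^sup>2) * indicator {1..} r) (N \<theta>) \<partial>lborel) < \<infinity>"
    proof (rule nn_integral_radial_finite[OF N(1-3), where M=0])
      have "(\<integral>\<^sup>+r\<in>{1..}. ennreal (G0 r * (D r)\<^sup>2) * ennreal (r ^ (DIM(real^'n) - 1)) \<partial>lborel) < \<infinity>"
      proof (rule radial)
        show "0 < 1 / Ch\<^sup>2" using h(3) by simp
        fix r :: real assume r: "1 \<le> r"
        have "(D r)\<^sup>2 \<le> (Ch * H1 \<beta> r)\<^sup>2" using h(12,13)[of r] r by (intro power_mono) auto
        then have "1 / Ch\<^sup>2 * (D r)\<^sup>2 \<le> (H1 \<beta> r)\<^sup>2" using h(3) by (simp add: power_mult_distrib field_simps)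
        also have "\<dots> \<le> H1 \<beta> r powr \<gamma>"
        \<comment> \<open>Since \<open>H1\<close> is at most 1, the exponent
          \<open>\<gamma> \<le> 2\<close> gives the larger power. The value 0, where both sides
          vanish, is split off so that powers of a positive base are compared.\<close>
        proof (cases "H1 \<beta> r = 0")
          case False
          then have "0 < H1 \<beta> r" using H1_le[of r] r by simp
          then have "(H1 \<beta> r)\<^sup>2 = H1 \<beta> r powr 2" by simp
          also have "\<dots> \<le> H1 \<beta> r powr \<gamma>" using \<open>0 < H1 \<beta> r\<close> H1_le[of r] r \<gamma> by (intro powr_mono') auto
          finally show ?thesis .
        qed simp
        finally show "0 \<le> (D r)\<^sup>2 \<and> 1 / Ch\<^sup>2 * (D r)\<^sup>2 \<le> H1 \<beta> r powr \<gamma>" by simp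
      qed measurable
      then show "(\<integral>\<^sup>+r\<in>{1..}. ennreal (G0 r * (D r)\<^sup>2) * indicator {1..} r * ennreal (r ^ (DIM(real^'n) - 1)) \<partial>lborel) < \<infinity>"
        by (rule le_less_trans[rotated]) (intro nn_integral_mono, auto split: split_indicator)
    qed (auto split: split_indicator)
    then show ?thesis by (simp add: indicator_def)
  qed
  have Gh: "(\<integral>\<^sup>+\<theta>. ennreal (G0 (N \<theta>) * (h i (N \<theta>))\<^sup>2) \<partial>lborel) < \<infinity>" for i
  proof -
    have [measurable]: "{\<theta>. 1 \<le> N \<theta>} \<in> sets borel" by measurable
    have "(\<integral>\<^sup>+\<theta>. ennreal (G0 (N \<theta>) * (h i (N \<theta>))\<^sup>2) \<partial>lborel) \<le>
      (\<integral>\<^sup>+\<theta>. ennreal (2 powr b) * ennreal (G0 (N \<theta>) * (1 + N \<theta>) powr (- b)) +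
        ennreal ((real (Suc i))\<^sup>2) * (ennreal (G0 (N \<theta>) * (D (N \<theta>))\<^sup>2) * indicator {\<theta>. 1 \<le> N \<theta>} \<theta>) \<partial>lborel)"
    proof (rule nn_integral_mono)
      fix \<theta>
      have N0: "0 \<le> N \<theta>" using N(3)[of \<theta>] norm_ge_zero[of \<theta>] by linarith
      note hp = h(4)[OF N0, of i] h(6)[OF N0, of i] h(11)[OF N0, of i] h(12)[OF N0] and Gp = G0pos[of "N \<theta>"]
      show "ennreal (G0 (N \<theta>) * (h i (N \<theta>))\<^sup>2) \<le> ennreal (2 powr b) * ennreal (G0 (N \<theta>) * (1 + N \<theta>) powr (- b)) +
        ennreal ((real (Suc i))\<^sup>2) * (ennreal (G0 (N \<theta>) * (D (N \<theta>))\<^sup>2) * indicator {\<theta>. 1 \<le> N \<theta>} \<theta>)"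
      \<comment> \<open>Away from the origin \<open>h i\<close> is at most a multiple of
        \<open>D\<close>, with a factor that may depend on \<open>i\<close>. Near it only
        \<open>h i \<le> 1\<close> is used, and \<open>(1 + N \<theta>) powr (- b)\<close> is
        bounded below by \<open>2 powr (- b)\<close>.\<close>
      proof (cases "1 \<le> N \<theta>")
        case True
        have "(h i (N \<theta>))\<^sup>2 \<le> (real (Suc i) * D (N \<theta>))\<^sup>2" using hp by (intro power_mono) auto
        then have "G0 (N \<theta>) * (h i (N \<theta>))\<^sup>2 \<le> (real (Suc i))\<^sup>2 * (G0 (N \<theta>) * (D (N \<theta>))\<^sup>2)"
          using Gp mult_left_mono[of _ _ "G0 (N \<theta>)"] by (simp add: power_mult_distrib mult_ac)
        then have "ennreal (G0 (N \<theta>) * (h i (N \<theta>))\<^sup>2) \<le> ennreal ((real (Suc i))\<^sup>2 * (G0 (N \<theta>) * (D (N \<theta>))\<^sup>2))"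
          by (rule ennreal_leI)
        also have "\<dots> = ennreal ((real (Suc i))\<^sup>2) * ennreal (G0 (N \<theta>) * (D (N \<theta>))\<^sup>2)"
          using Gp by (intro ennreal_mult) auto
        finally show ?thesis using True by (simp add: add_increasing)
      next
        case False
        have "(h i (N \<theta>))\<^sup>2 \<le> 1" using hp by (simp add: power_le_one)
        also have "1 = 2 powr b * 2 powr (- b)" by (simp add: powr_minus)
        also have "\<dots> \<le> 2 powr b * (1 + N \<theta>) powr (- b)"
          using False N0 exps by (intro mult_left_mono powr_mono2') auto
        finally have "G0 (N \<theta>) * (h i (N \<theta>))\<^sup>2 \<le> 2 powr b * (G0 (N \<theta>) * (1 + N \<theta>) powr (- b))"
          using Gp mult_left_mono[of _ _ "G0 (N \<theta>)"] by (simp add: mult_ac)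
        then have "ennreal (G0 (N \<theta>) * (h i (N \<theta>))\<^sup>2) \<le> ennreal (2 powr b * (G0 (N \<theta>) * (1 + N \<theta>) powr (- b)))"
          by (rule ennreal_leI)
        also have "\<dots> = ennreal (2 powr b) * ennreal (G0 (N \<theta>) * (1 + N \<theta>) powr (- b))"
          using Gp by (intro ennreal_mult) auto
        finally show ?thesis by (simp add: add_increasing2)
      qed
    qed
    also have "\<dots> = ennreal (2 powr b) * (\<integral>\<^sup>+\<theta>. ennreal (G0 (N \<theta>) * (1 + N \<theta>) powr (- b)) \<partial>lborel) +
        ennreal ((real (Suc i))\<^sup>2) * (\<integral>\<^sup>+\<theta>. ennreal (G0 (N \<theta>) * (D (N \<theta>))\<^sup>2) * indicator {\<theta>. 1 \<le> N \<theta>} \<theta> \<partial>lborel)"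
      by (subst nn_integral_add; (subst nn_integral_cmult)?; measurable?) (simp add: nn_integral_cmult)
    also have "\<dots> < \<infinity>" using Gb GD by (simp add: ennreal_mult_less_top)
    finally show ?thesis .
  qed
  define C where "C = max Ch CG"
  define c where "c = min ch cG"
  have C: "1 \<le> C" "Ch \<le> C" "CG \<le> C" using h(3) R by (auto simp: C_def)
  have c: "0 < c" "c \<le> ch" "c \<le> cG" using ch R by (auto simp: c_def)
  have CC: "x \<le> C * y" if "x \<le> Ch * y" "0 \<le> y" for x y
    using that C mult_right_mono[of Ch C y] by linarith
  interpret prior_sequence N f G0 D h p \<kappa> r0 L s R C c t1 e b a
    "\<integral>y. f (norm (y::real^'n)) * norm y \<partial>lborel" "\<integral>y. f (norm (y::real^'n)) * (norm y)\<^sup>2 \<partial>lborel"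
  proof
    show "norm x \<le> N x" "N x \<le> \<kappa> * norm x" "\<bar>N x - N y\<bar> \<le> N (x - y)" for x y
      using N(3-5) by (auto simp: \<kappa>_def)
    show "f r \<le> L * r powr (- (p + s))" if "r0 \<le> r" for r using tail that by simp
    show "1 \<le> r0" by (simp add: r0_def)
    show "G0 u \<le> C * G0 \<eta>" if "R \<le> u" "\<eta> / 2 \<le> u" "u \<le> 2 * \<eta>" "R \<le> \<eta>" for u \<eta>
    proof -
      have \<eta>: "0 < u" "0 < \<eta>" using that R(1) by linarith+
      have "CG * G \<eta> \<le> C * G \<eta>" using C(3) G \<eta> by (intro mult_right_mono) (auto simp: less_imp_le)
      then have "G u \<le> C * G \<eta>" using R(4)[OF that] by linarith
      then show ?thesis using \<eta> by (simp add: G0eq)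
    qed
    show "c * \<eta> powr t1 \<le> G0 \<eta>" if "R \<le> \<eta>" for \<eta>
    proof -
      have "c * \<eta> powr t1 \<le> cG * \<eta> powr t1" using c(3) by (intro mult_right_mono) auto
      then have "c * \<eta> powr t1 \<le> G \<eta>" using R(5)[OF that] by linarith
      then show ?thesis using that R(1) by (simp add: G0eq)
    qed
    show "h i u \<le> C * h i \<eta>" "h i \<eta> \<le> C * h i u" if "0 \<le> \<eta>" "\<eta> / 2 \<le> u" "u \<le> 2 * \<eta>" for i \<eta> u
      using h(8,9)[OF that] h(4)[of \<eta> i] h(4)[of u i] that by (auto intro!: CC)
    show "\<bar>h i u - h i \<eta>\<bar> \<le> C * \<bar>u - \<eta>\<bar> * D \<eta>" if "0 \<le> \<eta>" "\<eta> / 2 \<le> u" "u \<le> 2 * \<eta>" for i \<eta> u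
      using h(10)[OF that, of i] h(12)[of \<eta>] that CC[of "\<bar>h i u - h i \<eta>\<bar>" "\<bar>u - \<eta>\<bar> * D \<eta>"] by (simp add: mult.assoc)
    show "c * (1 + \<eta>) powr (- e) \<le> h 0 \<eta>" if "0 \<le> \<eta>" for \<eta>
    proof -
      have "c * (1 + \<eta>) powr (- e) \<le> ch * (1 + \<eta>) powr (- e)" using c(2) by (intro mult_right_mono) auto
      then show ?thesis using ch(2)[OF that] by linarith
    qed
    show "(\<integral>\<^sup>+\<theta>. ennreal (N \<theta> powr (- q)) * indicator {\<theta>. 1 \<le> N \<theta>} \<theta> \<partial>lborel) < \<infinity>" if "p < q" for q
      using nn_integral_homogeneous_powr[OF N(1-3), of q] that by (simp add: p_def)
  qed (use fnn fint L moment G0pos R C c h exps Gb GD Gh in \<open>auto simp: p_def a_def\<close>)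
  have "admissible_estimator f Q (gen_bayes f g)" by (rule gen_bayes_admissible[OF Q])
  moreover have "gen_bayes f g = gen_bayes f (\<lambda>\<theta>. G (N \<theta>))"
  proof (rule gen_bayes_cong_AE[OF fm g_meas Gm])
    show "AE \<theta> in lborel. g \<theta> = G (N \<theta>)"
      using AE_lborel_singleton[of "0::real^'n"] by eventually_elim (simp add: g_def G0eq N0)
  qed
  ultimately show ?thesis by (simp add: N_def)
qed

theorem theorem3p1:
  fixes p :: nat
    and f G \<beta> :: "real \<Rightarrow> real"
    and d :: "real ^ 'n::{finite,linorder}"
    and Q :: "real ^ 'n::{finite,linorder} ^ 'n::{finite,linorder}"
    and t1 t2 \<gamma> s :: real
  assumes p: "p = CARD('n::{finite,linorder})"
    and d: "antimono (\<lambda>i. d $ i)" "\<forall>i. 1 \<le> d $ i"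
    and Q: "positive_definite Q"
    and f: "radial_density f TYPE(real ^ 'n::{finite,linorder})"
    and G: "\<forall>\<eta>>0. 0 < G \<eta>"
    and \<beta>: "beta_function \<beta>"
    and standing: "- real p \<le> t2" "t1 \<le> 2 - real p"
    and G1: "cond_G1 G t1 t2"
    and G2: "cond_G2 p \<beta> G \<gamma>"
    and G3: "cond_G3 p G"
    and F1: "cond_F1 p f s"
    and FG1: "cond_FG1 p f G"
  shows
    "(s > 2 + max 1 (1 + \<gamma> - t1 - real p) \<and> t2 < 2 - real p \<longrightarrow>
        admissible_estimator f Q (gen_bayes f (\<lambda>\<theta>. G (norm_d d \<theta>)))) \<and>
     (\<forall>t3 t4. cond_G1' G t1 t2 \<and> cond_G1'' G t3 t4 \<and>
        s > 2 + Max {1, 3 - t1 - real p, t2, 2 - t3 - real p, t4} \<and> t2 \<ge> 2 - real p \<longrightarrow>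
        admissible_estimator f Q (gen_bayes f (\<lambda>\<theta>. G (norm_d d \<theta>))))"
proof -
  have adm: "admissible_estimator f Q (gen_bayes f (\<lambda>\<theta>. G (norm_d d \<theta>)))"
    if "3 < s" "3 + \<gamma> - t1 - real p < s"
    using admissible_gen_bayes_radial[OF d(2) Q f G \<beta> G1] G2 G3 F1 that by (simp add: p)
  have "\<gamma> \<le> 2" using G2 by (simp add: cond_G2_def)
  then show ?thesis using adm by auto
qed

end
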